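(* Consider the linear structural error-in-variables model $y_i=\beta\xi_i+\alpha+\delta_i$, $x_i=\xi_i+\varepsilon_i$, $i\ge1$, with real-valued slope $\beta$ and intercept $\alpha$, where $\alpha$ is either known to be zero ($c=0$ in the context) or unknown ($c=1$). Assume (A), (B) and (C) of the context. Then, for $j=1$ and $2$, as $n\to\infty$, (a) $\displaystyle \sqrt{n}\,U(j,n)(\widehat{\beta}_{jn}-\beta)\Big(\sum_{i=1}^{n}\big(u_i(j,n)-\overline{u(j,n)}\big)^2/(n-1)\Big)^{-1/2}\xrightarrow{\mathcal{D}}N(0,1)$, (b) $\displaystyle n\,U(j,n)(\widehat{\beta}_{jn}-\beta)\Big(\sum_{i=1}^{n}u_i^2(j,n)\Big)^{-1/2}\xrightarrow{\mathcal{D}}N(0,1)$, and also $\displaystyle n\,U(j,n)(\widehat{\beta}_{jn}-\beta)\Big(\sum_{i=1}^{n}\widetilde u_i^2(j,n)\Big)^{-1/2}\xrightarrow{\mathcal{D}}N(0,1)$.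
   Context: Assumptions. (A) $\{(\delta,\varepsilon),(\delta_i,\varepsilon_i),i\ge1\}$ is a sequence of i.i.d. random vectors with mean zero, $E\delta^4<\infty$, $E\varepsilon^4<\infty$, and positive definite covariance matrix $\Gamma=\begin{pmatrix}\lambda\theta&\mu\\ \mu&\theta\end{pmatrix}$, i.e. $\mathrm{Var}\,\delta=\lambda\theta$, $\mathrm{Var}\,\varepsilon=\theta$, $\mathrm{cov}(\delta,\varepsilon)=\mu$. (B) $\{\xi,\xi_i,i\ge1\}$ are i.i.d. random variables in the domain of attraction of the normal law (DAN), i.e. there are constants $a_n$ and $b_n$, $b_n>0$, for which $(\sum_{i=1}^n\xi_i-a_n)b_n^{-1}\xrightarrow{\mathcal D}N(0,1)$ as $n\to\infty$. (C) $(\delta,\varepsilon)$ and $\xi$ are independent; in the structural model the explanatory variables $\xi_i$ are independent of the error terms $(\delta_i,\varepsilon_i)$. Notation. For real-valued variables $u_i,v_i$, $1\le i\le n$: $\overline u=\frac1n\sum_{i=1}^nu_i$, $s_{i,uv}=(u_i-c\,\overline u)(v_i-c\,\overline v)$, $S_{uv}=\frac1n\sum_{i=1}^ns_{i,uv}$, where $c=0$ if $\alpha$ is known to be zero and $c=1$ if $\alpha$ is unknown. The case $j=1$ is used when $\lambda\theta$ and $\mu$ are known and $\theta$ is unknown: $\widehat\beta_{1n}=\dfrac{S_{yy}-\lambda\theta}{S_{xy}-\mu}$, if $S_{xy}-\mu\ne0$ and $S_{yy}-\lambda\theta>0$. The case $j=2$ is used when $\theta$ and $\mu$ are known and $\lambda\theta$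 is unknown: $\widehat\beta_{2n}=\dfrac{S_{xy}-\mu}{S_{xx}-\theta}$, if $S_{xx}-\theta>0$. Furthermore $$U(1,n)=S_{xy}-\mu,\quad U(2,n)=S_{xx}-\theta,$$ $$u_i(1,n)=(s_{i,yy}-\lambda\theta)-\beta(s_{i,xy}-\mu),\quad u_i(2,n)=(s_{i,xy}-\mu)-\beta(s_{i,xx}-\theta),$$ $$\widetilde u_i(1,n)=(s_{i,yy}-\lambda\theta)-\widehat\beta_{1n}(s_{i,xy}-\mu),\quad \widetilde u_i(2,n)=(s_{i,xy}-\mu)-\widehat\beta_{2n}(s_{i,xx}-\theta),$$ and $\overline{u(j,n)}=\frac1n\sum_{i=1}^nu_i(j,n)$.
   Formalization: For j=1 the slope β is assumed nonzero; if β=0, the condition S_yy−λθ>0 defining the estimator fails with probability not tending to 0 (e.g. δ=±1 with probability 1/2, c=α=0: it never holds), so the claim has no meaning there. *)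

theory Defs
  imports "HOL-Probability.Probability"
begin

definition pos_def :: "real ^ 'n ^ 'n \<Rightarrow> bool" where
  "pos_def A \<longleftrightarrow> transpose A = A \<and> (\<forall>v. v \<noteq> 0 \<longrightarrow> v \<bullet> (A *v v) > 0)"

context prob_space
begin

definition iid :: "'b measure \<Rightarrow> (nat \<Rightarrow> 'a \<Rightarrow> 'b) \<Rightarrow> bool" where
  "iid N X \<longleftrightarrow> indep_vars (\<lambda>_. N) X UNIV \<and> (\<forall>i. distr M N (X i) = distr M N (X 0))"

(* The library's indep_var wants both variables to have the same value type. *)
definition indep_rv :: "'b measure \<Rightarrow> ('a \<Rightarrow> 'b) \<Rightarrow> 'c measure \<Rightarrow> ('a \<Rightarrow> 'c) \<Rightarrow> bool" where
  "indep_rv N X L Y \<longleftrightarrow> random_variable N X \<and> random_variable L Y \<and>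
     indep_set {X -` A \<inter> space M | A. A \<in> sets N} {Y -` B \<inter> space M | B. B \<in> sets L}"

definition covariance :: "('a \<Rightarrow> real) \<Rightarrow> ('a \<Rightarrow> real) \<Rightarrow> real" where
  "covariance X Y = expectation (\<lambda>\<omega>. (X \<omega> - expectation X) * (Y \<omega> - expectation Y))"

definition conv_std_normal :: "(nat \<Rightarrow> 'a \<Rightarrow> real) \<Rightarrow> bool" where
  "conv_std_normal Z \<longleftrightarrow> weak_conv_m (\<lambda>n. distr M borel (Z n)) std_normal_distribution"

(* Domain of attraction of the normal law, for an i.i.d. sequence X. *)
definition DAN :: "(nat \<Rightarrow> 'a \<Rightarrow> real) \<Rightarrow> bool" where
  "DAN X \<longleftrightarrow> (\<exists>a b :: nat \<Rightarrow> real. (\<forall>n. b n > 0) \<and>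
     conv_std_normal (\<lambda>n \<omega>. ((\<Sum>i=1..n. X i \<omega>) - a n) / b n))"

end

(* Sample quantities for data u 1, ..., u n (the entry u 0 is never used). *)

definition smean :: "nat \<Rightarrow> (nat \<Rightarrow> real) \<Rightarrow> real" where
  "smean n u = (\<Sum>i=1..n. u i) / real n"

definition sprod :: "real \<Rightarrow> nat \<Rightarrow> (nat \<Rightarrow> real) \<Rightarrow> (nat \<Rightarrow> real) \<Rightarrow> nat \<Rightarrow> real" where
  "sprod c n u v i = (u i - c * smean n u) * (v i - c * smean n v)"

definition S :: "real \<Rightarrow> nat \<Rightarrow> (nat \<Rightarrow> real) \<Rightarrow> (nat \<Rightarrow> real) \<Rightarrow> real" where
  "S c n u v = smean n (sprod c n u v)"

(* In what follows lam * th = Var \<delta>, th = Var \<epsilon>, mu = cov(\<delta>, \<epsilon>). The argument j is 1 or 2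
   (anything other than 1 is treated as 2). Where the estimator is not defined, it takes the
   unspecified real value undefined, so nothing is assumed about it there. *)

definition beta_hat ::
    "nat \<Rightarrow> real \<Rightarrow> real \<Rightarrow> real \<Rightarrow> real \<Rightarrow> nat \<Rightarrow> (nat \<Rightarrow> real) \<Rightarrow> (nat \<Rightarrow> real) \<Rightarrow> real" where
  "beta_hat j c lam th mu n x y =
    (if j = 1 then
       (if S c n x y - mu \<noteq> 0 \<and> S c n y y - lam * th > 0
        then (S c n y y - lam * th) / (S c n x y - mu) else undefined)
     else
       (if S c n x x - th > 0
        then (S c n x y - mu) / (S c n x x - th) else undefined))"

definition U ::
    "nat \<Rightarrow> real \<Rightarrow> real \<Rightarrow> real \<Rightarrow> nat \<Rightarrow> (nat \<Rightarrow> real) \<Rightarrow> (nat \<Rightarrow> real) \<Rightarrow> real" where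
  "U j c th mu n x y = (if j = 1 then S c n x y - mu else S c n x x - th)"

(* For b = beta this is u_i(j,n); for b = beta_hat it is the version with a tilde. *)
definition u_resid ::
    "nat \<Rightarrow> real \<Rightarrow> real \<Rightarrow> real \<Rightarrow> real \<Rightarrow> real \<Rightarrow> nat \<Rightarrow> (nat \<Rightarrow> real) \<Rightarrow> (nat \<Rightarrow> real) \<Rightarrow> nat \<Rightarrow> real"
  where
  "u_resid j c lam th mu b n x y i =
    (if j = 1 then (sprod c n y y i - lam * th) - b * (sprod c n x y i - mu)
     else (sprod c n x y i - mu) - b * (sprod c n x x i - th))"

end

theory Submission
  imports Defs
begin

text \<open>
  Write \<open>z\<close> for \<open>y\<close> if \<open>j = 1\<close> and for \<open>x\<close> if \<open>j = 2\<close>, let \<open>\<eta> = \<delta> - \<beta>\<epsilon>\<close>, and let \<open>\<nu>\<close> be the error in \<open>z\<close>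
  (\<open>\<delta>\<close> or \<open>\<epsilon>\<close>). Subtracting \<open>c\<close> times the sample mean from all variables removes the intercept, and
  then \<open>y\<^sub>i - \<beta> x\<^sub>i\<close> becomes \<open>\<eta>\<^sub>i\<close>. Consequently \<open>u\<^sub>i = z\<^sub>i \<eta>\<^sub>i - E(\<nu>\<eta>)\<close> in the centred variables, and the
  definition of the estimator says that \<open>n U (bhat - \<beta>) = \<Sum> u\<^sub>i\<close> wherever the estimator is defined, which
  happens with probability tending to one. All three statistics are thus
  self-normalized sums of the \<open>u\<^sub>i\<close>, and the theorem is a central limit theorem for \<open>\<Sum> u\<^sub>i\<close> together with a
  law of large numbers for the three norms in the denominators.

  Both are obtained conditionally on the explanatory variables. Given \<open>\<xi>\<close>, the sum \<open>\<Sum> u\<^sub>i\<close> equals, up to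
  a multiple of the product of two error means, a sum of independent centred variables
  \<open>v\<^sub>i = g a\<^sub>i \<eta>\<^sub>i + \<zeta>\<^sub>i\<close>, where \<open>a\<^sub>i\<close> is the centred \<open>\<xi>\<^sub>i\<close>, \<open>g\<close> is \<open>\<beta>\<close> or \<open>1\<close>, and \<open>\<zeta>\<^sub>i = \<nu>\<^sub>i \<eta>\<^sub>i - E(\<nu>\<eta>)\<close>.
  With probability tending to one, the conditional variance \<open>V\<close> of this sum is at least a multiple of
  \<open>\<Sum> a\<^sub>i\<^sup>2 + n\<close>, since
  \<open>Var \<eta> > 0\<close> by positive definiteness and since \<open>\<xi>\<close> is not degenerate. The errors have enough
  moments for the Lindeberg condition to follow from \<open>\<Sum> a\<^sub>i^4 / (\<Sum> a\<^sub>i\<^sup>2)\<^sup>2 \<rightarrow> 0\<close> alone. The errors of the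
  normal approximation to \<open>\<Sum> v\<^sub>i / \<surd>V\<close> and of the approximation of \<open>\<Sum> v\<^sub>i\<^sup>2 / V\<close> by \<open>1\<close> are bounded by explicit
  functions of the Lindeberg sum (\<open>char_approx\<close>, \<open>sum_square_approx\<close>), so integrating over the law of
  \<open>\<xi>\<close> gives the unconditional limits \<open>score_clt\<close> and \<open>score_square_sum\<close>.

  The hypothesis on \<open>\<xi>\<close> therefore enters through two facts only: \<open>\<Sum> (\<xi>\<^sub>i - mean)\<^sup>2\<close> grows at least linearly
  (\<open>centred_ss_ge_linear\<close>), and \<open>\<Sum> (\<xi>\<^sub>i - mean)^4\<close> is negligible against its square (\<open>fourth_power_ratio\<close>).
  They are read off from characteristic functions. If \<open>X\<close> is the difference of two independent copies
  of \<open>\<xi>\<close>, then normal convergence with norming constants \<open>b\<^sub>n\<close> means \<open>n E(1 - cos(t X / b\<^sub>n)) \<rightarrow> t\<^sup>2\<close>. As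
  \<open>2 (1 - cos s)\<^sup>2 = 4 (1 - cos s) - (1 - cos 2s)\<close>, a quadratic limit forces
  \<open>2 n E(1 - cos(t X / b\<^sub>n))\<^sup>2 \<rightarrow> 4 t\<^sup>2 - (2 t)\<^sup>2 = 0\<close>. Averaging the last statement over a
  Gaussian \<open>t\<close> gives \<open>n P(|X| > \<tau> b\<^sub>n) \<rightarrow> 0\<close>, so no \<open>\<xi>\<^sub>i\<close> is far from \<open>\<xi>\<^sub>0\<close> on the scale \<open>b\<^sub>n\<close>; combined with the
  first limit it makes \<open>\<Sum> (1 - cos(X\<^sub>k / b\<^sub>n))\<close> over disjoint pairs concentrate around a positive constant,
  so the centred sum of squares is at least of order \<open>b\<^sub>n\<^sup>2\<close>.

  Finally, replacing \<open>v\<^sub>i\<close> by \<open>u\<^sub>i\<close>, by the centred \<open>u\<^sub>i\<close>, or by the residuals with the estimated slope changes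
  the Euclidean norm by \<open>o(\<surd>V)\<close> (\<open>res_norm_ratio\<close>, \<open>perturbed_norm_ratio\<close>), and Slutsky's lemma concludes.
\<close>

section \<open>Convergence in probability as convergence along a filter\<close>

context prob_space
begin

text \<open>
  The filter of statements about \<open>(n, \<omega>)\<close> that hold with probability tending to one. A limit along it
  is convergence in probability, so the calculus of limits (sums, products, square roots,
  squeezing) carries over to convergence in probability.
\<close>
definition whp :: "(nat \<times> 'a) filter" where
  "whp = (INF A\<in>{A. range A \<subseteq> events \<and> (\<lambda>n. prob (A n)) \<longlonglongrightarrow> 1}. principal (Sigma UNIV A))"

lemma eventually_whp:
  "eventually P whp \<longleftrightarrow>
     (\<exists>A. range A \<subseteq> events \<and> (\<lambda>n. prob (A n)) \<longlonglongrightarrow> 1 \<and> (\<forall>n. \<forall>\<omega>\<in>A n. P (n, \<omega>)))"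
proof -
  let ?W = "{A. range A \<subseteq> events \<and> (\<lambda>n. prob (A n)) \<longlonglongrightarrow> 1}"
  have "(\<lambda>n. space M) \<in> ?W"
    by (auto simp: prob_space)
  hence ne: "?W \<noteq> {}"
    by blast
  have inter: "\<exists>C\<in>?W. principal (Sigma UNIV C) \<le> inf (principal (Sigma UNIV A)) (principal (Sigma UNIV B))"
    if AB: "A \<in> ?W" "B \<in> ?W" for A B
  proof
    have [measurable]: "A n \<in> events" "B n \<in> events" for n
      using AB by auto
    have low: "prob (A n) + prob (B n) - 1 \<le> prob (A n \<inter> B n)" for n
      using finite_measure_Union'[of "A n" "B n"] finite_measure_Diff'[of "B n" "A n"]
        prob_le_1[of "A n \<union> B n"] by (simp add: Int_commute)
    have "(\<lambda>n. prob (A n) + prob (B n) - 1) \<longlonglongrightarrow> 1 + 1 - 1"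
      using AB by (intro tendsto_intros) auto
    hence lim: "(\<lambda>n. prob (A n) + prob (B n) - 1) \<longlonglongrightarrow> 1"
      by simp
    have "(\<lambda>n. prob (A n \<inter> B n)) \<longlonglongrightarrow> 1"
      by (rule tendsto_sandwich[OF _ _ lim tendsto_const]) (auto simp: low)
    thus "(\<lambda>n. A n \<inter> B n) \<in> ?W"
      by auto
    show "principal (Sigma UNIV (\<lambda>n. A n \<inter> B n))
            \<le> inf (principal (Sigma UNIV A)) (principal (Sigma UNIV B))"
      by auto
  qed
  have "eventually P whp \<longleftrightarrow> (\<exists>A\<in>?W. eventually P (principal (Sigma UNIV A)))"
    unfolding whp_def by (rule eventually_INF_base) (use ne inter in auto)
  thus ?thesis
    by (auto simp: eventually_principal)
qed

lemma eventually_whp_prob: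
  assumes "eventually P whp" and "\<And>n. {\<omega> \<in> space M. P (n, \<omega>)} \<in> events"
  shows "(\<lambda>n. prob {\<omega> \<in> space M. P (n, \<omega>)}) \<longlonglongrightarrow> 1"
proof -
  obtain A where A: "range A \<subseteq> events" "(\<lambda>n. prob (A n)) \<longlonglongrightarrow> 1" "\<forall>n. \<forall>\<omega>\<in>A n. P (n, \<omega>)"
    using assms(1) unfolding eventually_whp by blast
  have "prob (A n) \<le> prob {\<omega> \<in> space M. P (n, \<omega>)}" for n
    using A(1,3) assms(2) sets.sets_into_space[of "A n" M] by (intro finite_measure_mono) auto
  with A(2) show ?thesis
    by (intro tendsto_sandwich[OF _ _ A(2) tendsto_const]) auto
qed

lemma eventually_whpI:
  assumes "\<And>n. {\<omega> \<in> space M. P (n, \<omega>)} \<in> events"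
    and "(\<lambda>n. prob {\<omega> \<in> space M. P (n, \<omega>)}) \<longlonglongrightarrow> 1"
  shows "eventually P whp"
  unfolding eventually_whp using assms
  by (intro exI[of _ "\<lambda>n. {\<omega> \<in> space M. P (n, \<omega>)}"]) auto

text \<open>The form in which the union bound and Chebyshev's inequality deliver such statements.\<close>
lemma eventually_whpI_compl:
  assumes ev: "\<And>n. {\<omega> \<in> space M. \<not> P (n, \<omega>)} \<in> events"
    and 0: "(\<lambda>n. prob {\<omega> \<in> space M. \<not> P (n, \<omega>)}) \<longlonglongrightarrow> 0"
  shows "eventually P whp"
proof (rule eventually_whpI)
  have eq: "{\<omega> \<in> space M. P (n, \<omega>)} = space M - {\<omega> \<in> space M. \<not> P (n, \<omega>)}" for n
    by auto
  show "{\<omega> \<in> space M. P (n, \<omega>)} \<in> events" for n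
    unfolding eq using ev by auto
  have "(\<lambda>n. 1 - prob {\<omega> \<in> space M. \<not> P (n, \<omega>)}) \<longlonglongrightarrow> 1 - 0"
    by (intro tendsto_intros 0)
  thus "(\<lambda>n. prob {\<omega> \<in> space M. P (n, \<omega>)}) \<longlonglongrightarrow> 1"
    unfolding eq using ev by (simp add: prob_compl)
qed

lemma filterlim_fst_whp: "filterlim fst sequentially whp"
proof (unfold filterlim_iff, intro allI impI)
  fix P :: "nat \<Rightarrow> bool" assume P: "eventually P sequentially"
  show "eventually (\<lambda>p. P (fst p)) whp"
  proof (rule eventually_whpI)
    show "(\<lambda>n. prob {\<omega> \<in> space M. P (fst (n, \<omega>))}) \<longlonglongrightarrow> 1"
      by (rule tendsto_eventually, rule eventually_mono[OF P]) (auto simp: prob_space)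
  qed auto
qed

lemma eventually_whp_fst: "eventually P sequentially \<Longrightarrow> eventually (\<lambda>p. P (fst p)) whp"
  using filterlim_fst_whp unfolding filterlim_iff by blast

lemma eventually_whp_space: "eventually (\<lambda>p. snd p \<in> space M) whp"
  by (rule eventually_whpI) (auto simp: prob_space)

lemma eventually_whp_all: "(\<And>n \<omega>. \<omega> \<in> space M \<Longrightarrow> P (n, \<omega>)) \<Longrightarrow> eventually P whp"
  by (rule eventually_mono[OF eventually_whp_space]) auto

abbreviation conv_prob :: "(nat \<Rightarrow> 'a \<Rightarrow> 'b::topological_space) \<Rightarrow> 'b \<Rightarrow> bool" where
  "conv_prob Z z \<equiv> ((\<lambda>p. Z (fst p) (snd p)) \<longlongrightarrow> z) whp"

abbreviation likely :: "(nat \<Rightarrow> 'a \<Rightarrow> bool) \<Rightarrow> bool" where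
  "likely P \<equiv> eventually (\<lambda>p. P (fst p) (snd p)) whp"

lemma tendsto_whp_const: "X \<longlonglongrightarrow> l \<Longrightarrow> conv_prob (\<lambda>n \<omega>. X n) l"
  by (rule filterlim_compose[OF _ filterlim_fst_whp])

text \<open>Markov's inequality, applied to the truncated variable \<open>min 1 Z\<close>, whose mean always exists.\<close>
lemma tendsto_whp_min_expectation:
  fixes Z :: "nat \<Rightarrow> 'a \<Rightarrow> real"
  assumes [measurable]: "\<And>n. Z n \<in> borel_measurable M"
    and nonneg: "\<And>n \<omega>. \<omega> \<in> space M \<Longrightarrow> 0 \<le> Z n \<omega>"
    and 0: "(\<lambda>n. expectation (\<lambda>\<omega>. min 1 (Z n \<omega>))) \<longlonglongrightarrow> 0"
  shows "conv_prob (\<lambda>n \<omega>. Z n \<omega>) 0"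
proof (rule order_tendstoI)
  fix a :: real assume "a < 0"
  thus "likely (\<lambda>n \<omega>. a < Z n \<omega>)"
    by (intro eventually_whp_all) (auto intro: less_le_trans[OF _ nonneg])
next
  fix a :: real assume a: "0 < a"
  define e where "e = min 1 a"
  have e: "0 < e" "e \<le> 1" "e \<le> a"
    using a by (auto simp: e_def)
  have int: "integrable M (\<lambda>\<omega>. min 1 (Z n \<omega>))" for n
    by (rule integrable_const_bound[where B=1]) (use nonneg in \<open>auto intro!: AE_I2\<close>)
  have bnd: "prob {\<omega> \<in> space M. \<not> Z n \<omega> < e} \<le> expectation (\<lambda>\<omega>. min 1 (Z n \<omega>)) / e" for n
  proof -
    have "prob {\<omega> \<in> space M. \<not> Z n \<omega> < e} \<le> prob {\<omega> \<in> space M. e \<le> min 1 (Z n \<omega>)}"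
      using e by (intro finite_measure_mono) auto
    also have "\<dots> \<le> expectation (\<lambda>\<omega>. min 1 (Z n \<omega>)) / e"
      using int e nonneg
      by (intro integral_Markov_inequality_measure[where A="{}"]) (auto intro!: AE_I2)
    finally show ?thesis .
  qed
  have lim: "(\<lambda>n. expectation (\<lambda>\<omega>. min 1 (Z n \<omega>)) / e) \<longlonglongrightarrow> 0"
    using tendsto_divide_zero[OF 0] .
  have "(\<lambda>n. prob {\<omega> \<in> space M. \<not> Z n \<omega> < e}) \<longlonglongrightarrow> 0"
    by (rule tendsto_sandwich[OF _ _ tendsto_const lim]) (simp_all add: bnd)
  hence "likely (\<lambda>n \<omega>. Z n \<omega> < e)"
    by (intro eventually_whpI_compl) auto
  thus "likely (\<lambda>n \<omega>. Z n \<omega> < a)"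
    by (rule eventually_mono) (use e in auto)
qed

lemma tendsto_whp_expectation:
  fixes Z :: "nat \<Rightarrow> 'a \<Rightarrow> real"
  assumes int: "\<And>n. integrable M (Z n)"
    and nonneg: "\<And>n \<omega>. \<omega> \<in> space M \<Longrightarrow> 0 \<le> Z n \<omega>"
    and 0: "(\<lambda>n. expectation (Z n)) \<longlonglongrightarrow> 0"
  shows "conv_prob (\<lambda>n \<omega>. Z n \<omega>) 0"
proof (rule tendsto_whp_min_expectation)
  show [measurable]: "Z n \<in> borel_measurable M" for n
    using int by auto
  have le: "expectation (\<lambda>\<omega>. min 1 (Z n \<omega>)) \<le> expectation (Z n)" for n
    by (intro integral_mono int integrable_const_bound[where B=1 and f="\<lambda>\<omega>. min 1 (Z n \<omega>)"])
      (use nonneg in \<open>auto intro!: AE_I2\<close>)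
  have ge: "0 \<le> expectation (\<lambda>\<omega>. min 1 (Z n \<omega>))" for n
    by (rule Bochner_Integration.integral_nonneg) (use nonneg in auto)
  show "(\<lambda>n. expectation (\<lambda>\<omega>. min 1 (Z n \<omega>))) \<longlonglongrightarrow> 0"
    by (rule tendsto_sandwich[OF _ _ tendsto_const 0]) (auto simp: le ge)
qed (use nonneg in auto)

text \<open>
  Bounded convergence in probability: outside an event of vanishing probability the integrand is
  small, and on that event it is bounded. It turns conditional limits into unconditional ones.
\<close>
lemma whp_bounded_convergence_0:
  fixes Z :: "nat \<Rightarrow> 'a \<Rightarrow> real"
  assumes [measurable]: "\<And>n. Z n \<in> borel_measurable M"
    and bnd: "\<And>n \<omega>. \<omega> \<in> space M \<Longrightarrow> \<bar>Z n \<omega>\<bar> \<le> K"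
    and 0: "conv_prob (\<lambda>n \<omega>. Z n \<omega>) 0"
  shows "(\<lambda>n. expectation (Z n)) \<longlonglongrightarrow> 0"
proof (rule LIMSEQ_I)
  fix r :: real assume r: "0 < r"
  have "likely (\<lambda>n \<omega>. \<bar>Z n \<omega>\<bar> < r / 2)"
    using tendstoD[OF 0, of "r/2"] r by (auto simp: dist_real_def)
  from eventually_whp_prob[OF this]
  have lim: "(\<lambda>n. prob {\<omega> \<in> space M. \<bar>Z n \<omega>\<bar> < r / 2}) \<longlonglongrightarrow> 1"
    by simp
  have "(\<lambda>n. K * (1 - prob {\<omega> \<in> space M. \<bar>Z n \<omega>\<bar> < r / 2})) \<longlonglongrightarrow> K * (1 - 1)"
    by (intro tendsto_intros lim)
  hence "\<forall>\<^sub>F n in sequentially. K * (1 - prob {\<omega> \<in> space M. \<bar>Z n \<omega>\<bar> < r / 2}) < r / 2"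
    by (rule order_tendstoD) (use r in auto)
  then obtain N where N: "\<And>n. n \<ge> N \<Longrightarrow> K * (1 - prob {\<omega> \<in> space M. \<bar>Z n \<omega>\<bar> < r / 2}) < r / 2"
    by (auto simp: eventually_sequentially)
  have "norm (expectation (Z n) - 0) < r" if "n \<ge> N" for n
  proof -
    let ?A = "{\<omega> \<in> space M. \<bar>Z n \<omega>\<bar> < r / 2}"
    have int: "integrable M (Z n)"
      by (rule integrable_const_bound[where B=K]) (use bnd in \<open>auto intro!: AE_I2\<close>)
    have K: "0 \<le> K"
      using bnd not_empty by (metis abs_ge_zero ex_in_conv order_trans)
    have "norm (expectation (Z n)) \<le> expectation (\<lambda>\<omega>. norm (Z n \<omega>))"
      by (rule integral_norm_bound)
    also have "\<dots> \<le> expectation (\<lambda>\<omega>. r / 2 + K * indicator (space M - ?A) \<omega>)"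
    proof (rule integral_mono)
      show "integrable M (\<lambda>\<omega>. r / 2 + K * indicator (space M - ?A) \<omega>)"
        by (intro integrable_const_bound[where B="r/2 + K"]) (use r K in \<open>auto intro!: AE_I2 simp: indicator_def\<close>)
      fix \<omega> assume w: "\<omega> \<in> space M"
      show "norm (Z n \<omega>) \<le> r / 2 + K * indicator (space M - ?A) \<omega>"
        using bnd[OF w, of n] w r K by (auto simp: indicator_def)
    qed (use int in auto)
    also have "\<dots> = r / 2 + K * prob (space M - ?A)"
      by (subst Bochner_Integration.integral_add) (auto simp: prob_space emeasure_eq_measure)
    also have "\<dots> < r"
      using N[OF that] by (simp add: prob_compl)
    finally show ?thesis
      by simp
  qed
  thus "\<exists>no. \<forall>n\<ge>no. norm (expectation (Z n) - 0) < r"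
    by blast
qed

lemma whp_bounded_convergence:
  fixes Z :: "nat \<Rightarrow> 'a \<Rightarrow> complex"
  assumes [measurable]: "\<And>n. Z n \<in> borel_measurable M"
    and bnd: "\<And>n \<omega>. \<omega> \<in> space M \<Longrightarrow> norm (Z n \<omega>) \<le> K"
    and lim: "conv_prob (\<lambda>n \<omega>. Z n \<omega>) l"
  shows "(\<lambda>n. expectation (Z n)) \<longlonglongrightarrow> l"
proof -
  have "(\<lambda>n. expectation (\<lambda>\<omega>. norm (Z n \<omega> - l))) \<longlonglongrightarrow> 0"
  proof (rule whp_bounded_convergence_0)
    show "conv_prob (\<lambda>n \<omega>. norm (Z n \<omega> - l)) 0"
      using lim by (intro tendsto_norm_zero) (simp add: LIM_zero_iff)
    show "\<bar>norm (Z n \<omega> - l)\<bar> \<le> K + norm l" if "\<omega> \<in> space M" for n \<omega>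
      using bnd[OF that, of n] norm_triangle_ineq4[of "Z n \<omega>" l] by simp
  qed auto
  moreover have "norm (expectation (Z n) - l) \<le> expectation (\<lambda>\<omega>. norm (Z n \<omega> - l))" for n
  proof -
    have int: "integrable M (Z n)"
      by (rule integrable_const_bound[where B=K]) (use bnd in \<open>auto intro!: AE_I2\<close>)
    hence "expectation (Z n) - l = expectation (\<lambda>\<omega>. Z n \<omega> - l)"
      by (subst Bochner_Integration.integral_diff) (auto simp: prob_space)
    thus ?thesis
      by (simp add: integral_norm_bound)
  qed
  ultimately have "(\<lambda>n. expectation (Z n) - l) \<longlonglongrightarrow> 0"
    by (intro Lim_null_comparison[where g="\<lambda>n. expectation (\<lambda>\<omega>. norm (Z n \<omega> - l))" and
          f="\<lambda>n. expectation (Z n) - l"] always_eventually) auto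
  thus ?thesis
    by (simp add: LIM_zero_iff)
qed

lemma conv_std_normal_iff_char:
  assumes [measurable]: "\<And>n. Z n \<in> borel_measurable M"
  shows "conv_std_normal Z \<longleftrightarrow>
    (\<forall>t. (\<lambda>n. expectation (\<lambda>\<omega>. iexp (t * Z n \<omega>))) \<longlonglongrightarrow> complex_of_real (exp (- t\<^sup>2 / 2)))"
proof -
  have ch: "char (distr M borel (Z n)) t = expectation (\<lambda>\<omega>. iexp (t * Z n \<omega>))" for n t
    unfolding char_def by (subst integral_distr) auto
  have rd: "real_distribution (distr M borel (Z n))" for n
    by (rule real_distribution_distr) auto
  show ?thesis
    unfolding conv_std_normal_def
    using levy_continuity1[OF rd real_dist_normal_dist, of "\<lambda>n. n"]
      levy_continuity[OF rd real_dist_normal_dist, of "\<lambda>n. n"]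
    unfolding ch char_std_normal_distribution by blast
qed

text \<open>
  Slutsky's lemma through characteristic functions:
  \<open>E(exp(itT)) - E(exp(itW))\<close> is the mean of \<open>exp(itW) (exp(it(T - W)) - 1)\<close>, which is bounded and tends
  to \<open>0\<close> in probability.
\<close>
lemma slutsky_add:
  assumes [measurable]: "\<And>n. W n \<in> borel_measurable M" "\<And>n. T n \<in> borel_measurable M"
    and W: "conv_std_normal W"
    and d: "conv_prob (\<lambda>n \<omega>. T n \<omega> - W n \<omega>) 0"
  shows "conv_std_normal T"
  unfolding conv_std_normal_iff_char[of T, OF assms(2)]
proof
  fix t :: real
  have "conv_prob (\<lambda>n \<omega>. iexp (t * (T n \<omega> - W n \<omega>)) - 1) (iexp (t * 0) - 1)"
    by (intro tendsto_intros d)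
  hence lim1: "conv_prob (\<lambda>n \<omega>. norm (iexp (t * (T n \<omega> - W n \<omega>)) - 1)) 0"
    by (intro tendsto_norm_zero) simp
  have split: "iexp (t * T n \<omega>) - iexp (t * W n \<omega>)
      = iexp (t * W n \<omega>) * (iexp (t * (T n \<omega> - W n \<omega>)) - 1)" for n \<omega>
    by (simp add: algebra_simps flip: exp_add)
  have lim2: "conv_prob (\<lambda>n \<omega>. iexp (t * T n \<omega>) - iexp (t * W n \<omega>)) 0"
    unfolding split by (rule Lim_null_comparison[OF _ lim1]) (simp add: norm_mult)
  have "(\<lambda>n. expectation (\<lambda>\<omega>. iexp (t * T n \<omega>) - iexp (t * W n \<omega>))) \<longlonglongrightarrow> 0"
  proof (rule whp_bounded_convergence[OF _ _ lim2, where K=2])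
    show "norm (iexp (t * T n \<omega>) - iexp (t * W n \<omega>)) \<le> 2" for n \<omega>
      using norm_triangle_ineq4[of "iexp (t * T n \<omega>)" "iexp (t * W n \<omega>)"] by simp
  qed auto
  moreover have "expectation (\<lambda>\<omega>. iexp (t * T n \<omega>) - iexp (t * W n \<omega>))
      = expectation (\<lambda>\<omega>. iexp (t * T n \<omega>)) - expectation (\<lambda>\<omega>. iexp (t * W n \<omega>))" for n
    by (rule Bochner_Integration.integral_diff)
      (auto intro!: integrable_const_bound[where B=1])
  ultimately have d0: "(\<lambda>n. expectation (\<lambda>\<omega>. iexp (t * T n \<omega>)) - expectation (\<lambda>\<omega>. iexp (t * W n \<omega>))) \<longlonglongrightarrow> 0"
    by simp
  have w0: "(\<lambda>n. expectation (\<lambda>\<omega>. iexp (t * W n \<omega>))) \<longlonglongrightarrow> complex_of_real (exp (- t\<^sup>2 / 2))"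
    using W unfolding conv_std_normal_iff_char[of W, OF assms(1)] by (rule spec)
  from tendsto_add[OF d0 w0]
  show "(\<lambda>n. expectation (\<lambda>\<omega>. iexp (t * T n \<omega>))) \<longlonglongrightarrow> complex_of_real (exp (- t\<^sup>2 / 2))"
    by simp
qed

text \<open>Tightness: both tails of the distribution functions converge to tails of the normal law.\<close>
lemma conv_std_normal_tight:
  assumes [measurable]: "\<And>n. W n \<in> borel_measurable M"
    and W: "conv_std_normal W" and "0 < e"
  obtains K where "0 < K" "\<forall>\<^sub>F n in sequentially. prob {\<omega> \<in> space M. \<bar>W n \<omega>\<bar> > K} < e"
proof -
  let ?N = std_normal_distribution
  interpret N: real_distribution ?N
    by (rule real_dist_normal_dist)
  have low: "((\<lambda>x. cdf ?N (- x)) \<longlongrightarrow> 0) at_top"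
    by (rule filterlim_compose[OF N.cdf_lim_at_bot filterlim_uminus_at_bot_at_top])
  have "((\<lambda>x. 1 - cdf ?N x + cdf ?N (- x)) \<longlongrightarrow> 1 - 1 + 0) at_top"
    by (rule tendsto_add[OF tendsto_diff[OF tendsto_const N.cdf_lim_at_top_prob] low])
  hence "\<forall>\<^sub>F x in at_top. 1 - cdf ?N x + cdf ?N (- x) < e"
    by (rule order_tendstoD) (use \<open>0 < e\<close> in auto)
  hence "\<forall>\<^sub>F x in at_top. 0 < x \<and> 1 - cdf ?N x + cdf ?N (- x) < e"
    using eventually_gt_at_top[of 0] by eventually_elim auto
  then obtain K where K: "0 < K" "1 - cdf ?N K + cdf ?N (- K) < e"
    by (auto simp: eventually_at_top_linorder)
  have cont: "isCont (cdf ?N) x" for x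
    by (subst N.isCont_cdf) (simp add: measure_def emeasure_density nn_integral_null_set)
  have lim: "(\<lambda>n. cdf (distr M borel (W n)) x) \<longlonglongrightarrow> cdf ?N x" for x
    using W cont unfolding conv_std_normal_def weak_conv_m_def weak_conv_def by auto
  have "(\<lambda>n. 1 - cdf (distr M borel (W n)) K + cdf (distr M borel (W n)) (- K))
      \<longlonglongrightarrow> 1 - cdf ?N K + cdf ?N (- K)"
    by (intro tendsto_intros lim)
  hence "\<forall>\<^sub>F n in sequentially. 1 - cdf (distr M borel (W n)) K + cdf (distr M borel (W n)) (- K) < e"
    by (rule order_tendstoD) (use K in auto)
  moreover have "prob {\<omega> \<in> space M. \<bar>W n \<omega>\<bar> > K}
      \<le> 1 - cdf (distr M borel (W n)) K + cdf (distr M borel (W n)) (- K)" for n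
  proof -
    have c: "cdf (distr M borel (W n)) x = prob {\<omega> \<in> space M. W n \<omega> \<le> x}" for x
      by (auto simp: cdf_def measure_distr vimage_def Int_def conj_commute)
    have "prob {\<omega> \<in> space M. \<bar>W n \<omega>\<bar> > K}
        \<le> prob ((space M - {\<omega> \<in> space M. W n \<omega> \<le> K}) \<union> {\<omega> \<in> space M. W n \<omega> \<le> - K})"
      by (intro finite_measure_mono) auto
    also have "\<dots> \<le> prob (space M - {\<omega> \<in> space M. W n \<omega> \<le> K}) + prob {\<omega> \<in> space M. W n \<omega> \<le> - K}"
      by (rule measure_Un_le) auto
    also have "\<dots> = 1 - prob {\<omega> \<in> space M. W n \<omega> \<le> K} + prob {\<omega> \<in> space M. W n \<omega> \<le> - K}"
      by (simp add: prob_compl)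
    finally show ?thesis
      unfolding c .
  qed
  ultimately have "\<forall>\<^sub>F n in sequentially. prob {\<omega> \<in> space M. \<bar>W n \<omega>\<bar> > K} < e"
    by (elim eventually_mono) (meson le_less_trans)
  with K(1) show thesis
    by (rule that)
qed

text \<open>A tight factor does not destroy convergence to \<open>0\<close>; split according to \<open>|W| \<le> K\<close>.\<close>
lemma tight_mult_null:
  assumes [measurable]: "\<And>n. W n \<in> borel_measurable M" "\<And>n. R n \<in> borel_measurable M"
    and W: "conv_std_normal W"
    and R: "conv_prob (\<lambda>n \<omega>. R n \<omega>) 0"
  shows "conv_prob (\<lambda>n \<omega>. W n \<omega> * R n \<omega>) ((0::real))"
proof -
  have "conv_prob (\<lambda>n \<omega>. \<bar>W n \<omega> * R n \<omega>\<bar>) 0"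
  proof (rule tendsto_whp_min_expectation[where Z="\<lambda>n \<omega>. \<bar>W n \<omega> * R n \<omega>\<bar>"])
    show "(\<lambda>n. expectation (\<lambda>\<omega>. min 1 \<bar>W n \<omega> * R n \<omega>\<bar>)) \<longlonglongrightarrow> 0"
    proof (rule order_tendstoI)
      fix a :: real assume "a < 0"
      thus "\<forall>\<^sub>F n in sequentially. a < expectation (\<lambda>\<omega>. min 1 \<bar>W n \<omega> * R n \<omega>\<bar>)"
        by (intro always_eventually allI less_le_trans[OF _ Bochner_Integration.integral_nonneg]) auto
    next
      fix a :: real assume a: "0 < a"
      obtain K where K: "0 < K" "\<forall>\<^sub>F n in sequentially. prob {\<omega> \<in> space M. \<bar>W n \<omega>\<bar> > K} < a / 2"
        using conv_std_normal_tight[OF _ W, of "a / 2"] a by auto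
      have "(\<lambda>n. expectation (\<lambda>\<omega>. min 1 (K * \<bar>R n \<omega>\<bar>))) \<longlonglongrightarrow> 0"
      proof (rule whp_bounded_convergence_0[where K=1])
        have "conv_prob (\<lambda>n \<omega>. min 1 (K * \<bar>R n \<omega>\<bar>)) (min 1 (K * \<bar>0\<bar>))"
          by (intro tendsto_intros R)
        thus "conv_prob (\<lambda>n \<omega>. min 1 (K * \<bar>R n \<omega>\<bar>)) 0"
          by simp
      qed (use K in auto)
      hence "\<forall>\<^sub>F n in sequentially. expectation (\<lambda>\<omega>. min 1 (K * \<bar>R n \<omega>\<bar>)) < a / 2"
        by (rule order_tendstoD) (use a in auto)
      with K(2) show "\<forall>\<^sub>F n in sequentially. expectation (\<lambda>\<omega>. min 1 \<bar>W n \<omega> * R n \<omega>\<bar>) < a"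
      proof eventually_elim
        case (elim n)
        let ?A = "{\<omega> \<in> space M. \<bar>W n \<omega>\<bar> > K}"
        have i: "integrable M (\<lambda>\<omega>. min 1 (K * \<bar>R n \<omega>\<bar>))"
          by (rule integrable_const_bound[where B=1]) (use K in auto)
        have "expectation (\<lambda>\<omega>. min 1 \<bar>W n \<omega> * R n \<omega>\<bar>)
            \<le> expectation (\<lambda>\<omega>. indicator ?A \<omega> + min 1 (K * \<bar>R n \<omega>\<bar>))"
        proof (rule integral_mono)
          show "integrable M (\<lambda>\<omega>. min 1 \<bar>W n \<omega> * R n \<omega>\<bar>)"
            by (rule integrable_const_bound[where B=1]) auto
          show "integrable M (\<lambda>\<omega>. indicator ?A \<omega> + min 1 (K * \<bar>R n \<omega>\<bar>))"
            by (intro Bochner_Integration.integrable_add i) (auto simp: emeasure_eq_measure)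
          fix \<omega> assume "\<omega> \<in> space M"
          show "min 1 \<bar>W n \<omega> * R n \<omega>\<bar> \<le> indicator ?A \<omega> + min 1 (K * \<bar>R n \<omega>\<bar>)"
          proof (cases "\<omega> \<in> ?A")
            case True
            have "0 \<le> min 1 (K * \<bar>R n \<omega>\<bar>)"
              using K by simp
            thus ?thesis
              using True by (simp add: min.coboundedI1)
          next
            case False
            hence "\<bar>W n \<omega> * R n \<omega>\<bar> \<le> K * \<bar>R n \<omega>\<bar>"
              using \<open>\<omega> \<in> space M\<close> by (auto simp: abs_mult intro!: mult_right_mono)
            thus ?thesis
              by (auto simp: indicator_def)
          qed
        qed
        also have "\<dots> = prob ?A + expectation (\<lambda>\<omega>. min 1 (K * \<bar>R n \<omega>\<bar>))"
          by (subst Bochner_Integration.integral_add[OF _ i]) (auto simp: emeasure_eq_measure)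
        finally show ?case
          using elim by simp
      qed
    qed
  qed auto
  thus ?thesis
    by (simp add: tendsto_rabs_zero_iff)
qed

lemma slutsky_mult:
  assumes [measurable]: "\<And>n. W n \<in> borel_measurable M" "\<And>n. R n \<in> borel_measurable M"
    and W: "conv_std_normal W"
    and R: "conv_prob (\<lambda>n \<omega>. R n \<omega>) 1"
  shows "conv_std_normal (\<lambda>n \<omega>. W n \<omega> * R n \<omega>)"
proof (rule slutsky_add[OF _ _ W])
  have "conv_prob (\<lambda>n \<omega>. R n \<omega> - 1) 0"
    using R by (simp add: LIM_zero_iff)
  from tight_mult_null[OF _ _ W this[THEN tendsto_cong[THEN iffD1, rotated]], of "\<lambda>n \<omega>. R n \<omega> - 1"]
  show "conv_prob (\<lambda>n \<omega>. W n \<omega> * R n \<omega> - W n \<omega>) 0"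
    by (simp add: algebra_simps)
qed auto

end

section \<open>Quantitative Lindeberg bounds for a row of independent variables\<close>

context prob_space
begin

text \<open>Jensen's inequality, in the form that the variance of \<open>|Y|\<close> is nonnegative.\<close>
lemma expectation_abs_le_sqrt:
  fixes Y :: "'a \<Rightarrow> real"
  assumes [measurable]: "Y \<in> borel_measurable M" and sq: "integrable M (\<lambda>\<omega>. (Y \<omega>)\<^sup>2)"
  shows "expectation (\<lambda>\<omega>. \<bar>Y \<omega>\<bar>) \<le> sqrt (expectation (\<lambda>\<omega>. (Y \<omega>)\<^sup>2))"
proof (rule real_le_rsqrt)
  have "integrable M Y"
    by (rule square_integrable_imp_integrable[OF _ sq]) auto
  hence "0 \<le> expectation (\<lambda>\<omega>. \<bar>Y \<omega>\<bar>\<^sup>2) - (expectation (\<lambda>\<omega>. \<bar>Y \<omega>\<bar>))\<^sup>2"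
    using sq variance_positive[of "\<lambda>\<omega>. \<bar>Y \<omega>\<bar>"] by (subst (asm) variance_eq) auto
  thus "(expectation (\<lambda>\<omega>. \<bar>Y \<omega>\<bar>))\<^sup>2 \<le> expectation (\<lambda>\<omega>. (Y \<omega>)\<^sup>2)"
    by simp
qed

lemma expectation_sum_square:
  fixes X :: "'i \<Rightarrow> 'a \<Rightarrow> real"
  assumes "finite I" "indep_vars (\<lambda>_. borel) X I"
    and "\<And>i. i \<in> I \<Longrightarrow> integrable M (\<lambda>\<omega>. (X i \<omega>)\<^sup>2)" "\<And>i. i \<in> I \<Longrightarrow> expectation (X i) = 0"
  shows "integrable M (\<lambda>\<omega>. (\<Sum>i\<in>I. X i \<omega>)\<^sup>2) \<and>
    expectation (\<lambda>\<omega>. (\<Sum>i\<in>I. X i \<omega>)\<^sup>2) = (\<Sum>i\<in>I. expectation (\<lambda>\<omega>. (X i \<omega>)\<^sup>2))"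
  using assms
proof (induction I rule: finite_induct)
  case (insert k F)
  have rv[measurable]: "i \<in> insert k F \<Longrightarrow> X i \<in> borel_measurable M" for i
    using insert.prems(1) by (auto simp: indep_vars_def)
  have int: "i \<in> insert k F \<Longrightarrow> integrable M (X i)" for i
    by (rule square_integrable_imp_integrable) (use rv insert.prems(2) in auto)
  have ind: "indep_var borel (X k) borel (\<lambda>\<omega>. \<Sum>i\<in>F. X i \<omega>)"
    using insert.hyps insert.prems(1) by (rule indep_vars_sum)
  have IH: "integrable M (\<lambda>\<omega>. (\<Sum>i\<in>F. X i \<omega>)\<^sup>2)"
    "expectation (\<lambda>\<omega>. (\<Sum>i\<in>F. X i \<omega>)\<^sup>2) = (\<Sum>i\<in>F. expectation (\<lambda>\<omega>. (X i \<omega>)\<^sup>2))"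
    using insert.IH insert.prems indep_vars_subset[OF insert.prems(1)] by auto
  have intF: "integrable M (\<lambda>\<omega>. \<Sum>i\<in>F. X i \<omega>)"
    using int by auto
  have intP: "integrable M (\<lambda>\<omega>. X k \<omega> * (\<Sum>i\<in>F. X i \<omega>))"
    using indep_var_integrable[OF ind int[of k] intF] by auto
  have "expectation (\<lambda>\<omega>. X k \<omega> * (\<Sum>i\<in>F. X i \<omega>)) = 0"
    using indep_var_lebesgue_integral[OF ind int[of k] intF] insert.prems(3)[of k] by auto
  moreover have "(\<Sum>i\<in>insert k F. X i \<omega>)\<^sup>2
      = (X k \<omega>)\<^sup>2 + (2 * (X k \<omega> * (\<Sum>i\<in>F. X i \<omega>)) + (\<Sum>i\<in>F. X i \<omega>)\<^sup>2)" for \<omega>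
    using insert.hyps by (simp add: power2_eq_square algebra_simps)
  ultimately show ?case
    using insert.hyps insert.prems(2)[of k] IH intP by simp
qed simp

lemma variance_sum_indep:
  fixes X :: "'i \<Rightarrow> 'a \<Rightarrow> real"
  assumes I: "finite I" and ind: "indep_vars (\<lambda>_. borel) X I"
    and sq: "\<And>i. i \<in> I \<Longrightarrow> integrable M (\<lambda>\<omega>. (X i \<omega>)\<^sup>2)"
  shows "integrable M (\<lambda>\<omega>. (\<Sum>i\<in>I. X i \<omega> - expectation (X i))\<^sup>2)"
    and "expectation (\<lambda>\<omega>. (\<Sum>i\<in>I. X i \<omega> - expectation (X i))\<^sup>2)
      \<le> (\<Sum>i\<in>I. expectation (\<lambda>\<omega>. (X i \<omega>)\<^sup>2))"
proof -
  have rv[measurable]: "i \<in> I \<Longrightarrow> X i \<in> borel_measurable M" for i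
    using ind by (auto simp: indep_vars_def)
  have int: "i \<in> I \<Longrightarrow> integrable M (X i)" for i
    by (rule square_integrable_imp_integrable) (use rv sq in auto)
  have ind': "indep_vars (\<lambda>_. borel) (\<lambda>i \<omega>. X i \<omega> - expectation (X i)) I"
    using ind by (rule indep_vars_compose2) auto
  have sq': "integrable M (\<lambda>\<omega>. (X i \<omega> - expectation (X i))\<^sup>2)" if "i \<in> I" for i
    using int[OF that] sq[OF that] by (simp add: power2_diff)
  have *: "integrable M (\<lambda>\<omega>. (\<Sum>i\<in>I. X i \<omega> - expectation (X i))\<^sup>2) \<and>
    expectation (\<lambda>\<omega>. (\<Sum>i\<in>I. X i \<omega> - expectation (X i))\<^sup>2)
      = (\<Sum>i\<in>I. expectation (\<lambda>\<omega>. (X i \<omega> - expectation (X i))\<^sup>2))"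
    by (rule expectation_sum_square[OF I ind' sq']) (simp_all add: prob_space int)
  show "integrable M (\<lambda>\<omega>. (\<Sum>i\<in>I. X i \<omega> - expectation (X i))\<^sup>2)"
    using * by blast
  have "expectation (\<lambda>\<omega>. (X i \<omega> - expectation (X i))\<^sup>2) \<le> expectation (\<lambda>\<omega>. (X i \<omega>)\<^sup>2)" if "i \<in> I" for i
    using variance_eq[OF int[OF that] sq[OF that]] by simp
  thus "expectation (\<lambda>\<omega>. (\<Sum>i\<in>I. X i \<omega> - expectation (X i))\<^sup>2)
      \<le> (\<Sum>i\<in>I. expectation (\<lambda>\<omega>. (X i \<omega>)\<^sup>2))"
    unfolding conjunct2[OF *] by (rule sum_mono)
qed

end

text \<open>
  The Lindeberg function. The sum of \<open>E(lind X\<^sub>i)\<close> being small is equivalent to Lindeberg's condition at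
  every level, with the advantage that \<open>lind\<close> is continuous in \<open>x\<close>, dominated by both \<open>x\<^sup>2\<close> and
  \<open>|x|^3\<close>, and subadditive up to a constant.
\<close>
definition lind :: "real \<Rightarrow> real" where
  "lind x = x\<^sup>2 * min 1 \<bar>x\<bar>"

lemma lind_measurable [measurable]: "lind \<in> borel_measurable borel"
  unfolding lind_def by measurable

lemma lind_nonneg: "0 \<le> lind x"
  by (simp add: lind_def)

lemma lind_le_square: "lind x \<le> x\<^sup>2"
  unfolding lind_def by (rule mult_left_le) auto

lemma lind_le_cube: "lind x \<le> \<bar>x\<bar> ^ 3"
proof -
  have "lind x \<le> x\<^sup>2 * \<bar>x\<bar>"
    unfolding lind_def by (intro mult_left_mono) auto
  also have "\<dots> = \<bar>x\<bar> ^ 3"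
    by (simp add: power3_eq_cube power2_eq_square flip: abs_mult)
  finally show ?thesis .
qed

lemma lind_double_le: "lind (2 * x) \<le> 8 * lind x"
proof -
  have "min 1 (2 * \<bar>x\<bar>) \<le> 2 * min 1 \<bar>x\<bar>"
    by (auto simp: min_def)
  from mult_left_mono[OF this, of "4 * x\<^sup>2"] show ?thesis
    by (simp add: lind_def power2_eq_square abs_mult)
qed

lemma lind_mono: "\<bar>x\<bar> \<le> \<bar>y\<bar> \<Longrightarrow> lind x \<le> lind y"
  unfolding lind_def by (intro mult_mono min.mono) (auto simp: abs_le_square_iff)

lemma lind_add_le: "lind (x + y) \<le> 8 * (lind x + lind y)"
proof (cases "\<bar>x\<bar> \<le> \<bar>y\<bar>")
  case True
  hence "lind (x + y) \<le> lind (2 * y)"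
    by (intro lind_mono) auto
  with lind_double_le[of y] lind_nonneg[of x] show ?thesis
    by simp
next
  case False
  hence "lind (x + y) \<le> lind (2 * x)"
    by (intro lind_mono) auto
  with lind_double_le[of x] lind_nonneg[of y] show ?thesis
    by simp
qed

text \<open>
  The upper estimate of \<open>exp(-s)\<close> comes from \<open>1 + s + s\<^sup>2/2 \<le> exp s\<close> and
  \<open>(1 - s + s\<^sup>2/2) (1 + s + s\<^sup>2/2) = 1 + s^4/4 \<ge> 1\<close>.
\<close>
lemma exp_minus_approx:
  fixes s :: real
  assumes "0 \<le> s"
  shows "\<bar>1 - s - exp (- s)\<bar> \<le> s\<^sup>2 / 2"
proof -
  have "1 - s \<le> exp (- s)"
    using exp_ge_add_one_self[of "- s"] by simp
  moreover have "exp (- s) \<le> 1 - s + s\<^sup>2 / 2"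
  proof -
    have "(1 - s + s\<^sup>2 / 2) * (1 + s + s\<^sup>2 / 2) = 1 + s ^ 4 / 4"
      by (simp add: algebra_simps power2_eq_square power4_eq_xxxx)
    hence "1 \<le> (1 - s + s\<^sup>2 / 2) * (1 + s + s\<^sup>2 / 2)"
      by simp
    also have "\<dots> \<le> (1 - s + s\<^sup>2 / 2) * exp s"
    proof (rule mult_left_mono[OF exp_lower_Taylor_quadratic[OF assms]])
      have "1 - s + s\<^sup>2 / 2 = ((s - 1)\<^sup>2 + 1) / 2"
        by (simp add: power2_eq_square algebra_simps)
      thus "0 \<le> 1 - s + s\<^sup>2 / 2"
        by (metis add_nonneg_nonneg divide_nonneg_nonneg zero_le_numeral zero_le_one zero_le_power2)
    qed
    finally have "1 \<le> (1 - s + s\<^sup>2 / 2) * exp s" .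
    from mult_right_mono[OF this, of "exp (- s)"] show ?thesis
      by (simp add: mult.assoc flip: exp_add)
  qed
  ultimately show ?thesis
    by simp
qed

text \<open>
  One row of a triangular array, normalized to variance one. All estimates below are for this fixed
  row and depend on it only through \<open>L\<close>; this is what allows the row to depend on a further
  parameter, over which the estimates are integrated later.
\<close>
locale lindeberg_sum = prob_space +
  fixes X :: "nat \<Rightarrow> 'a \<Rightarrow> real" and I :: "nat set" and L :: real
  assumes fin: "finite I" and ind: "indep_vars (\<lambda>_. borel) X I"
    and sq: "\<And>i. i \<in> I \<Longrightarrow> integrable M (\<lambda>\<omega>. (X i \<omega>)\<^sup>2)"
    and mean: "\<And>i. i \<in> I \<Longrightarrow> expectation (X i) = 0"
    and unit_var: "(\<Sum>i\<in>I. expectation (\<lambda>\<omega>. (X i \<omega>)\<^sup>2)) = 1"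
    and L_eq: "L = (\<Sum>i\<in>I. expectation (\<lambda>\<omega>. lind (X i \<omega>)))"
begin

lemma rv [measurable]: "i \<in> I \<Longrightarrow> X i \<in> borel_measurable M"
  using ind by (auto simp: indep_vars_def)

lemma int: "i \<in> I \<Longrightarrow> integrable M (X i)"
  by (rule square_integrable_imp_integrable) (use rv sq in auto)

lemma int_lind: "i \<in> I \<Longrightarrow> integrable M (\<lambda>\<omega>. lind (X i \<omega>))"
  by (rule Bochner_Integration.integrable_bound[OF sq]) (auto simp: lind_nonneg lind_le_square)

lemma L_bounds: "0 \<le> L" "L \<le> 1"
proof -
  show "0 \<le> L"
    unfolding L_eq by (intro sum_nonneg Bochner_Integration.integral_nonneg lind_nonneg)
  have "L \<le> (\<Sum>i\<in>I. expectation (\<lambda>\<omega>. (X i \<omega>)\<^sup>2))"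
    unfolding L_eq by (intro sum_mono integral_mono int_lind sq lind_le_square)
  thus "L \<le> 1"
    using unit_var by simp
qed

lemma lind_le_L: "i \<in> I \<Longrightarrow> expectation (\<lambda>\<omega>. lind (X i \<omega>)) \<le> L"
  unfolding L_eq by (intro member_le_sum fin Bochner_Integration.integral_nonneg lind_nonneg)

text \<open>
  A small Lindeberg sum makes each single variance small: \<open>x\<^sup>2 \<le> \<tau>\<^sup>2 + lind x / \<tau>\<close> for \<open>0 < \<tau> \<le> 1\<close>, and
  \<open>\<tau> = \<surd>L\<close> gives the bound.
\<close>
lemma variance_le:
  assumes i: "i \<in> I"
  shows "expectation (\<lambda>\<omega>. (X i \<omega>)\<^sup>2) \<le> L + sqrt L"
proof -
  let ?s = "expectation (\<lambda>\<omega>. (X i \<omega>)\<^sup>2)"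
  have *: "?s \<le> \<tau>\<^sup>2 + L / \<tau>" if \<tau>: "0 < \<tau>" "\<tau> \<le> 1" for \<tau>
  proof -
    have pt: "x\<^sup>2 \<le> \<tau>\<^sup>2 + lind x / \<tau>" for x
    proof (cases "\<bar>x\<bar> \<le> \<tau>")
      case True
      hence "x\<^sup>2 \<le> \<tau>\<^sup>2"
        by (metis abs_ge_zero power2_abs power_mono)
      with lind_nonneg[of x] \<tau> show ?thesis
        by (simp add: add_increasing2)
    next
      case False
      hence "x\<^sup>2 * \<tau> \<le> lind x"
        unfolding lind_def using \<tau> by (intro mult_left_mono) auto
      hence "x\<^sup>2 \<le> lind x / \<tau>"
        using \<tau> by (simp add: field_simps)
      thus ?thesis
        by (simp add: add_increasing)
    qed
    have "?s \<le> expectation (\<lambda>\<omega>. \<tau>\<^sup>2 + lind (X i \<omega>) / \<tau>)"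
      using sq[OF i] int_lind[OF i] pt by (intro integral_mono) auto
    also have "\<dots> = \<tau>\<^sup>2 + expectation (\<lambda>\<omega>. lind (X i \<omega>)) / \<tau>"
      using int_lind[OF i] by (simp add: prob_space)
    also have "\<dots> \<le> \<tau>\<^sup>2 + L / \<tau>"
      using lind_le_L[OF i] \<tau> by (simp add: divide_right_mono)
    finally show ?thesis .
  qed
  show ?thesis
  proof (cases "L = 0")
    case False
    hence "0 < L"
      using L_bounds by simp
    thus ?thesis
      using *[of "sqrt L"] L_bounds by (simp add: real_div_sqrt)
  next
    case True
    have "?s \<le> 0"
    proof (rule ccontr)
      assume s: "\<not> ?s \<le> 0"
      have "?s \<le> (\<Sum>i\<in>I. expectation (\<lambda>\<omega>. (X i \<omega>)\<^sup>2))"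
        by (rule member_le_sum[OF i _ fin]) auto
      hence "?s \<le> 1"
        using unit_var by simp
      with s *[of "sqrt (?s / 2)"] True show False
        by simp
    qed
    with True show ?thesis
      by simp
  qed
qed

text \<open>
  The characteristic function of the sum and the Gaussian one are products of factors of modulus at
  most one, so their difference is at most the sum of the differences of the factors. Each of these
  passes through the quadratic Taylor polynomial \<open>1 - t\<^sup>2 s\<^sub>i / 2\<close>.
\<close>
lemma char_approx:
  "norm (expectation (\<lambda>\<omega>. iexp (t * (\<Sum>i\<in>I. X i \<omega>))) - complex_of_real (exp (- t\<^sup>2 / 2)))
     \<le> t\<^sup>2 * max 1 \<bar>t\<bar> * L + t ^ 4 / 8 * (L + sqrt L)"
proof -
  define s where "s i = expectation (\<lambda>\<omega>. (X i \<omega>)\<^sup>2)" for i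
  define \<phi> where "\<phi> i = char (distr M borel (X i)) t" for i
  have s0: "0 \<le> s i" for i
    by (simp add: s_def)
  have meas: "(\<lambda>\<omega>. \<Sum>i\<in>I. X i \<omega>) \<in> borel_measurable M"
    by simp
  have "expectation (\<lambda>\<omega>. iexp (t * (\<Sum>i\<in>I. X i \<omega>))) = char (distr M borel (\<lambda>\<omega>. \<Sum>i\<in>I. X i \<omega>)) t"
    unfolding char_def by (subst integral_distr[OF meas]) auto
  also have "\<dots> = (\<Prod>i\<in>I. \<phi> i)"
    unfolding \<phi>_def by (rule char_distr_sum[OF ind])
  finally have lhs: "expectation (\<lambda>\<omega>. iexp (t * (\<Sum>i\<in>I. X i \<omega>))) = (\<Prod>i\<in>I. \<phi> i)" .
  have "(\<Sum>i\<in>I. - t\<^sup>2 * s i / 2) = (\<Sum>i\<in>I. s i * (- t\<^sup>2 / 2))"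
    by (simp add: algebra_simps)
  also have "\<dots> = - t\<^sup>2 / 2"
    using unit_var unfolding s_def sum_distrib_right[symmetric] by simp
  finally have "exp (- t\<^sup>2 / 2) = (\<Prod>i\<in>I. exp (- t\<^sup>2 * s i / 2))"
    by (simp only: exp_sum[OF fin, symmetric])
  hence rhs: "complex_of_real (exp (- t\<^sup>2 / 2)) = (\<Prod>i\<in>I. complex_of_real (exp (- t\<^sup>2 * s i / 2)))"
    by simp
  have one: "norm (\<phi> i - complex_of_real (exp (- t\<^sup>2 * s i / 2)))
      \<le> t\<^sup>2 * max 1 \<bar>t\<bar> * expectation (\<lambda>\<omega>. lind (X i \<omega>)) + t ^ 4 / 8 * (s i * (L + sqrt L))"
    if i: "i \<in> I" for i
  proof -
    have "norm (\<phi> i - complex_of_real (1 - t\<^sup>2 * s i / 2))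
        \<le> t\<^sup>2 / 6 * expectation (\<lambda>\<omega>. min (6 * (X i \<omega>)\<^sup>2) (\<bar>t\<bar> * \<bar>X i \<omega>\<bar> ^ 3))"
      using char_approx3'[OF rv[OF i] int[OF i] sq[OF i] mean[OF i], of "s i" "distr M borel (X i)" t]
      unfolding \<phi>_def by (simp add: s_def mean[OF i])
    also have "\<dots> \<le> t\<^sup>2 / 6 * expectation (\<lambda>\<omega>. 6 * max 1 \<bar>t\<bar> * lind (X i \<omega>))"
    proof (intro mult_left_mono integral_mono)
      show "integrable M (\<lambda>\<omega>. min (6 * (X i \<omega>)\<^sup>2) (\<bar>t\<bar> * \<bar>X i \<omega>\<bar> ^ 3))"
        using i by (intro Bochner_Integration.integrable_bound[OF integrable_mult_right[OF sq[OF i], of 6]]) auto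
      show "integrable M (\<lambda>\<omega>. 6 * max 1 \<bar>t\<bar> * lind (X i \<omega>))"
        using int_lind[OF i] by simp
      fix \<omega>
      let ?x = "X i \<omega>"
      have "min (6 * ?x\<^sup>2) (\<bar>t\<bar> * \<bar>?x\<bar> ^ 3) = ?x\<^sup>2 * min 6 (\<bar>t\<bar> * \<bar>?x\<bar>)"
      proof -
        have c: "\<bar>?x\<bar> ^ 3 = ?x\<^sup>2 * \<bar>?x\<bar>"
          by (simp add: power3_eq_cube power2_eq_square flip: abs_mult)
        show ?thesis
          unfolding c by (subst mult_min_right) (auto simp: mult_ac)
      qed
      also have "\<dots> \<le> ?x\<^sup>2 * (6 * max 1 \<bar>t\<bar> * min 1 \<bar>?x\<bar>)"
      proof (intro mult_left_mono)
        have t1: "\<bar>t\<bar> * \<bar>?x\<bar> \<le> max 1 \<bar>t\<bar> * \<bar>?x\<bar>"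
          by (intro mult_right_mono) auto
        show "min 6 (\<bar>t\<bar> * \<bar>?x\<bar>) \<le> 6 * max 1 \<bar>t\<bar> * min 1 \<bar>?x\<bar>"
        proof (cases "\<bar>?x\<bar> \<le> 1")
          case True
          have "0 \<le> max 1 \<bar>t\<bar> * \<bar>?x\<bar>"
            by simp
          with t1 have "min 6 (\<bar>t\<bar> * \<bar>?x\<bar>) \<le> 6 * (max 1 \<bar>t\<bar> * \<bar>?x\<bar>)"
            by linarith
          with True show ?thesis
            by (simp add: min_absorb2 mult.assoc)
        next
          case False
          thus ?thesis
            by (simp add: min.coboundedI1)
        qed
      qed auto
      finally show "min (6 * ?x\<^sup>2) (\<bar>t\<bar> * \<bar>?x\<bar> ^ 3) \<le> 6 * max 1 \<bar>t\<bar> * lind ?x"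
        by (simp add: lind_def mult_ac)
    qed auto
    also have "\<dots> = t\<^sup>2 * max 1 \<bar>t\<bar> * expectation (\<lambda>\<omega>. lind (X i \<omega>))"
      using int_lind[OF i] by simp
    finally have 1: "norm (\<phi> i - complex_of_real (1 - t\<^sup>2 * s i / 2))
        \<le> t\<^sup>2 * max 1 \<bar>t\<bar> * expectation (\<lambda>\<omega>. lind (X i \<omega>))" .
    have "\<bar>1 - t\<^sup>2 * s i / 2 - exp (- (t\<^sup>2 * s i / 2))\<bar> \<le> (t\<^sup>2 * s i / 2)\<^sup>2 / 2"
      by (rule exp_minus_approx) (simp add: s0)
    also have "\<dots> = t ^ 4 / 8 * (s i * s i)"
      by (simp add: power2_eq_square power4_eq_xxxx)
    also have "\<dots> \<le> t ^ 4 / 8 * (s i * (L + sqrt L))"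
      using variance_le[OF i] s0 by (intro mult_left_mono) (auto simp: s_def)
    finally have "\<bar>1 - t\<^sup>2 * s i / 2 - exp (- t\<^sup>2 * s i / 2)\<bar> \<le> t ^ 4 / 8 * (s i * (L + sqrt L))"
      by simp
    hence 2: "norm (complex_of_real (1 - t\<^sup>2 * s i / 2) - complex_of_real (exp (- t\<^sup>2 * s i / 2)))
        \<le> t ^ 4 / 8 * (s i * (L + sqrt L))"
      by (simp flip: of_real_diff)
    show ?thesis
      using norm_triangle_le[OF add_mono[OF 1 2]] by simp
  qed
  have "norm ((\<Prod>i\<in>I. \<phi> i) - (\<Prod>i\<in>I. complex_of_real (exp (- t\<^sup>2 * s i / 2))))
      \<le> (\<Sum>i\<in>I. norm (\<phi> i - complex_of_real (exp (- t\<^sup>2 * s i / 2))))"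
  proof (rule norm_prod_diff)
    show "norm (\<phi> i) \<le> 1" if "i \<in> I" for i
      unfolding \<phi>_def using that by (intro real_distribution.cmod_char_le_1 real_distribution_distr rv)
    show "norm (complex_of_real (exp (- t\<^sup>2 * s i / 2))) \<le> 1" for i
      using s0[of i] by (simp add: mult_nonneg_nonneg)
  qed
  also have "\<dots> \<le> (\<Sum>i\<in>I. t\<^sup>2 * max 1 \<bar>t\<bar> * expectation (\<lambda>\<omega>. lind (X i \<omega>)) + t ^ 4 / 8 * (s i * (L + sqrt L)))"
    by (rule sum_mono[OF one])
  also have "\<dots> = t\<^sup>2 * max 1 \<bar>t\<bar> * L + t ^ 4 / 8 * ((\<Sum>i\<in>I. s i) * (L + sqrt L))"
    by (simp add: sum.distrib L_eq sum_distrib_left sum_distrib_right)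
  also have "(\<Sum>i\<in>I. s i) = 1"
    using unit_var by (simp add: s_def)
  finally show ?thesis
    unfolding lhs rhs by simp
qed

text \<open>
  The squares with \<open>|X\<^sub>i| \<le> 1\<close> have a sum of variance at most \<open>L\<close>, and the others contribute at most \<open>L\<close> to
  the mean. Thus second moments suffice for a law of large numbers for the squares.
\<close>
lemma sum_square_approx:
  "expectation (\<lambda>\<omega>. \<bar>(\<Sum>i\<in>I. (X i \<omega>)\<^sup>2) - 1\<bar>) \<le> 2 * L + sqrt L"
proof -
  define a where "a i \<omega> = (if \<bar>X i \<omega>\<bar> \<le> 1 then (X i \<omega>)\<^sup>2 else 0)" for i \<omega>
  define b where "b i \<omega> = (if \<bar>X i \<omega>\<bar> \<le> 1 then 0 else (X i \<omega>)\<^sup>2)" for i \<omega>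
  have am[measurable]: "a i \<in> borel_measurable M" if "i \<in> I" for i
    unfolding a_def using rv[OF that] by measurable
  have bm[measurable]: "b i \<in> borel_measurable M" if "i \<in> I" for i
    unfolding b_def using rv[OF that] by measurable
  have a1: "0 \<le> a i \<omega>" "a i \<omega> \<le> (X i \<omega>)\<^sup>2" "0 \<le> b i \<omega>" "b i \<omega> \<le> (X i \<omega>)\<^sup>2" "b i \<omega> \<le> lind (X i \<omega>)" for i \<omega>
    by (auto simp: a_def b_def lind_def)
  have a2: "(a i \<omega>)\<^sup>2 \<le> lind (X i \<omega>)" for i \<omega>
  proof (cases "\<bar>X i \<omega>\<bar> \<le> 1")
    case True
    have "(X i \<omega>)\<^sup>2 = \<bar>X i \<omega>\<bar> * \<bar>X i \<omega>\<bar>"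
      by (simp add: power2_eq_square)
    also have "\<dots> \<le> \<bar>X i \<omega>\<bar> * 1"
      using True by (intro mult_left_mono) auto
    finally have "(X i \<omega>)\<^sup>2 * (X i \<omega>)\<^sup>2 \<le> (X i \<omega>)\<^sup>2 * \<bar>X i \<omega>\<bar>"
      by (intro mult_left_mono) auto
    with True show ?thesis
      by (simp add: a_def lind_def power2_eq_square min_absorb2)
  qed (simp add: a_def lind_nonneg)
  have inta: "integrable M (a i)" if "i \<in> I" for i
    by (rule Bochner_Integration.integrable_bound[OF sq[OF that]]) (use a1 that in auto)
  have intb: "integrable M (b i)" if "i \<in> I" for i
    by (rule Bochner_Integration.integrable_bound[OF sq[OF that]]) (use a1 that in auto)
  have inta2: "integrable M (\<lambda>\<omega>. (a i \<omega>)\<^sup>2)" if "i \<in> I" for i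
    by (rule Bochner_Integration.integrable_bound[OF int_lind[OF that]]) (use a2 lind_nonneg that in auto)
  have inda: "indep_vars (\<lambda>_. borel) a I"
  proof -
    have "indep_vars (\<lambda>_. borel) (\<lambda>i \<omega>. (\<lambda>x. if \<bar>x\<bar> \<le> 1 then x\<^sup>2 else 0) (X i \<omega>)) I"
      by (rule indep_vars_compose2[OF ind]) auto
    thus ?thesis
      by (simp add: a_def[abs_def])
  qed
  let ?A = "\<lambda>\<omega>. \<Sum>i\<in>I. a i \<omega> - expectation (a i)"
  let ?B = "\<lambda>\<omega>. \<Sum>i\<in>I. b i \<omega> + expectation (b i)"
  note va = variance_sum_indep[OF fin inda inta2]
  have "expectation (\<lambda>\<omega>. (?A \<omega>)\<^sup>2) \<le> (\<Sum>i\<in>I. expectation (\<lambda>\<omega>. (a i \<omega>)\<^sup>2))"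
    by (rule va(2))
  also have "\<dots> \<le> L"
    unfolding L_eq by (intro sum_mono integral_mono inta2 int_lind a2)
  finally have A: "expectation (\<lambda>\<omega>. \<bar>?A \<omega>\<bar>) \<le> sqrt L"
    by (intro order_trans[OF expectation_abs_le_sqrt[OF _ va(1)]] real_sqrt_le_mono) simp_all
  have Bb: "expectation (b i) \<le> expectation (\<lambda>\<omega>. lind (X i \<omega>))" if "i \<in> I" for i
    by (intro integral_mono intb int_lind that a1)
  have "expectation ?B = (\<Sum>i\<in>I. 2 * expectation (b i))"
    using intb by (simp add: prob_space)
  also have "\<dots> \<le> (\<Sum>i\<in>I. 2 * expectation (\<lambda>\<omega>. lind (X i \<omega>)))"
    using Bb by (intro sum_mono) auto
  also have "\<dots> = 2 * L"
    by (simp add: L_eq sum_distrib_left)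
  finally have B: "expectation ?B \<le> 2 * L" .
  have "(X i \<omega>)\<^sup>2 = a i \<omega> + b i \<omega>" for i \<omega>
    by (auto simp: a_def b_def)
  hence sum_split: "(\<Sum>i\<in>I. (X i \<omega>)\<^sup>2) = (\<Sum>i\<in>I. a i \<omega>) + (\<Sum>i\<in>I. b i \<omega>)" for \<omega>
    by (simp add: sum.distrib)
  have "1 = (\<Sum>i\<in>I. expectation (\<lambda>\<omega>. a i \<omega> + b i \<omega>))"
    unfolding unit_var[symmetric] by (intro sum.cong refl Bochner_Integration.integral_cong) (auto simp: a_def b_def)
  also have "\<dots> = (\<Sum>i\<in>I. expectation (a i)) + (\<Sum>i\<in>I. expectation (b i))"
    using inta intb by (simp add: sum.distrib)
  finally have mean_split: "(\<Sum>i\<in>I. expectation (a i)) + (\<Sum>i\<in>I. expectation (b i)) = 1" ..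
  have pt: "\<bar>(\<Sum>i\<in>I. (X i \<omega>)\<^sup>2) - 1\<bar> \<le> \<bar>?A \<omega>\<bar> + ?B \<omega>" for \<omega>
  proof -
    have "0 \<le> (\<Sum>i\<in>I. b i \<omega>)" "0 \<le> (\<Sum>i\<in>I. expectation (b i))"
      using a1 by (auto intro!: sum_nonneg Bochner_Integration.integral_nonneg)
    moreover have "?A \<omega> = (\<Sum>i\<in>I. a i \<omega>) - (\<Sum>i\<in>I. expectation (a i))"
      "?B \<omega> = (\<Sum>i\<in>I. b i \<omega>) + (\<Sum>i\<in>I. expectation (b i))"
      by (simp_all add: sum_subtractf sum.distrib)
    ultimately show ?thesis
      using mean_split unfolding sum_split by linarith
  qed
  have iA: "integrable M (\<lambda>\<omega>. \<bar>?A \<omega>\<bar>)" and iB: "integrable M ?B"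
    using inta intb by (auto intro!: Bochner_Integration.integrable_sum Bochner_Integration.integrable_add)
  have "expectation (\<lambda>\<omega>. \<bar>(\<Sum>i\<in>I. (X i \<omega>)\<^sup>2) - 1\<bar>) \<le> expectation (\<lambda>\<omega>. \<bar>?A \<omega>\<bar> + ?B \<omega>)"
    using iA iB sq by (intro integral_mono pt) auto
  also have "\<dots> = expectation (\<lambda>\<omega>. \<bar>?A \<omega>\<bar>) + expectation ?B"
    by (rule Bochner_Integration.integral_add[OF iA iB])
  finally show ?thesis
    using A B by simp
qed

end

section \<open>Consequences of the domain of attraction of the normal law\<close>

text \<open>Taking logarithms: with \<open>r\<^sub>n = - n ln q\<^sub>n \<rightarrow> s\<close>, the quantity \<open>n (1 - exp(- r\<^sub>n / n))\<close> is \<open>r\<^sub>n + O(1/n)\<close>.\<close>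
lemma power_tendsto_exp_imp_linear:
  fixes q :: "nat \<Rightarrow> real"
  assumes q: "\<And>n. 0 \<le> q n" "\<And>n. q n \<le> 1"
    and lim: "(\<lambda>n. q n ^ n) \<longlonglongrightarrow> exp (- s)"
  shows "(\<lambda>n. real n * (1 - q n)) \<longlonglongrightarrow> s"
proof -
  define r where "r n = - (real n * ln (q n))" for n
  have ev: "\<forall>\<^sub>F n in sequentially. 0 < q n \<and> 0 < n"
    using order_tendstoD(1)[OF lim exp_gt_zero] eventually_gt_at_top[of 0]
  proof eventually_elim
    case (elim n)
    thus ?case
      using q(1)[of n] by (metis less_eq_real_def order_less_irrefl zero_power)
  qed
  have "(\<lambda>n. - ln (q n ^ n)) \<longlonglongrightarrow> - ln (exp (- s))"
    by (rule tendsto_minus[OF tendsto_ln[OF lim]]) simp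
  hence "(\<lambda>n. - ln (q n ^ n)) \<longlonglongrightarrow> s"
    by simp
  moreover have "\<forall>\<^sub>F n in sequentially. - ln (q n ^ n) = r n"
    using ev by eventually_elim (simp add: r_def ln_realpow)
  ultimately have r: "r \<longlonglongrightarrow> s"
    using tendsto_cong[of "\<lambda>n. - ln (q n ^ n)" r] by blast
  have "(\<lambda>n. (r n)\<^sup>2 * inverse (real n)) \<longlonglongrightarrow> s\<^sup>2 * 0"
    by (intro tendsto_intros r lim_inverse_n)
  hence 0: "(\<lambda>n. (r n)\<^sup>2 * inverse (real n)) \<longlonglongrightarrow> 0"
    by simp
  have "(\<lambda>n. real n * (1 - q n) - r n) \<longlonglongrightarrow> 0"
  proof (rule Lim_null_comparison[OF _ 0])
    show "\<forall>\<^sub>F n in sequentially. norm (real n * (1 - q n) - r n) \<le> (r n)\<^sup>2 * inverse (real n)"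
      using ev
    proof eventually_elim
      case (elim n)
      let ?x = "- ln (q n)"
      have x: "0 \<le> ?x" "exp (- ?x) = q n"
        using elim q(2)[of n] by (auto simp: ln_le_zero_iff)
      have "real n * (1 - q n) - r n = real n * (1 - ?x - exp (- ?x))"
        using x(2) by (simp add: r_def algebra_simps)
      hence "\<bar>real n * (1 - q n) - r n\<bar> = real n * \<bar>1 - ?x - exp (- ?x)\<bar>"
        by (simp only: abs_mult abs_of_nat)
      also have "\<dots> \<le> real n * (?x\<^sup>2 / 2)"
        by (intro mult_left_mono exp_minus_approx x) auto
      also have "\<dots> \<le> (r n)\<^sup>2 * inverse (real n)"
        using elim by (simp add: r_def power2_eq_square field_simps)
      finally show ?case
        by simp
    qed
  qed
  from tendsto_add[OF this r] show ?thesis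
    by simp
qed

lemma one_minus_cos_le: "1 - cos s \<le> (s::real)\<^sup>2 / 2"
proof -
  have "1 - cos s = 2 * (sin (s / 2))\<^sup>2"
    using cos_double_sin[of "s / 2"] by simp
  also have "\<dots> \<le> 2 * (s / 2)\<^sup>2"
    using abs_sin_x_le_abs_x[of "s / 2"] unfolding abs_le_square_iff by simp
  finally show ?thesis
    by (simp add: power_divide)
qed

text \<open>
  The identity that turns the quadratic limit of \<open>n E(1 - cos(t X / b\<^sub>n))\<close> into the vanishing of the
  second moments: its right-hand side is \<open>0\<close> when \<open>1 - cos\<close> is replaced by a quadratic function.
\<close>
lemma one_minus_cos_square: "2 * (1 - cos s)\<^sup>2 = 4 * (1 - cos s) - (1 - cos (2 * (s::real)))"
  using cos_double_cos[of s] by (simp add: power2_eq_square algebra_simps)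

lemma cos_std_normal: "(LINT t|std_normal_distribution. cos (t * s)) = exp (- s\<^sup>2 / 2)"
proof -
  interpret N: real_distribution std_normal_distribution
    by (rule real_dist_normal_dist)
  have "complex_integrable std_normal_distribution (\<lambda>t. iexp (s * t))"
    by (rule N.integrable_const_bound[where B=1]) auto
  hence "Re (char std_normal_distribution s) = (LINT t|std_normal_distribution. Re (iexp (s * t)))"
    unfolding char_def by simp
  thus ?thesis
    by (simp add: char_std_normal_distribution Re_exp mult.commute)
qed

text \<open>
  For a fixed \<open>t\<close> the function \<open>(1 - cos(ts))\<^sup>2\<close> vanishes at nonzero arguments \<open>s\<close>, but its average over \<open>t\<close>
  does not. A Gaussian average is explicit: with \<open>x = exp(-s\<^sup>2/2)\<close> it equals
  \<open>(x^4 - 4x + 3) / 2 = (1 - x)\<^sup>2 (x\<^sup>2 + 2x + 3) / 2\<close>.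
\<close>
lemma std_normal_average_one_minus_cos_square:
  assumes "0 < \<tau>" "\<tau> \<le> \<bar>s\<bar>"
  shows "3 / 2 * (1 - exp (- \<tau>\<^sup>2 / 2))\<^sup>2 \<le> (LINT t|std_normal_distribution. (1 - cos (t * s))\<^sup>2)"
proof -
  interpret N: real_distribution std_normal_distribution
    by (rule real_dist_normal_dist)
  let ?x = "exp (- s\<^sup>2 / 2)"
  have int: "integrable std_normal_distribution (\<lambda>t. cos (t * r))" for r
    by (rule N.integrable_const_bound[where B=1]) auto
  have "(LINT t|std_normal_distribution. (1 - cos (t * s))\<^sup>2)
      = (LINT t|std_normal_distribution. 3 / 2 - 2 * cos (t * s) + cos (t * (2 * s)) / 2)"
  proof (rule Bochner_Integration.integral_cong[OF refl])
    fix t :: real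
    show "(1 - cos (t * s))\<^sup>2 = 3 / 2 - 2 * cos (t * s) + cos (t * (2 * s)) / 2"
      using one_minus_cos_square[of "t * s"] by (simp add: mult_ac)
  qed
  also have "\<dots> = 3 / 2 - 2 * ?x + exp (- (2 * s)\<^sup>2 / 2) / 2"
    using int[of s] int[of "2 * s"] N.prob_space
    by (simp add: cos_std_normal)
  also have "exp (- (2 * s)\<^sup>2 / 2) = ?x ^ 4"
    by (simp flip: exp_of_nat_mult)
  also have "3 / 2 - 2 * ?x + ?x ^ 4 / 2 = (1 - ?x)\<^sup>2 * (?x\<^sup>2 + 2 * ?x + 3) / 2"
    by (simp add: power2_eq_square power4_eq_xxxx field_simps)
  finally have eq: "(LINT t|std_normal_distribution. (1 - cos (t * s))\<^sup>2)
      = (1 - ?x)\<^sup>2 * (?x\<^sup>2 + 2 * ?x + 3) / 2" .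
  have "\<tau>\<^sup>2 \<le> s\<^sup>2"
    using assms by (metis abs_of_pos abs_le_square_iff)
  hence "(1 - exp (- \<tau>\<^sup>2 / 2))\<^sup>2 \<le> (1 - ?x)\<^sup>2"
    by (intro power_mono) auto
  hence "3 * (1 - exp (- \<tau>\<^sup>2 / 2))\<^sup>2 \<le> (1 - ?x)\<^sup>2 * (?x\<^sup>2 + 2 * ?x + 3)"
  proof -
    assume *: "(1 - exp (- \<tau>\<^sup>2 / 2))\<^sup>2 \<le> (1 - ?x)\<^sup>2"
    have "(1 - exp (- \<tau>\<^sup>2 / 2))\<^sup>2 * 3 \<le> (1 - ?x)\<^sup>2 * (?x\<^sup>2 + 2 * ?x + 3)"
      by (intro mult_mono *) auto
    thus ?thesis
      by simp
  qed
  thus ?thesis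
    unfolding eq by simp
qed

definition centred_ss :: "nat \<Rightarrow> (nat \<Rightarrow> real) \<Rightarrow> real" where
  "centred_ss n a = (\<Sum>i=1..n. (a i - smean n a)\<^sup>2)"

lemma sum_pairs: "(\<Sum>i=1..2 * N. f i) = (\<Sum>k<N. f (2 * k + 1) + f (2 * k + 2))"
  for f :: "nat \<Rightarrow> real"
  by (induction N) (auto simp: algebra_simps)

lemma half_square_diff_le: "(x - y)\<^sup>2 / 2 \<le> x\<^sup>2 + (y::real)\<^sup>2"
  using zero_le_power2[of "x + y"] unfolding power2_sum power2_diff by simp

text \<open>
  Disjoint pairs bound the centred sum of squares from below by a sum of independent terms, which
  does not involve the sample mean.
\<close>
lemma centred_ss_ge_pairs:
  "(\<Sum>k<n div 2. (a (2 * k + 1) - a (2 * k + 2))\<^sup>2) / 2 \<le> centred_ss n a"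
proof -
  let ?m = "smean n a"
  have "(\<Sum>k<n div 2. (a (2 * k + 1) - a (2 * k + 2))\<^sup>2) / 2
      \<le> (\<Sum>k<n div 2. (a (2 * k + 1) - ?m)\<^sup>2 + (a (2 * k + 2) - ?m)\<^sup>2)"
    unfolding sum_divide_distrib
  proof (rule sum_mono)
    fix k
    let ?x = "a (2 * k + 1) - ?m" and ?y = "a (2 * k + 2) - ?m"
    show "(a (2 * k + 1) - a (2 * k + 2))\<^sup>2 / 2 \<le> ?x\<^sup>2 + ?y\<^sup>2"
      using half_square_diff_le[of ?x ?y] by simp
  qed
  also have "\<dots> = (\<Sum>i=1..2 * (n div 2). (a i - ?m)\<^sup>2)"
    by (rule sum_pairs[symmetric])
  also have "\<dots> \<le> centred_ss n a"
    unfolding centred_ss_def by (rule sum_mono2) auto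
  finally show ?thesis .
qed

lemma half_tendsto: "(\<lambda>n. real (n div 2) / real n) \<longlonglongrightarrow> 1 / 2"
proof -
  have "(\<lambda>n. 1 / 2 - inverse (real n)) \<longlonglongrightarrow> 1 / 2 - 0"
    by (intro tendsto_intros lim_inverse_n)
  hence lo: "(\<lambda>n. 1 / 2 - inverse (real n)) \<longlonglongrightarrow> 1 / 2"
    by simp
  show ?thesis
  proof (rule tendsto_sandwich[OF _ _ lo tendsto_const])
    show "\<forall>\<^sub>F n in sequentially. 1 / 2 - inverse (real n) \<le> real (n div 2) / real n"
      using eventually_gt_at_top[of 0]
    proof eventually_elim
      case (elim n)
      have "real n / 2 - 1 \<le> real (n div 2)"
        by linarith
      from divide_right_mono[OF this, of "real n"] elim show ?case
        by (simp add: diff_divide_distrib inverse_eq_divide)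
    qed
    show "\<forall>\<^sub>F n in sequentially. real (n div 2) / real n \<le> 1 / 2"
      using eventually_gt_at_top[of 0]
    proof eventually_elim
      case (elim n)
      have "2 * real (n div 2) \<le> real n"
        by linarith
      with elim show ?case
        by (simp add: field_simps)
    qed
  qed
qed

context prob_space
begin

lemma indep_var_from_indep_vars:
  fixes X :: "nat \<Rightarrow> 'a \<Rightarrow> real"
  assumes "indep_vars (\<lambda>_. borel) X UNIV" "i \<noteq> j"
  shows "indep_var borel (X i) borel (X j)"
proof -
  have "indep_vars (\<lambda>_. borel) X (insert i {j})"
    by (rule indep_vars_subset[OF assms(1)]) auto
  from indep_vars_sum[OF _ _ this] assms(2) show ?thesis
    by simp
qed

end

locale dan_sequence = prob_space +
  fixes \<xi> :: "nat \<Rightarrow> 'a \<Rightarrow> real"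
  assumes iid_\<xi>: "iid borel \<xi>" and DAN_\<xi>: "DAN \<xi>"
begin

lemma indep_\<xi>: "indep_vars (\<lambda>_. borel) \<xi> UNIV"
  using iid_\<xi> by (simp add: iid_def)

lemma rv_\<xi> [measurable]: "\<xi> i \<in> borel_measurable M"
  using indep_\<xi> by (auto simp: indep_vars_def)

lemma distr_\<xi>: "distr M borel (\<xi> i) = distr M borel (\<xi> 0)"
  using iid_\<xi> unfolding iid_def by blast

text \<open>
  Passing to differences removes the centring constants \<open>a\<^sub>n\<close> and makes the characteristic function real
  and nonnegative: it is the squared modulus of that of \<open>\<xi>\<close>.
\<close>
definition diff_law :: "real measure" where
  "diff_law = distr M borel (\<lambda>\<omega>. \<xi> 1 \<omega> - \<xi> 0 \<omega>)"

lemma prob_space_diff_law: "prob_space diff_law"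
  unfolding diff_law_def by (rule prob_space_distr) auto

lemma sets_diff_law [measurable_cong, simp]: "sets diff_law = sets borel"
  by (simp add: diff_law_def)

lemma space_diff_law [simp]: "space diff_law = UNIV"
  by (simp add: diff_law_def)

lemma distr_diff:
  assumes "i \<noteq> j"
  shows "distr M borel (\<lambda>\<omega>. \<xi> i \<omega> - \<xi> j \<omega>) = diff_law"
proof -
  have *: "distr M borel (\<lambda>\<omega>. \<xi> i \<omega> - \<xi> j \<omega>)
      = distr (distr M borel (\<xi> 0) \<Otimes>\<^sub>M distr M borel (\<xi> 0)) borel (\<lambda>(x, y). x - y)"
    if "i \<noteq> j" for i j
  proof -
    have "distr M borel (\<xi> 0) \<Otimes>\<^sub>M distr M borel (\<xi> 0)
        = distr M (borel \<Otimes>\<^sub>M borel) (\<lambda>\<omega>. (\<xi> i \<omega>, \<xi> j \<omega>))"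
      using indep_var_from_indep_vars[OF indep_\<xi> that] distr_\<xi>
      unfolding indep_var_distribution_eq by metis
    thus ?thesis
      by (simp add: distr_distr comp_def)
  qed
  show ?thesis
    unfolding diff_law_def *[OF assms] by (rule *[symmetric]) simp
qed

lemma expectation_diff:
  fixes f :: "real \<Rightarrow> real"
  assumes "i \<noteq> j" and [measurable]: "f \<in> borel_measurable borel"
  shows "expectation (\<lambda>\<omega>. f (\<xi> i \<omega> - \<xi> j \<omega>)) = (LINT x|diff_law. f x)"
  unfolding distr_diff[OF assms(1), symmetric] by (rule integral_distr[symmetric]) auto

lemma prob_diff:
  assumes "i \<noteq> j" and [measurable]: "Measurable.pred borel P"
  shows "prob {\<omega> \<in> space M. P (\<xi> i \<omega> - \<xi> j \<omega>)} = measure diff_law {x. P x}"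
  unfolding distr_diff[OF assms(1), symmetric]
  by (subst measure_distr) (auto simp: vimage_def Int_def conj_commute)

lemma cos_diff_law: "(LINT x|diff_law. cos (t * x)) = (norm (char (distr M borel (\<xi> 0)) t))\<^sup>2"
proof -
  have ind: "indep_var borel (\<xi> 1) borel (\<xi> 0)"
    by (rule indep_var_from_indep_vars[OF indep_\<xi>]) simp
  have f: "(\<lambda>x::real. iexp (t * x)) \<in> borel_measurable borel"
    by measurable
  have g: "(\<lambda>x::real. cnj (iexp (t * x))) \<in> borel_measurable borel"
    by (intro borel_measurable_continuous_onI continuous_intros)
  have ind': "indep_var borel (\<lambda>\<omega>. iexp (t * \<xi> 1 \<omega>)) borel (\<lambda>\<omega>. cnj (iexp (t * \<xi> 0 \<omega>)))"
    using indep_var_compose[OF ind f g] by (simp only: comp_def)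
  have ch: "expectation (\<lambda>\<omega>. iexp (t * \<xi> i \<omega>)) = char (distr M borel (\<xi> 0)) t" for i
    unfolding distr_\<xi>[of i, symmetric] char_def by (subst integral_distr) auto
  have int: "complex_integrable M (\<lambda>\<omega>. iexp (t * \<xi> i \<omega>))" for i
    by (rule integrable_const_bound[where B=1]) auto
  have int': "complex_integrable M (\<lambda>\<omega>. iexp (t * (\<xi> 1 \<omega> - \<xi> 0 \<omega>)))"
    by (rule integrable_const_bound[where B=1]) auto
  have "expectation (\<lambda>\<omega>. iexp (t * (\<xi> 1 \<omega> - \<xi> 0 \<omega>)))
      = expectation (\<lambda>\<omega>. iexp (t * \<xi> 1 \<omega>) * cnj (iexp (t * \<xi> 0 \<omega>)))"
    by (intro Bochner_Integration.integral_cong refl)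
      (simp add: exp_cnj algebra_simps flip: exp_add)
  also have "\<dots> = char (distr M borel (\<xi> 0)) t * cnj (char (distr M borel (\<xi> 0)) t)"
    unfolding indep_var_lebesgue_integral[OF ind' int integrable_cnj[OF int]] Bochner_Integration.integral_cnj ch ..
  also have "\<dots> = complex_of_real ((norm (char (distr M borel (\<xi> 0)) t))\<^sup>2)"
    by (rule complex_norm_square[symmetric])
  finally have "Re (expectation (\<lambda>\<omega>. iexp (t * (\<xi> 1 \<omega> - \<xi> 0 \<omega>)))) = (norm (char (distr M borel (\<xi> 0)) t))\<^sup>2"
    by simp
  also have "Re (expectation (\<lambda>\<omega>. iexp (t * (\<xi> 1 \<omega> - \<xi> 0 \<omega>)))) = expectation (\<lambda>\<omega>. cos (t * (\<xi> 1 \<omega> - \<xi> 0 \<omega>)))"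
    using int' by (simp add: Re_exp flip: integral_Re)
  also have "\<dots> = (LINT x|diff_law. cos (t * x))"
    by (rule expectation_diff) auto
  finally show ?thesis .
qed

lemma integrable_diff_law_bounded:
  fixes f :: "real \<Rightarrow> real"
  assumes "f \<in> borel_measurable borel" "\<And>x. \<bar>f x\<bar> \<le> K"
  shows "integrable diff_law f"
proof -
  interpret D: prob_space diff_law
    by (rule prob_space_diff_law)
  show ?thesis
    by (rule D.integrable_const_bound[where B=K]) (use assms in auto)
qed

lemma one_minus_cos_bounds: "\<bar>1 - cos (s::real)\<bar> \<le> 2" "\<bar>(1 - cos s)\<^sup>2\<bar> \<le> 4"
proof -
  show *: "\<bar>1 - cos s\<bar> \<le> 2"
    by (smt (verit) cos_ge_minus_one cos_le_one)
  from power_mono[OF this, of 2] show "\<bar>(1 - cos s)\<^sup>2\<bar> \<le> 4"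
    by simp
qed

text \<open>All that is used of the hypothesis that \<open>\<xi>\<close> is in the domain of attraction of the normal law.\<close>
lemma scaled_one_minus_cos:
  obtains b :: "nat \<Rightarrow> real" where "\<And>n. 0 < b n"
    "\<And>t. (\<lambda>n. real n * (LINT x|diff_law. 1 - cos (t * (x / b n)))) \<longlonglongrightarrow> t\<^sup>2"
    "\<And>t. (\<lambda>n. real n * (LINT x|diff_law. (1 - cos (t * (x / b n)))\<^sup>2)) \<longlonglongrightarrow> 0"
proof -
  obtain a b where b: "\<And>n. 0 < b n"
    and Z: "conv_std_normal (\<lambda>n \<omega>. ((\<Sum>i=1..n. \<xi> i \<omega>) - a n) / b n)"
    using DAN_\<xi> unfolding DAN_def by blast
  interpret D: prob_space diff_law
    by (rule prob_space_diff_law)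
  let ?\<phi> = "char (distr M borel (\<xi> 0))"
  have \<phi>1: "norm (?\<phi> t) \<le> 1" for t
    by (intro real_distribution.cmod_char_le_1 real_distribution_distr) auto
  have 1: "(\<lambda>n. real n * (LINT x|diff_law. 1 - cos (t * (x / b n)))) \<longlonglongrightarrow> t\<^sup>2" for t
  proof -
    have "(\<lambda>n. expectation (\<lambda>\<omega>. iexp (t * (((\<Sum>i=1..n. \<xi> i \<omega>) - a n) / b n))))
        \<longlonglongrightarrow> complex_of_real (exp (- t\<^sup>2 / 2))"
      using Z by (subst (asm) conv_std_normal_iff_char) auto
    from tendsto_norm[OF this]
    have "(\<lambda>n. norm (expectation (\<lambda>\<omega>. iexp (t * (((\<Sum>i=1..n. \<xi> i \<omega>) - a n) / b n)))))
        \<longlonglongrightarrow> exp (- t\<^sup>2 / 2)"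
      by simp
    moreover have "norm (expectation (\<lambda>\<omega>. iexp (t * (((\<Sum>i=1..n. \<xi> i \<omega>) - a n) / b n))))
        = norm (?\<phi> (t / b n)) ^ n" for n
    proof -
      have "expectation (\<lambda>\<omega>. iexp (t * (((\<Sum>i=1..n. \<xi> i \<omega>) - a n) / b n)))
          = expectation (\<lambda>\<omega>. iexp (t / b n * (\<Sum>i=1..n. \<xi> i \<omega>)) * iexp (- t * a n / b n))"
        by (intro Bochner_Integration.integral_cong refl)
          (simp add: algebra_simps diff_divide_distrib flip: exp_add)
      also have "\<dots> = char (distr M borel (\<lambda>\<omega>. \<Sum>i=1..n. \<xi> i \<omega>)) (t / b n) * iexp (- t * a n / b n)"
        unfolding char_def by (subst integral_distr) auto
      also have "char (distr M borel (\<lambda>\<omega>. \<Sum>i=1..n. \<xi> i \<omega>)) (t / b n)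
          = (\<Prod>i=1..n. char (distr M borel (\<xi> i)) (t / b n))"
        by (rule char_distr_sum, rule indep_vars_subset[OF indep_\<xi>]) auto
      also have "\<dots> = ?\<phi> (t / b n) ^ n"
        by (subst distr_\<xi>) simp
      finally show ?thesis
        by (simp add: norm_mult norm_power)
    qed
    ultimately have "(\<lambda>n. norm (?\<phi> (t / b n)) ^ n) \<longlonglongrightarrow> exp (- t\<^sup>2 / 2)"
      by simp
    from tendsto_power[OF this, of 2]
    have "(\<lambda>n. ((norm (?\<phi> (t / b n)))\<^sup>2) ^ n) \<longlonglongrightarrow> exp (- t\<^sup>2)"
      by (simp add: mult.commute flip: power_mult exp_of_nat_mult)
    hence "(\<lambda>n. real n * (1 - (norm (?\<phi> (t / b n)))\<^sup>2)) \<longlonglongrightarrow> t\<^sup>2"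
      by (rule power_tendsto_exp_imp_linear[rotated 2]) (auto simp: \<phi>1 power_le_one)
    moreover have "(LINT x|diff_law. 1 - cos (t * (x / b n))) = 1 - (norm (?\<phi> (t / b n)))\<^sup>2" for n
    proof -
      have "integrable diff_law (\<lambda>x. cos (t / b n * x))"
        by (rule integrable_diff_law_bounded[where K=1]) auto
      hence "(LINT x|diff_law. 1 - cos (t / b n * x)) = 1 - (norm (?\<phi> (t / b n)))\<^sup>2"
        using D.prob_space cos_diff_law[of "t / b n"] by simp
      thus ?thesis
        by simp
    qed
    ultimately show ?thesis
      by simp
  qed
  have 2: "(\<lambda>n. real n * (LINT x|diff_law. (1 - cos (t * (x / b n)))\<^sup>2)) \<longlonglongrightarrow> 0" for t
  proof -
    have i: "integrable diff_law (\<lambda>x. 1 - cos (r * (x / b n)))" for r n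
      by (rule integrable_diff_law_bounded[OF _ one_minus_cos_bounds(1)]) auto
    have i2: "integrable diff_law (\<lambda>x. (1 - cos (r * (x / b n))) / 2)" for r n
      by (rule integrable_divide) (rule i)
    have i3: "integrable diff_law (\<lambda>x. 2 * (1 - cos (r * (x / b n))))" for r n
      by (rule integrable_mult_right) (rule i)
    have halve: "y = 2 * c - d / 2" if "2 * y = 4 * c - d" for y c d :: real
      using that by simp
    have "(LINT x|diff_law. (1 - cos (t * (x / b n)))\<^sup>2)
        = (LINT x|diff_law. 2 * (1 - cos (t * (x / b n))) - (1 - cos (2 * t * (x / b n))) / 2)" for n
    proof (rule Bochner_Integration.integral_cong[OF refl])
      fix x
      show "(1 - cos (t * (x / b n)))\<^sup>2 = 2 * (1 - cos (t * (x / b n))) - (1 - cos (2 * t * (x / b n))) / 2"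
        using halve[OF one_minus_cos_square[of "t * (x / b n)"]] unfolding mult.assoc .
    qed
    also have "\<And>n. \<dots> n = 2 * (LINT x|diff_law. 1 - cos (t * (x / b n)))
        - (LINT x|diff_law. 1 - cos (2 * t * (x / b n))) / 2"
      unfolding Bochner_Integration.integral_diff[OF i3 i2]
        integral_mult_right_zero integral_divide_zero ..
    finally have eq: "(LINT x|diff_law. (1 - cos (t * (x / b n)))\<^sup>2)
        = 2 * (LINT x|diff_law. 1 - cos (t * (x / b n))) - (LINT x|diff_law. 1 - cos (2 * t * (x / b n))) / 2" for n .
    have "(\<lambda>n. 2 * (real n * (LINT x|diff_law. 1 - cos (t * (x / b n))))
        - real n * (LINT x|diff_law. 1 - cos (2 * t * (x / b n))) / 2) \<longlonglongrightarrow> 2 * t\<^sup>2 - (2 * t)\<^sup>2 / 2"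
      by (intro tendsto_intros 1) simp
    thus ?thesis
      unfolding eq by (simp add: algebra_simps)
  qed
  show thesis
    using b 1 2 by (rule that)
qed

text \<open>
  The Gaussian average over \<open>t\<close> of \<open>n E(1 - cos(t X / b\<^sub>n))\<^sup>2\<close>, restricted to the tail event, is at least a
  constant times \<open>n p\<^sub>n\<close>, where \<open>p\<^sub>n\<close> is the tail probability. Interchanging the limit with this average
  requires a dominating function, which is obtained by dividing by \<open>k\<^sub>n = max 1 (4 n p\<^sub>n)\<close>: the
  integrand is then at most \<open>1\<close>, one finds \<open>n p\<^sub>n / k\<^sub>n \<rightarrow> 0\<close>, and this excludes \<open>k\<^sub>n > 1\<close> for large \<open>n\<close>.
\<close>
lemma scaled_tail_tendsto_0:
  assumes b: "\<And>n. 0 < b n"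
    and H: "\<And>t. (\<lambda>n. real n * (LINT x|diff_law. (1 - cos (t * (x / b n)))\<^sup>2)) \<longlonglongrightarrow> 0"
    and \<tau>: "0 < \<tau>"
  shows "(\<lambda>n. real n * measure diff_law {x. \<tau> * b n < \<bar>x\<bar>}) \<longlonglongrightarrow> 0"
proof -
  let ?N = std_normal_distribution
  interpret N: real_distribution ?N
    by (rule real_dist_normal_dist)
  interpret D: prob_space diff_law
    by (rule prob_space_diff_law)
  interpret DN: pair_prob_space diff_law ?N
    by unfold_locales
  define p where "p n = measure diff_law {x. \<tau> * b n < \<bar>x\<bar>}" for n
  define f where "f n x t = indicator {x. \<tau> * b n < \<bar>x\<bar>} x * (1 - cos (t * (x / b n)))\<^sup>2" for n and x t :: real
  (* dividing by k bounds the averages h by 1, whatever the size of n * p n *)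
  define k where "k n = max 1 (4 * real n * p n)" for n
  define C where "C = 3 / 2 * (1 - exp (- \<tau>\<^sup>2 / 2))\<^sup>2"
  have C: "0 < C"
    using \<tau> by (simp add: C_def)
  have p0: "0 \<le> p n" for n
    by (simp add: p_def)
  have k1: "1 \<le> k n" "4 * real n * p n \<le> k n" for n
    by (auto simp: k_def)
  have [measurable]: "{x. \<tau> * b n < \<bar>x\<bar>} \<in> sets borel" for n
    by measurable
  have fm[measurable]: "(\<lambda>(x, t). f n x t) \<in> borel_measurable (diff_law \<Otimes>\<^sub>M ?N)" for n
    unfolding f_def by measurable
  have f0: "0 \<le> f n x t" and f4: "f n x t \<le> 4 * indicator {x. \<tau> * b n < \<bar>x\<bar>} x"
    and fle: "f n x t \<le> (1 - cos (t * (x / b n)))\<^sup>2" for n x t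
    using one_minus_cos_bounds(2)[of "t * (x / b n)"] by (auto simp: f_def indicator_def)
  have f44: "\<bar>f n x t\<bar> \<le> 4" for n x t
    using f0[of n x t] f4[of n x t] by (cases "\<tau> * b n < \<bar>x\<bar>") auto
  have intx: "integrable diff_law (\<lambda>x. f n x t)" for n t
    by (rule integrable_diff_law_bounded[OF _ f44]) (simp add: f_def)
  have int: "integrable (diff_law \<Otimes>\<^sub>M ?N) (\<lambda>(x, t). f n x t)" for n
    by (rule DN.P.integrable_const_bound[where B=4]) (use f44 in \<open>auto simp: split_beta\<close>)
  define h where "h n t = real n / k n * (LINT x|diff_law. f n x t)" for n t
  have hm[measurable]: "h n \<in> borel_measurable ?N" for n
  proof -
    have "(\<lambda>t. LINT x|diff_law. (\<lambda>(x, t). f n x t) (x, t)) \<in> borel_measurable ?N"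
      by (rule D.borel_measurable_lebesgue_integral) (use measurable_pair_swap[OF fm[of n]] in \<open>simp add: split_beta\<close>)
    thus ?thesis
      unfolding h_def by simp
  qed
  have gp: "0 \<le> (LINT x|diff_law. f n x t)" for n t
    by (rule Bochner_Integration.integral_nonneg) (rule f0)
  have h0: "0 \<le> h n t" for n t
    unfolding h_def using k1[of n] gp by (intro mult_nonneg_nonneg divide_nonneg_nonneg) auto
  have h1: "h n t \<le> 1" for n t
  proof -
    have "(LINT x|diff_law. f n x t) \<le> (LINT x|diff_law. 4 * indicator {x. \<tau> * b n < \<bar>x\<bar>} x)"
      by (intro integral_mono intx f4) (auto simp: D.emeasure_eq_measure)
    also have "\<dots> = 4 * p n"
      by (simp add: p_def)
    finally have "real n / k n * (LINT x|diff_law. f n x t) \<le> real n / k n * (4 * p n)"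
      using k1[of n] by (intro mult_left_mono divide_nonneg_nonneg) auto
    also have "\<dots> \<le> 1"
      using k1[of n] by (simp add: field_simps)
    finally show ?thesis
      by (simp add: h_def)
  qed
  have hlim: "(\<lambda>n. h n t) \<longlonglongrightarrow> 0" for t
  proof (rule tendsto_sandwich[OF _ _ tendsto_const H[of t]])
    have "h n t \<le> real n * (LINT x|diff_law. (1 - cos (t * (x / b n)))\<^sup>2)" for n
    proof -
      have "(LINT x|diff_law. f n x t) \<le> (LINT x|diff_law. (1 - cos (t * (x / b n)))\<^sup>2)"
        by (intro integral_mono intx fle integrable_diff_law_bounded[OF _ one_minus_cos_bounds(2)]) auto
      moreover have "real n / k n \<le> real n"
        using k1[of n] by (simp add: divide_le_eq mult_left_mono[of 1 "k n" "real n", simplified])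
      ultimately show ?thesis
        unfolding h_def using gp by (intro mult_mono) auto
    qed
    thus "\<forall>\<^sub>F n in sequentially. h n t \<le> real n * (LINT x|diff_law. (1 - cos (t * (x / b n)))\<^sup>2)"
      by simp
  qed (simp add: h0)
  have "(\<lambda>n. LINT t|?N. h n t) \<longlonglongrightarrow> (LINT t|?N. 0)"
    by (rule integral_dominated_convergence[where w="\<lambda>_. 1"]) (use h0 h1 hlim in \<open>auto intro!: AE_I2\<close>)
  hence avg: "(\<lambda>n. LINT t|?N. h n t) \<longlonglongrightarrow> 0"
    by simp
  have low: "C * (real n * p n / k n) \<le> (LINT t|?N. h n t)" for n
  proof -
    have "C * p n = (LINT x|diff_law. C * indicator {x. \<tau> * b n < \<bar>x\<bar>} x)"
      by (simp add: p_def)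
    also have "\<dots> \<le> (LINT x|diff_law. LINT t|?N. f n x t)"
    proof (rule integral_mono)
      show "integrable diff_law (\<lambda>x. LINT t|?N. f n x t)"
        using DN.integrable_fst[OF int[of n]] by simp
      fix x
      show "C * indicator {x. \<tau> * b n < \<bar>x\<bar>} x \<le> (LINT t|?N. f n x t)"
      proof (cases "\<tau> * b n < \<bar>x\<bar>")
        case True
        hence "\<tau> \<le> \<bar>x / b n\<bar>"
          using b[of n] by (simp add: abs_divide pos_le_divide_eq)
        from std_normal_average_one_minus_cos_square[OF \<tau> this] show ?thesis
          using True by (simp add: f_def C_def)
      qed (auto intro!: Bochner_Integration.integral_nonneg f0)
    qed (auto simp: D.emeasure_eq_measure)
    also have "\<dots> = (LINT t|?N. LINT x|diff_law. f n x t)"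
      using DN.Fubini_integral[OF int[of n]] by simp
    finally have "real n / k n * (C * p n) \<le> real n / k n * (LINT t|?N. LINT x|diff_law. f n x t)"
      using k1[of n] by (intro mult_left_mono divide_nonneg_nonneg) auto
    thus ?thesis
      by (simp add: h_def mult_ac)
  qed
  have r: "(\<lambda>n. real n * p n / k n) \<longlonglongrightarrow> 0"
  proof (rule tendsto_sandwich[OF _ _ tendsto_const])
    show "(\<lambda>n. (LINT t|?N. h n t) / C) \<longlonglongrightarrow> 0"
      using tendsto_divide_zero[OF avg] .
    show "\<forall>\<^sub>F n in sequentially. real n * p n / k n \<le> (LINT t|?N. h n t) / C"
      using low C by (simp add: pos_le_divide_eq mult.commute)
    show "\<forall>\<^sub>F n in sequentially. 0 \<le> real n * p n / k n"
      using p0 k1 by (intro always_eventually allI divide_nonneg_nonneg mult_nonneg_nonneg) (auto intro: order_trans[OF zero_le_one])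
  qed
  have "\<forall>\<^sub>F n in sequentially. real n * p n / k n = real n * p n"
    using order_tendstoD(2)[OF r, of "1 / 4", simplified]
  proof eventually_elim
    case (elim n)
    have "k n = 1"
    proof (rule ccontr)
      assume "k n \<noteq> 1"
      hence "k n = 4 * real n * p n" "1 < k n"
        by (auto simp: k_def max_def split: if_splits)
      with elim show False
        by (cases "n = 0 \<or> p n = 0") auto
    qed
    thus ?case
      by simp
  qed
  from tendsto_cong[OF this] r show ?thesis
    unfolding p_def by simp
qed

lemma indep_pairs: "indep_vars (\<lambda>_. borel) (\<lambda>k \<omega>. \<xi> (2 * k + 1) \<omega> - \<xi> (2 * k + 2) \<omega>) UNIV"
proof -
  let ?K = "\<lambda>k::nat. {2 * k + 1, 2 * k + 2}"
  have ind: "indep_vars (\<lambda>k. PiM (?K k) (\<lambda>_. borel)) (\<lambda>k \<omega>. restrict (\<lambda>i. \<xi> i \<omega>) (?K k)) UNIV"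
  proof (rule indep_vars_restrict[OF indep_\<xi>])
    show "disjoint_family_on ?K UNIV"
      by (auto simp: disjoint_family_on_def)
  qed auto
  have "indep_vars (\<lambda>_. borel)
      (\<lambda>k \<omega>. (\<lambda>f. f (2 * k + 1) - f (2 * k + 2)) (restrict (\<lambda>i. \<xi> i \<omega>) (?K k))) UNIV"
    by (rule indep_vars_compose2[OF ind])
      (intro borel_measurable_diff measurable_component_singleton; simp)
  thus ?thesis
    by simp
qed

text \<open>Chebyshev's inequality for the bounded variables \<open>1 - cos(t\<^sub>n X\<^sub>k)\<close> over the \<open>n div 2\<close> disjoint pairs.\<close>
lemma pair_sum_lower:
  fixes t :: "nat \<Rightarrow> real"
  defines "e \<equiv> \<lambda>n. LINT x|diff_law. 1 - cos (t n * x)"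
    and "v \<equiv> \<lambda>n. LINT x|diff_law. (1 - cos (t n * x))\<^sup>2"
  assumes e: "\<forall>\<^sub>F n in sequentially. 0 < e n"
    and lim: "(\<lambda>n. v n / (real (n div 2) * (e n)\<^sup>2)) \<longlonglongrightarrow> 0"
  shows "likely (\<lambda>n \<omega>. real (n div 2) * e n / 2
    \<le> (\<Sum>k<n div 2. 1 - cos (t n * (\<xi> (2 * k + 1) \<omega> - \<xi> (2 * k + 2) \<omega>))))"
proof -
  define Y where "Y n k \<omega> = 1 - cos (t n * (\<xi> (2 * k + 1) \<omega> - \<xi> (2 * k + 2) \<omega>))" for n k \<omega>
  define N where "N n = n div 2" for n :: nat
  have [measurable]: "Y n k \<in> borel_measurable M" for n k
    unfolding Y_def by measurable
  have Ye: "expectation (Y n k) = e n" for n k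
    unfolding Y_def e_def by (rule expectation_diff) auto
  have Yv: "expectation (\<lambda>\<omega>. (Y n k \<omega>)\<^sup>2) = v n" for n k
    unfolding Y_def v_def by (rule expectation_diff) auto
  have Yb: "\<bar>(Y n k \<omega>)\<^sup>2\<bar> \<le> 4" for n k \<omega>
    unfolding Y_def by (rule one_minus_cos_bounds(2))
  have sq: "integrable M (\<lambda>\<omega>. (Y n k \<omega>)\<^sup>2)" for n k
    by (rule integrable_const_bound[where B=4]) (use Yb in auto)
  have ind: "indep_vars (\<lambda>_. borel) (Y n) {..<N n}" for n
    unfolding Y_def by (rule indep_vars_compose2[OF indep_vars_subset[OF indep_pairs]]) auto
  define Z where "Z n \<omega> = ((\<Sum>k<N n. Y n k \<omega> - e n) / (real (N n) * e n))\<^sup>2" for n \<omega>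
  note var = variance_sum_indep[OF finite_lessThan ind sq, unfolded Ye Yv]
  have Z: "conv_prob (\<lambda>n \<omega>. Z n \<omega>) 0"
  proof (rule tendsto_whp_expectation)
    show "integrable M (Z n)" for n
      unfolding Z_def power_divide by (intro integrable_divide var(1))
    have le: "expectation (Z n) \<le> v n / (real (N n) * (e n)\<^sup>2)" for n
    proof -
      have "expectation (Z n) = expectation (\<lambda>\<omega>. (\<Sum>k<N n. Y n k \<omega> - e n)\<^sup>2) / (real (N n) * e n)\<^sup>2"
        unfolding Z_def power_divide by simp
      also have "\<dots> \<le> (\<Sum>k<N n. v n) / (real (N n) * e n)\<^sup>2"
        by (intro divide_right_mono var(2)) auto
      also have "\<dots> = v n / (real (N n) * (e n)\<^sup>2)"
        by (cases "N n = 0") (simp_all add: power2_eq_square)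
      finally show ?thesis .
    qed
    have ge: "0 \<le> expectation (Z n)" for n
      unfolding Z_def by (rule Bochner_Integration.integral_nonneg) simp
    show "(\<lambda>n. expectation (Z n)) \<longlonglongrightarrow> 0"
      by (rule tendsto_sandwich[OF _ _ tendsto_const lim]) (use le ge in \<open>auto simp: N_def\<close>)
  qed (simp add: Z_def)
  have "likely (\<lambda>n \<omega>. Z n \<omega> < 1 / 4)"
    by (rule order_tendstoD(2)[OF Z]) simp
  moreover have "likely (\<lambda>n \<omega>. 0 < e n)"
    by (rule eventually_whp_fst[OF e])
  ultimately show ?thesis
  proof eventually_elim
    case (elim p)
    obtain n \<omega> where p: "p = (n, \<omega>)"
      by (cases p)
    have e0: "0 < e n" and Zl: "Z n \<omega> < (1 / 2)\<^sup>2"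
      using elim by (auto simp: p power2_eq_square)
    show ?case
    proof (cases "N n = 0")
      case False
      let ?D = "real (N n) * e n"
      have D: "0 < ?D"
        using False e0 by simp
      have "\<bar>(\<Sum>k<N n. Y n k \<omega> - e n) / ?D\<bar> < 1 / 2"
        using Zl unfolding Z_def by (metis abs_of_pos abs_square_less_1 half_gt_zero_iff power2_less_imp_less real_sqrt_abs real_sqrt_less_iff zero_less_one)
      hence "\<bar>(\<Sum>k<N n. Y n k \<omega> - e n)\<bar> < ?D / 2"
        using D by (simp add: abs_divide pos_divide_less_eq)
      moreover have "(\<Sum>k<N n. Y n k \<omega> - e n) = (\<Sum>k<N n. Y n k \<omega>) - ?D"
        by (simp add: sum_subtractf)
      ultimately have "?D / 2 \<le> (\<Sum>k<N n. Y n k \<omega>)"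
        by linarith
      thus ?thesis
        by (simp add: p N_def Y_def)
    qed (simp add: p N_def)
  qed
qed

text \<open>
  Since \<open>1 - cos s \<le> s\<^sup>2/2\<close>, the bounded sums also bound the centred sum of squares from below. It is applied
  with a constant \<open>t\<close> for the linear growth and with \<open>t\<^sub>n = 1 / b\<^sub>n\<close> for growth of order \<open>b\<^sub>n\<^sup>2\<close>.
\<close>
lemma centred_ss_lower:
  fixes t :: "nat \<Rightarrow> real"
  defines "e \<equiv> \<lambda>n. LINT x|diff_law. 1 - cos (t n * x)"
    and "v \<equiv> \<lambda>n. LINT x|diff_law. (1 - cos (t n * x))\<^sup>2"
  assumes t: "\<And>n. t n \<noteq> 0" and e: "\<forall>\<^sub>F n in sequentially. 0 < e n"
    and lim: "(\<lambda>n. v n / (real (n div 2) * (e n)\<^sup>2)) \<longlonglongrightarrow> 0"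
  shows "likely (\<lambda>n \<omega>. real (n div 2) * e n / 2
    \<le> (t n)\<^sup>2 * centred_ss n (\<lambda>i. \<xi> i \<omega>))"
  using pair_sum_lower[of t, OF e[unfolded e_def] lim[unfolded e_def v_def]]
proof eventually_elim
  case (elim p)
  let ?n = "fst p" and ?d = "\<lambda>k. \<xi> (2 * k + 1) (snd p) - \<xi> (2 * k + 2) (snd p)"
  have "(\<Sum>k<?n div 2. 1 - cos (t ?n * ?d k)) \<le> (\<Sum>k<?n div 2. (t ?n * ?d k)\<^sup>2 / 2)"
    by (rule sum_mono) (rule one_minus_cos_le)
  also have "\<dots> = (t ?n)\<^sup>2 * ((\<Sum>k<?n div 2. (?d k)\<^sup>2) / 2)"
    by (simp add: power_mult_distrib sum_distrib_left sum_divide_distrib)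
  also have "\<dots> \<le> (t ?n)\<^sup>2 * centred_ss ?n (\<lambda>i. \<xi> i (snd p))"
    by (intro mult_left_mono centred_ss_ge_pairs) auto
  finally show ?case
    using elim unfolding e_def by simp
qed

lemma centred_ss_ge_linear:
  obtains c0 where "0 < c0" "likely (\<lambda>n \<omega>. c0 * real n \<le> centred_ss n (\<lambda>i. \<xi> i \<omega>))"
proof -
  obtain b :: "nat \<Rightarrow> real" where b: "\<And>n. 0 < b n"
    and 1: "\<And>t. (\<lambda>n. real n * (LINT x|diff_law. 1 - cos (t * (x / b n)))) \<longlonglongrightarrow> t\<^sup>2"
    and "\<And>t. (\<lambda>n. real n * (LINT x|diff_law. (1 - cos (t * (x / b n)))\<^sup>2)) \<longlonglongrightarrow> 0"
    by (rule scaled_one_minus_cos) (rule that)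
  have "\<forall>\<^sub>F n in sequentially. 0 < real n * (LINT x|diff_law. 1 - cos (1 * (x / b n)))"
    by (rule order_tendstoD(1)[OF 1]) simp
  then obtain m where m: "0 < real m * (LINT x|diff_law. 1 - cos (1 * (x / b m)))"
    by (auto simp: eventually_sequentially)
  define t where "t = 1 / b m"
  define e where "e = (LINT x|diff_law. 1 - cos (t * x))"
  define v where "v = (LINT x|diff_law. (1 - cos (t * x))\<^sup>2)"
  have t: "t \<noteq> 0"
    using b[of m] by (simp add: t_def)
  have e: "0 < e"
    using m by (simp add: e_def t_def zero_less_mult_iff)
  have "(\<lambda>n. v / (e\<^sup>2) * inverse (real n) * inverse (real (n div 2) / real n)) \<longlonglongrightarrow> v / (e\<^sup>2) * 0 * inverse (1 / 2)"
    by (intro tendsto_intros lim_inverse_n half_tendsto) simp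
  hence "(\<lambda>n. v / (e\<^sup>2) * inverse (real n) * inverse (real (n div 2) / real n)) \<longlonglongrightarrow> 0"
    by simp
  moreover have "\<forall>\<^sub>F n in sequentially. v / (e\<^sup>2) * inverse (real n) * inverse (real (n div 2) / real n)
      = v / (real (n div 2) * e\<^sup>2)"
    using eventually_gt_at_top[of 0] by eventually_elim (simp add: field_simps)
  ultimately have lim: "(\<lambda>n. v / (real (n div 2) * e\<^sup>2)) \<longlonglongrightarrow> 0"
    by (rule Lim_transform_eventually)
  have ev: "likely (\<lambda>n \<omega>. real (n div 2) * e / 2 \<le> t\<^sup>2 * centred_ss n (\<lambda>i. \<xi> i \<omega>))"
    using centred_ss_lower[of "\<lambda>_. t"] t e lim by (simp add: e_def v_def)
  have "\<forall>\<^sub>F n in sequentially. 1 / 4 < real (n div 2) / real n \<and> 0 < n"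
    using order_tendstoD(1)[OF half_tendsto, of "1 / 4"] eventually_gt_at_top[of 0]
    by (simp add: eventually_conj)
  from eventually_whp_fst[OF this] ev
  have "likely (\<lambda>n \<omega>. e / (8 * t\<^sup>2) * real n \<le> centred_ss n (\<lambda>i. \<xi> i \<omega>))"
  proof eventually_elim
    case (elim p)
    hence "1 / 4 * real (fst p) < real (fst p div 2)"
      by (intro pos_less_divide_eq[THEN iffD1]) auto
    hence "real (fst p) / 4 \<le> real (fst p div 2)"
      by simp
    hence "real (fst p) / 4 * e \<le> real (fst p div 2) * e"
      using e by (intro mult_right_mono) auto
    hence "real (fst p) / 4 * e / 2 \<le> t\<^sup>2 * centred_ss (fst p) (\<lambda>i. \<xi> i (snd p))"
      using elim by simp
    thus ?case
      using t by (simp add: field_simps)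
  qed
  thus thesis
    using e t by (intro that[of "e / (8 * t\<^sup>2)"]) auto
qed

text \<open>
  By the tail estimate and a union bound, with high probability all \<open>\<xi>\<^sub>i\<close> are within \<open>\<tau> b\<^sub>n\<close> of \<open>\<xi>\<^sub>0\<close>, which
  serves as an independent pivot, and hence within \<open>2 \<tau> b\<^sub>n\<close> of the sample mean. The fourth powers are then
  at most \<open>4 \<tau>\<^sup>2 b\<^sub>n\<^sup>2\<close> times the squares, and the sum of squares is at least \<open>b\<^sub>n\<^sup>2 / 8\<close>.
\<close>
lemma fourth_power_ratio:
  "conv_prob (\<lambda>n \<omega>. (\<Sum>i=1..n. (\<xi> i \<omega> - smean n (\<lambda>i. \<xi> i \<omega>)) ^ 4)
      / (centred_ss n (\<lambda>i. \<xi> i \<omega>))\<^sup>2) 0"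
proof -
  obtain b :: "nat \<Rightarrow> real" where b: "\<And>n. 0 < b n"
    and 1: "\<And>t. (\<lambda>n. real n * (LINT x|diff_law. 1 - cos (t * (x / b n)))) \<longlonglongrightarrow> t\<^sup>2"
    and 2: "\<And>t. (\<lambda>n. real n * (LINT x|diff_law. (1 - cos (t * (x / b n)))\<^sup>2)) \<longlonglongrightarrow> 0"
    by (rule scaled_one_minus_cos) (rule that)
  define e where "e n = (LINT x|diff_law. 1 - cos (1 / b n * x))" for n
  define v where "v n = (LINT x|diff_law. (1 - cos (1 / b n * x))\<^sup>2)" for n
  have e1: "(\<lambda>n. real n * e n) \<longlonglongrightarrow> 1"
    using 1[of 1] by (simp add: e_def)
  have v0: "(\<lambda>n. real n * v n) \<longlonglongrightarrow> 0"
    using 2[of 1] by (simp add: v_def)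
  have en: "\<forall>\<^sub>F n in sequentially. 0 < real n * e n"
    by (rule order_tendstoD(1)[OF e1]) simp
  hence e: "\<forall>\<^sub>F n in sequentially. 0 < e n"
    by eventually_elim (simp add: zero_less_mult_iff)
  have "(\<lambda>n. real n * v n * inverse (real (n div 2) / real n) * inverse ((real n * e n)\<^sup>2))
      \<longlonglongrightarrow> 0 * inverse (1 / 2) * inverse (1\<^sup>2)"
    by (intro tendsto_intros v0 half_tendsto e1) auto
  hence "(\<lambda>n. real n * v n * inverse (real (n div 2) / real n) * inverse ((real n * e n)\<^sup>2)) \<longlonglongrightarrow> 0"
    by simp
  moreover have "\<forall>\<^sub>F n in sequentially.
      real n * v n * inverse (real (n div 2) / real n) * inverse ((real n * e n)\<^sup>2)
      = v n / (real (n div 2) * (e n)\<^sup>2)"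
    using eventually_gt_at_top[of 0] by eventually_elim (simp add: field_simps power2_eq_square)
  ultimately have lim: "(\<lambda>n. v n / (real (n div 2) * (e n)\<^sup>2)) \<longlonglongrightarrow> 0"
    by (rule Lim_transform_eventually)
  have ev: "likely (\<lambda>n \<omega>. real (n div 2) * e n / 2
      \<le> (1 / b n)\<^sup>2 * centred_ss n (\<lambda>i. \<xi> i \<omega>))"
  proof -
    have "1 / b n \<noteq> 0" for n
      using b[of n] by simp
    thus ?thesis
      using centred_ss_lower[of "\<lambda>n. 1 / b n"] e lim unfolding e_def v_def by blast
  qed
  have "(\<lambda>n. real (n div 2) / real n * (real n * e n) / 2) \<longlonglongrightarrow> 1 / 2 * 1 / 2"
    by (intro tendsto_intros half_tendsto e1) simp
  hence "\<forall>\<^sub>F n in sequentially. 1 / 8 < real (n div 2) / real n * (real n * e n) / 2"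
    by (rule order_tendstoD) simp
  hence "\<forall>\<^sub>F n in sequentially. 1 / 8 < real (n div 2) * e n / 2 \<and> 0 < n"
    using eventually_gt_at_top[of 0] by eventually_elim simp
  from eventually_whp_fst[OF this] ev
  have Q: "likely (\<lambda>n \<omega>. 0 < n \<and> (b n)\<^sup>2 / 8 \<le> centred_ss n (\<lambda>i. \<xi> i \<omega>))"
  proof eventually_elim
    case (elim p)
    hence "1 / 8 \<le> (1 / b (fst p))\<^sup>2 * centred_ss (fst p) (\<lambda>i. \<xi> i (snd p))"
      by linarith
    with elim b[of "fst p"] show ?case
      by (simp add: field_simps)
  qed
  (* index 0 is not among the data, so \<xi> 0 is independent of each of them *)
  have far: "likely (\<lambda>n \<omega>. \<forall>i\<in>{1..n}. \<bar>\<xi> i \<omega> - \<xi> 0 \<omega>\<bar> \<le> \<tau> * b n)"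
    if \<tau>: "0 < \<tau>" for \<tau>
  proof (rule eventually_whpI_compl)
    have eq: "{\<omega> \<in> space M. \<not> (\<forall>i\<in>{1..fst (n, \<omega>)}. \<bar>\<xi> i (snd (n, \<omega>)) - \<xi> 0 (snd (n, \<omega>))\<bar> \<le> \<tau> * b (fst (n, \<omega>)))}
        = (\<Union>i\<in>{1..n}. {\<omega> \<in> space M. \<tau> * b n < \<bar>\<xi> i \<omega> - \<xi> 0 \<omega>\<bar>})" for n
      by (auto simp: not_le)
    show "{\<omega> \<in> space M. \<not> (\<forall>i\<in>{1..fst (n, \<omega>)}. \<bar>\<xi> i (snd (n, \<omega>)) - \<xi> 0 (snd (n, \<omega>))\<bar> \<le> \<tau> * b (fst (n, \<omega>)))} \<in> events" for n
      unfolding eq by measurable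
    have "prob (\<Union>i\<in>{1..n}. {\<omega> \<in> space M. \<tau> * b n < \<bar>\<xi> i \<omega> - \<xi> 0 \<omega>\<bar>})
        \<le> real n * measure diff_law {x. \<tau> * b n < \<bar>x\<bar>}" for n
    proof -
      have "prob (\<Union>i\<in>{1..n}. {\<omega> \<in> space M. \<tau> * b n < \<bar>\<xi> i \<omega> - \<xi> 0 \<omega>\<bar>})
          \<le> (\<Sum>i=1..n. prob {\<omega> \<in> space M. \<tau> * b n < \<bar>\<xi> i \<omega> - \<xi> 0 \<omega>\<bar>})"
        by (rule measure_UNION_le) auto
      also have "\<dots> = (\<Sum>i=1..n. measure diff_law {x. \<tau> * b n < \<bar>x\<bar>})"
        by (intro sum.cong refl prob_diff) auto
      finally show ?thesis
        by simp
    qed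
    thus "(\<lambda>n. prob {\<omega> \<in> space M. \<not> (\<forall>i\<in>{1..fst (n, \<omega>)}. \<bar>\<xi> i (snd (n, \<omega>)) - \<xi> 0 (snd (n, \<omega>))\<bar> \<le> \<tau> * b (fst (n, \<omega>)))})
        \<longlonglongrightarrow> 0"
      unfolding eq
      by (intro tendsto_sandwich[OF _ _ tendsto_const scaled_tail_tendsto_0[OF b 2 \<tau>]]) auto
  qed
  have bound: "likely (\<lambda>n \<omega>. (\<Sum>i=1..n. (\<xi> i \<omega> - smean n (\<lambda>i. \<xi> i \<omega>)) ^ 4)
      / (centred_ss n (\<lambda>i. \<xi> i \<omega>))\<^sup>2 \<le> 32 * \<tau>\<^sup>2)" if \<tau>: "0 < \<tau>" for \<tau>
    using Q far[OF \<tau>]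
  proof eventually_elim
    case (elim p)
    define n where "n = fst p"
    define a where "a = (\<lambda>i. \<xi> i (snd p))"
    define d where "d i = a i - smean n a" for i
    let ?Q = "centred_ss n a"
    have n: "0 < n" and Q: "(b n)\<^sup>2 / 8 \<le> ?Q" and near: "\<And>i. i \<in> {1..n} \<Longrightarrow> \<bar>a i - a 0\<bar> \<le> \<tau> * b n"
      using elim by (auto simp: n_def a_def)
    have b2: "0 < (b n)\<^sup>2"
      using b[of n] by simp
    hence Q0: "0 < ?Q"
      using Q by linarith
    have "smean n a - a 0 = (\<Sum>i=1..n. a i - a 0) / real n"
      using n by (simp add: smean_def sum_subtractf field_simps)
    hence "\<bar>smean n a - a 0\<bar> \<le> (\<Sum>i=1..n. \<bar>a i - a 0\<bar>) / real n"
      by (simp add: abs_divide divide_right_mono)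
    also have "\<dots> \<le> (\<Sum>i=1..n. \<tau> * b n) / real n"
      by (intro divide_right_mono sum_mono near) auto
    also have "\<dots> = \<tau> * b n"
      using n by simp
    finally have m: "\<bar>smean n a - a 0\<bar> \<le> \<tau> * b n" .
    have d: "(d i)\<^sup>2 \<le> 4 * \<tau>\<^sup>2 * (b n)\<^sup>2" if "i \<in> {1..n}" for i
    proof -
      have "\<bar>d i\<bar> \<le> 2 * \<tau> * b n"
        using near[OF that] m unfolding d_def by linarith
      from power_mono[OF this, of 2] show ?thesis
        by (simp add: power_mult_distrib)
    qed
    have "(\<Sum>i=1..n. d i ^ 4) = (\<Sum>i=1..n. (d i)\<^sup>2 * (d i)\<^sup>2)"
      by (simp flip: power_add)
    also have "\<dots> \<le> (\<Sum>i=1..n. 4 * \<tau>\<^sup>2 * (b n)\<^sup>2 * (d i)\<^sup>2)"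
      by (intro sum_mono mult_right_mono d) auto
    also have "\<dots> = 4 * \<tau>\<^sup>2 * (b n)\<^sup>2 * ?Q"
      by (simp add: centred_ss_def d_def sum_distrib_left)
    also have "\<dots> \<le> 4 * \<tau>\<^sup>2 * (8 * ?Q) * ?Q"
      using Q Q0 by (intro mult_right_mono mult_left_mono) auto
    finally have "(\<Sum>i=1..n. d i ^ 4) / ?Q\<^sup>2 \<le> 32 * \<tau>\<^sup>2"
      using Q0 by (subst pos_divide_le_eq) (simp_all add: power2_eq_square[of ?Q] mult_ac)
    thus ?case
      by (simp add: d_def n_def a_def)
  qed
  show ?thesis
  proof (rule order_tendstoI)
    fix r :: real assume "r < 0"
    thus "likely (\<lambda>n \<omega>. r < (\<Sum>i=1..n. (\<xi> i \<omega> - smean n (\<lambda>i. \<xi> i \<omega>)) ^ 4)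
        / (centred_ss n (\<lambda>i. \<xi> i \<omega>))\<^sup>2)"
      by (intro always_eventually allI, elim less_le_trans)
        (intro divide_nonneg_nonneg sum_nonneg; simp)
  next
    fix r :: real assume r: "0 < r"
    define \<tau> where "\<tau> = sqrt (r / 64)"
    have "0 < \<tau>" "32 * \<tau>\<^sup>2 < r"
      using r by (auto simp: \<tau>_def)
    with bound[of \<tau>] show "likely (\<lambda>n \<omega>. (\<Sum>i=1..n. (\<xi> i \<omega> - smean n (\<lambda>i. \<xi> i \<omega>)) ^ 4)
        / (centred_ss n (\<lambda>i. \<xi> i \<omega>))\<^sup>2 < r)"
      by (auto elim!: eventually_mono)
  qed
qed

end

section \<open>Conditioning on an independent variable; averages of the errors\<close>

context prob_space
begin

lemma indep_rv_distr:
  assumes ind: "indep_rv N X L Y"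
  shows "distr M (N \<Otimes>\<^sub>M L) (\<lambda>\<omega>. (X \<omega>, Y \<omega>)) = distr M N X \<Otimes>\<^sub>M distr M L Y"
proof -
  have [measurable]: "X \<in> M \<rightarrow>\<^sub>M N" "Y \<in> M \<rightarrow>\<^sub>M L"
    using ind by (auto simp: indep_rv_def)
  interpret X: prob_space "distr M N X"
    by (rule prob_space_distr) simp
  interpret Y: prob_space "distr M L Y"
    by (rule prob_space_distr) simp
  show ?thesis
  proof (rule pair_measure_eqI[symmetric])
    fix A B assume A: "A \<in> sets (distr M N X)" and B: "B \<in> sets (distr M L Y)"
    hence [measurable]: "A \<in> sets N" "B \<in> sets L"
      by auto
    have "prob ((X -` A \<inter> space M) \<inter> (Y -` B \<inter> space M))
        = prob (X -` A \<inter> space M) * prob (Y -` B \<inter> space M)"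
      using ind A B unfolding indep_rv_def by (intro indep_setD[of "{X -` A \<inter> space M | A. A \<in> sets N}"
            "{Y -` B \<inter> space M | B. B \<in> sets L}"]) auto
    moreover have "(\<lambda>\<omega>. (X \<omega>, Y \<omega>)) -` (A \<times> B) \<inter> space M = (X -` A \<inter> space M) \<inter> (Y -` B \<inter> space M)"
      by auto
    ultimately show "emeasure (distr M N X) A * emeasure (distr M L Y) B
        = emeasure (distr M (N \<Otimes>\<^sub>M L) (\<lambda>\<omega>. (X \<omega>, Y \<omega>))) (A \<times> B)"
      by (simp add: emeasure_distr emeasure_eq_measure ennreal_mult)
  qed (auto intro!: X.sigma_finite_measure_axioms Y.sigma_finite_measure_axioms sets_pair_measure_cong)
qed

text \<open>
  Decoupling: on one and the same space, \<open>Y\<close> may be evaluated at a second point \<open>\<omega>'\<close>. With \<open>\<omega>'\<close> fixed,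
  the inner integral is the conditional expectation given \<open>Y\<close>, as an ordinary integral with a
  parameter.
\<close>
lemma indep_rv_integral:
  fixes f :: "'b \<times> 'c \<Rightarrow> 'd::{banach, second_countable_topology}"
  assumes ind: "indep_rv N X L Y" and f[measurable]: "f \<in> borel_measurable (N \<Otimes>\<^sub>M L)"
    and bnd: "\<And>p. norm (f p) \<le> K"
  shows "(\<lambda>\<omega>'. expectation (\<lambda>\<omega>. f (X \<omega>, Y \<omega>'))) \<in> borel_measurable M"
    and "expectation (\<lambda>\<omega>. f (X \<omega>, Y \<omega>)) = expectation (\<lambda>\<omega>'. expectation (\<lambda>\<omega>. f (X \<omega>, Y \<omega>')))"
proof -
  have [measurable]: "X \<in> M \<rightarrow>\<^sub>M N" "Y \<in> M \<rightarrow>\<^sub>M L"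
    using ind by (auto simp: indep_rv_def)
  interpret X: prob_space "distr M N X"
    by (rule prob_space_distr) simp
  interpret Y: prob_space "distr M L Y"
    by (rule prob_space_distr) simp
  interpret XY: pair_prob_space "distr M N X" "distr M L Y"
    by unfold_locales
  have int: "integrable (distr M N X \<Otimes>\<^sub>M distr M L Y) (\<lambda>(x, y). f (x, y))"
    by (rule XY.P.integrable_const_bound[where B=K]) (use bnd in auto)
  have inner: "(LINT x|distr M N X. f (x, y)) = expectation (\<lambda>\<omega>. f (X \<omega>, y))" if "y \<in> space L" for y
    by (rule integral_distr) (use that in measurable)
  have "(\<lambda>y. LINT x|distr M N X. f (x, y)) \<in> borel_measurable L"
    by (rule X.borel_measurable_lebesgue_integral) (auto intro!: measurable_compose[OF measurable_pair_swap' f] simp: split_beta)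
  from measurable_compose[OF \<open>Y \<in> M \<rightarrow>\<^sub>M L\<close> this]
  have m: "(\<lambda>\<omega>'. LINT x|distr M N X. f (x, Y \<omega>')) \<in> borel_measurable M" .
  thus "(\<lambda>\<omega>'. expectation (\<lambda>\<omega>. f (X \<omega>, Y \<omega>'))) \<in> borel_measurable M"
    by (rule measurable_cong[THEN iffD1, rotated]) (auto intro!: inner measurable_space[OF \<open>Y \<in> M \<rightarrow>\<^sub>M L\<close>])
  have "expectation (\<lambda>\<omega>. f (X \<omega>, Y \<omega>)) = (LINT p|(distr M N X \<Otimes>\<^sub>M distr M L Y). f p)"
    unfolding indep_rv_distr[OF ind, symmetric] by (rule integral_distr[symmetric]) auto
  also have "\<dots> = (LINT y|distr M L Y. LINT x|distr M N X. f (x, y))"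
    using XY.integral_snd[OF int] by simp
  also have "\<dots> = expectation (\<lambda>\<omega>'. LINT x|distr M N X. f (x, Y \<omega>'))"
    by (rule integral_distr) (auto intro!: X.borel_measurable_lebesgue_integral measurable_compose[OF measurable_pair_swap' f] simp: split_beta)
  also have "\<dots> = expectation (\<lambda>\<omega>'. expectation (\<lambda>\<omega>. f (X \<omega>, Y \<omega>')))"
    by (intro Bochner_Integration.integral_cong refl inner measurable_space[OF \<open>Y \<in> M \<rightarrow>\<^sub>M L\<close>])
  finally show "expectation (\<lambda>\<omega>. f (X \<omega>, Y \<omega>)) = expectation (\<lambda>\<omega>'. expectation (\<lambda>\<omega>. f (X \<omega>, Y \<omega>')))" .
qed

text \<open>
  If the conditional means of nonnegative variables tend to \<open>0\<close> in probability, then so do the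
  variables: truncate at \<open>1\<close> and apply bounded convergence to the conditional means.
\<close>
lemma tendsto_whp_conditional:
  fixes T :: "nat \<Rightarrow> 'b \<times> 'c \<Rightarrow> real"
  assumes ind: "indep_rv N X L Y" and T[measurable]: "\<And>n. T n \<in> borel_measurable (N \<Otimes>\<^sub>M L)"
    and nonneg: "\<And>n p. 0 \<le> T n p"
    and int: "\<And>n \<omega>'. \<omega>' \<in> space M \<Longrightarrow> integrable M (\<lambda>\<omega>. T n (X \<omega>, Y \<omega>'))"
    and lim: "conv_prob (\<lambda>n \<omega>'. expectation (\<lambda>\<omega>. T n (X \<omega>, Y \<omega>'))) 0"
  shows "conv_prob (\<lambda>n \<omega>. T n (X \<omega>, Y \<omega>)) 0"
proof -
  have [measurable]: "X \<in> M \<rightarrow>\<^sub>M N" "Y \<in> M \<rightarrow>\<^sub>M L"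
    using ind by (auto simp: indep_rv_def)
  define G where "G n p = min 1 (T n p)" for n p
  have Gm[measurable]: "G n \<in> borel_measurable (N \<Otimes>\<^sub>M L)" for n
    unfolding G_def by measurable
  have Gb: "0 \<le> G n p" "G n p \<le> 1" "G n p \<le> T n p" for n p
    using nonneg[of n p] by (auto simp: G_def)
  hence Gn: "norm (G n p) \<le> 1" for n p
    by simp
  define h where "h n \<omega>' = expectation (\<lambda>\<omega>. G n (X \<omega>, Y \<omega>'))" for n \<omega>'
  have Gi: "integrable M (\<lambda>\<omega>. G n (X \<omega>, Y \<omega>'))" if "\<omega>' \<in> space M" for n \<omega>'
    by (rule Bochner_Integration.integrable_bound[OF int[OF that, of n]])
      (use Gb nonneg measurable_space[OF \<open>Y \<in> M \<rightarrow>\<^sub>M L\<close> that] in auto)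
  have h0: "0 \<le> h n \<omega>'" for n \<omega>'
    unfolding h_def by (rule Bochner_Integration.integral_nonneg) (rule Gb)
  have h1: "h n \<omega>' \<le> 1" if "\<omega>' \<in> space M" for n \<omega>'
    unfolding h_def by (rule integral_le_const[OF Gi[OF that]]) (use Gb in auto)
  have "conv_prob (\<lambda>n \<omega>. h n \<omega>) 0"
  proof (rule tendsto_sandwich[OF _ _ tendsto_const lim])
    show "likely (\<lambda>n \<omega>'. h n \<omega>' \<le> expectation (\<lambda>\<omega>. T n (X \<omega>, Y \<omega>')))"
      using eventually_whp_space
      by eventually_elim (unfold h_def, intro integral_mono Gi int Gb)
  qed (simp add: h0)
  hence "(\<lambda>n. expectation (h n)) \<longlonglongrightarrow> 0"
    by (intro whp_bounded_convergence_0[where K=1])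
      (use h0 h1 indep_rv_integral(1)[OF ind Gm Gn] in \<open>auto simp: h_def[abs_def]\<close>)
  moreover have "expectation (h n) = expectation (\<lambda>\<omega>. min 1 (T n (X \<omega>, Y \<omega>)))" for n
    using indep_rv_integral(2)[OF ind Gm Gn, of n] unfolding h_def G_def by simp
  ultimately show ?thesis
    by (intro tendsto_whp_min_expectation[where Z="\<lambda>n \<omega>. T n (X \<omega>, Y \<omega>)"]) (use nonneg in auto)
qed

lemma conv_std_normal_conditional:
  fixes W :: "nat \<Rightarrow> 'b \<times> 'c \<Rightarrow> real"
  assumes ind: "indep_rv N X L Y" and W[measurable]: "\<And>n. W n \<in> borel_measurable (N \<Otimes>\<^sub>M L)"
    and lim: "\<And>t. conv_prob (\<lambda>n \<omega>'. expectation (\<lambda>\<omega>. iexp (t * W n (X \<omega>, Y \<omega>')))) (complex_of_real (exp (- t\<^sup>2 / 2)))"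
  shows "conv_std_normal (\<lambda>n \<omega>. W n (X \<omega>, Y \<omega>))"
proof -
  have [measurable]: "X \<in> M \<rightarrow>\<^sub>M N" "Y \<in> M \<rightarrow>\<^sub>M L"
    using ind by (auto simp: indep_rv_def)
  have m: "(\<lambda>p. iexp (t * W n p)) \<in> borel_measurable (N \<Otimes>\<^sub>M L)" for t n
    by measurable
  have b: "norm (iexp (t * W n p)) \<le> 1" for t n p
    by simp
  have "(\<lambda>n. expectation (\<lambda>\<omega>. iexp (t * W n (X \<omega>, Y \<omega>)))) \<longlonglongrightarrow> complex_of_real (exp (- t\<^sup>2 / 2))" for t
    unfolding indep_rv_integral(2)[OF ind m b]
  proof (rule whp_bounded_convergence[OF indep_rv_integral(1)[OF ind m b] _ lim])
    fix n \<omega>' assume "\<omega>' \<in> space M"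
    show "norm (expectation (\<lambda>\<omega>. iexp (t * W n (X \<omega>, Y \<omega>')))) \<le> 1"
    proof -
      have "norm (expectation (\<lambda>\<omega>. iexp (t * W n (X \<omega>, Y \<omega>')))) \<le> expectation (\<lambda>\<omega>. norm (iexp (t * W n (X \<omega>, Y \<omega>'))))"
        by (rule integral_norm_bound)
      thus ?thesis
        by (simp add: prob_space)
    qed
  qed
  thus ?thesis
    by (subst conv_std_normal_iff_char) auto
qed

end

lemma square_add_le: "(a + b)\<^sup>2 \<le> 2 * a\<^sup>2 + 2 * (b::real)\<^sup>2"
  using zero_le_power2[of "a - b"] by (simp add: power2_sum power2_diff)

lemma fourth_add_le: "(a + b) ^ 4 \<le> 8 * a ^ 4 + 8 * (b::real) ^ 4"
proof -
  have "((a + b)\<^sup>2)\<^sup>2 \<le> (2 * a\<^sup>2 + 2 * b\<^sup>2)\<^sup>2"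
    by (intro power_mono square_add_le) simp
  also have "\<dots> \<le> 2 * (2 * a\<^sup>2)\<^sup>2 + 2 * (2 * b\<^sup>2)\<^sup>2"
    by (rule square_add_le)
  finally show ?thesis
    by (simp add: power_mult_distrib flip: power_mult)
qed

lemma abs_mult_le_squares: "\<bar>a * b\<bar> \<le> a\<^sup>2 + (b::real)\<^sup>2"
  using sum_squares_bound[of "\<bar>a\<bar>" "\<bar>b\<bar>"] zero_le_power2[of a] zero_le_power2[of b]
  unfolding abs_mult power2_abs by linarith

lemma L2_set_diff_le: "\<bar>L2_set f A - L2_set h A\<bar> \<le> L2_set (\<lambda>i. f i - h i) A"
proof -
  have "L2_set f A \<le> L2_set (\<lambda>i. f i - h i) A + L2_set h A"
    using L2_set_triangle_ineq[of "\<lambda>i. f i - h i" h A] by simp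
  moreover have "L2_set h A \<le> L2_set (\<lambda>i. h i - f i) A + L2_set f A"
    using L2_set_triangle_ineq[of "\<lambda>i. h i - f i" f A] by simp
  moreover have "L2_set (\<lambda>i. h i - f i) A = L2_set (\<lambda>i. f i - h i) A"
    unfolding L2_set_def by (simp add: power2_commute)
  ultimately show ?thesis
    by linarith
qed

lemma four_square_le: "(a + b + d + e)\<^sup>2 \<le> 4 * (a\<^sup>2 + b\<^sup>2 + d\<^sup>2 + (e::real)\<^sup>2)"
  using square_add_le[of "a + b" "d + e"] square_add_le[of a b] square_add_le[of d e]
  by (simp add: add.assoc)

text \<open>
  Every error that occurs (\<open>\<delta>\<close>, \<open>\<epsilon>\<close>, \<open>\<delta> - \<beta>\<epsilon>\<close>) is a fixed linear form in the error vector; working with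
  general linear forms treats \<open>j = 1\<close> and \<open>j = 2\<close> at once.
\<close>
definition lin :: "real \<Rightarrow> real \<Rightarrow> real \<times> real \<Rightarrow> real" where
  "lin k l e = k * fst e + l * snd e"

lemma lin_measurable [measurable]: "lin k l \<in> borel_measurable (borel \<Otimes>\<^sub>M borel)"
  unfolding lin_def by measurable

text \<open>The errors and the explanatory variables, before a linear relation is imposed.\<close>
locale eiv = dan_sequence +
  fixes err :: "nat \<Rightarrow> 'a \<Rightarrow> real \<times> real"
  assumes iid_err: "iid (borel \<Otimes>\<^sub>M borel) err"
    and moment4: "integrable M (\<lambda>\<omega>. fst (err 0 \<omega>) ^ 4)" "integrable M (\<lambda>\<omega>. snd (err 0 \<omega>) ^ 4)"
    and mean0: "expectation (\<lambda>\<omega>. fst (err 0 \<omega>)) = 0" "expectation (\<lambda>\<omega>. snd (err 0 \<omega>)) = 0"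
    and indep_err_\<xi>: "indep_rv (\<Pi>\<^sub>M i\<in>UNIV. borel \<Otimes>\<^sub>M borel) (\<lambda>\<omega> i. err i \<omega>)
        (\<Pi>\<^sub>M i\<in>UNIV. borel) (\<lambda>\<omega> i. \<xi> i \<omega>)"
begin

lemma indep_err: "indep_vars (\<lambda>_. borel \<Otimes>\<^sub>M borel) err UNIV"
  using iid_err by (simp add: iid_def)

lemma rv_err [measurable]: "err i \<in> M \<rightarrow>\<^sub>M borel \<Otimes>\<^sub>M borel"
  using indep_err by (auto simp: indep_vars_def)

lemma distr_err: "distr M (borel \<Otimes>\<^sub>M borel) (err i) = distr M (borel \<Otimes>\<^sub>M borel) (err 0)"
  using iid_err unfolding iid_def by blast

lemma indep_err_fun:
  assumes "\<And>i. i \<in> I \<Longrightarrow> f i \<in> borel_measurable (borel \<Otimes>\<^sub>M borel)"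
  shows "indep_vars (\<lambda>_. borel) (\<lambda>i \<omega>. f i (err i \<omega>) :: real) I"
  by (rule indep_vars_compose2[OF indep_vars_subset[OF indep_err]]) (use assms in auto)

lemma expectation_err:
  fixes f :: "real \<times> real \<Rightarrow> real"
  assumes [measurable]: "f \<in> borel_measurable (borel \<Otimes>\<^sub>M borel)"
  shows "expectation (\<lambda>\<omega>. f (err i \<omega>)) = expectation (\<lambda>\<omega>. f (err 0 \<omega>))"
proof -
  have "expectation (\<lambda>\<omega>. f (err i \<omega>)) = (LINT x|distr M (borel \<Otimes>\<^sub>M borel) (err i). f x)" for i
    by (rule integral_distr[symmetric]) auto
  thus ?thesis
    by (metis distr_err)
qed

lemma integrable_err:
  fixes f :: "real \<times> real \<Rightarrow> real"
  assumes [measurable]: "f \<in> borel_measurable (borel \<Otimes>\<^sub>M borel)"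
    and "integrable M (\<lambda>\<omega>. f (err 0 \<omega>))"
  shows "integrable M (\<lambda>\<omega>. f (err i \<omega>))"
proof -
  have "integrable M (\<lambda>\<omega>. f (err i \<omega>)) \<longleftrightarrow> integrable (distr M (borel \<Otimes>\<^sub>M borel) (err i)) f" for i
    by (rule integrable_distr_eq[symmetric]) auto
  thus ?thesis
    using assms(2) by (metis distr_err)
qed

lemma integrable_lin4: "integrable M (\<lambda>\<omega>. lin k l (err i \<omega>) ^ 4)"
proof (rule integrable_err[of "\<lambda>e. lin k l e ^ 4"])
  have "integrable M (\<lambda>\<omega>. 8 * (k ^ 4 * fst (err 0 \<omega>) ^ 4 + l ^ 4 * snd (err 0 \<omega>) ^ 4))"
    using moment4 by (intro integrable_mult_right Bochner_Integration.integrable_add)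
  thus "integrable M (\<lambda>\<omega>. lin k l (err 0 \<omega>) ^ 4)"
  proof (rule Bochner_Integration.integrable_bound)
    show "AE \<omega> in M. norm (lin k l (err 0 \<omega>) ^ 4) \<le> norm (8 * (k ^ 4 * fst (err 0 \<omega>) ^ 4 + l ^ 4 * snd (err 0 \<omega>) ^ 4))"
      using fourth_add_le[of "k * fst (err 0 _)" "l * snd (err 0 _)"]
      by (auto simp: lin_def power_mult_distrib)
  qed measurable
qed measurable

lemma integrable_lin_mult_square:
  "integrable M (\<lambda>\<omega>. (lin k l (err i \<omega>) * lin k' l' (err i \<omega>))\<^sup>2)"
proof (rule Bochner_Integration.integrable_bound)
  show "integrable M (\<lambda>\<omega>. lin k l (err i \<omega>) ^ 4 + lin k' l' (err i \<omega>) ^ 4)"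
    by (intro Bochner_Integration.integrable_add integrable_lin4)
  have "(x * y)\<^sup>2 \<le> x ^ 4 + y ^ 4" for x y :: real
    using abs_mult_le_squares[of "x\<^sup>2" "y\<^sup>2"] by (simp add: power_mult_distrib flip: power_mult)
  thus "AE \<omega> in M. norm ((lin k l (err i \<omega>) * lin k' l' (err i \<omega>))\<^sup>2)
      \<le> norm (lin k l (err i \<omega>) ^ 4 + lin k' l' (err i \<omega>) ^ 4)"
    by simp
qed measurable

lemma integrable_lin_mult: "integrable M (\<lambda>\<omega>. lin k l (err i \<omega>) * lin k' l' (err i \<omega>))"
  by (rule square_integrable_imp_integrable[OF _ integrable_lin_mult_square]) measurable

lemma integrable_lin_square: "integrable M (\<lambda>\<omega>. (lin k l (err i \<omega>))\<^sup>2)"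
  using integrable_lin_mult[of k l i k l] by (simp add: power2_eq_square)

lemma integrable_lin: "integrable M (\<lambda>\<omega>. lin k l (err i \<omega>))"
  by (rule square_integrable_imp_integrable[OF _ integrable_lin_square]) measurable

lemma integrable_lin_cube: "integrable M (\<lambda>\<omega>. \<bar>lin k l (err i \<omega>)\<bar> ^ 3)"
proof (rule Bochner_Integration.integrable_bound)
  show "integrable M (\<lambda>\<omega>. (lin k l (err i \<omega>))\<^sup>2 + lin k l (err i \<omega>) ^ 4)"
    by (intro Bochner_Integration.integrable_add integrable_lin4 integrable_lin_square)
  have "\<bar>x\<bar> ^ 3 \<le> x\<^sup>2 + x ^ 4" for x :: real
  proof (cases "\<bar>x\<bar> \<le> 1")
    case True
    hence "\<bar>x\<bar> ^ 3 \<le> \<bar>x\<bar> ^ 2"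
      by (intro power_decreasing) auto
    thus ?thesis
      by (simp add: add_increasing2)
  next
    case False
    hence "\<bar>x\<bar> ^ 3 \<le> \<bar>x\<bar> ^ 4"
      by (intro power_increasing) auto
    thus ?thesis
      by (simp add: add_increasing)
  qed
  thus "AE \<omega> in M. norm (\<bar>lin k l (err i \<omega>)\<bar> ^ 3) \<le> norm ((lin k l (err i \<omega>))\<^sup>2 + lin k l (err i \<omega>) ^ 4)"
    by simp
qed measurable

lemma expectation_lin: "expectation (\<lambda>\<omega>. lin k l (err i \<omega>)) = 0"
proof -
  have "integrable M (\<lambda>\<omega>. fst (err 0 \<omega>))" "integrable M (\<lambda>\<omega>. snd (err 0 \<omega>))"
    using integrable_lin[of 1 0 0] integrable_lin[of 0 1 0] by (simp_all add: lin_def)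
  hence "expectation (\<lambda>\<omega>. lin k l (err 0 \<omega>)) = 0"
    using mean0 by (simp add: lin_def)
  thus ?thesis
    using expectation_err[of "lin k l" i] by simp
qed

definition lin_cov :: "real \<Rightarrow> real \<Rightarrow> real \<Rightarrow> real \<Rightarrow> real" where
  "lin_cov k l k' l' = expectation (\<lambda>\<omega>. lin k l (err 0 \<omega>) * lin k' l' (err 0 \<omega>))"

lemma expectation_lin_mult: "expectation (\<lambda>\<omega>. lin k l (err i \<omega>) * lin k' l' (err i \<omega>)) = lin_cov k l k' l'"
  unfolding lin_cov_def by (rule expectation_err) measurable

lemma lin_cov_self: "expectation (\<lambda>\<omega>. (lin k l (err i \<omega>))\<^sup>2) = lin_cov k l k l"
  using expectation_lin_mult[of k l i k l] by (simp add: power2_eq_square)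

text \<open>
  The factor \<open>\<surd>n\<close> is what the product of two error means, multiplied by \<open>n\<close>, leaves over after division
  by a norming factor of order at least \<open>\<surd>n\<close>.
\<close>
lemma scaled_mean_square_tendsto_0:
  "conv_prob (\<lambda>n \<omega>. sqrt (real n) * (smean n (\<lambda>i. lin k l (err i \<omega>)))\<^sup>2) 0"
proof (rule tendsto_whp_expectation)
  have *: "integrable M (\<lambda>\<omega>. (\<Sum>i=1..n. lin k l (err i \<omega>))\<^sup>2) \<and>
    expectation (\<lambda>\<omega>. (\<Sum>i=1..n. lin k l (err i \<omega>))\<^sup>2) = (\<Sum>i=1..n. expectation (\<lambda>\<omega>. (lin k l (err i \<omega>))\<^sup>2))" for n
    by (rule expectation_sum_square) (auto intro!: indep_err_fun integrable_lin_square simp: expectation_lin)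
  show "integrable M (\<lambda>\<omega>. sqrt (real n) * (smean n (\<lambda>i. lin k l (err i \<omega>)))\<^sup>2)" for n
    unfolding smean_def power_divide using * by (intro integrable_mult_right integrable_divide) auto
  have eq: "expectation (\<lambda>\<omega>. sqrt (real n) * (smean n (\<lambda>i. lin k l (err i \<omega>)))\<^sup>2)
      = lin_cov k l k l * inverse (sqrt n)" for n :: nat
  proof -
    have "expectation (\<lambda>\<omega>. sqrt (real n) * (smean n (\<lambda>i. lin k l (err i \<omega>)))\<^sup>2)
        = sqrt (real n) * ((\<Sum>i=1..n. lin_cov k l k l) / (real n)\<^sup>2)"
      unfolding smean_def power_divide using conjunct2[OF *[of n]] by (simp add: lin_cov_self)
    also have "\<dots> = lin_cov k l k l * (sqrt n / real n)"
      by (cases "n = 0") (simp_all add: power2_eq_square)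
    also have "sqrt n / real n = inverse (sqrt n)"
      by (cases "n = 0") (simp_all add: field_simps)
    finally show ?thesis .
  qed
  have "(\<lambda>n. lin_cov k l k l * inverse (sqrt (real n))) \<longlonglongrightarrow> lin_cov k l k l * 0"
    by (intro tendsto_intros tendsto_inverse_0_at_top filterlim_compose[OF sqrt_at_top filterlim_real_sequentially])
  thus "(\<lambda>n. expectation (\<lambda>\<omega>. sqrt (real n) * (smean n (\<lambda>i. lin k l (err i \<omega>)))\<^sup>2)) \<longlonglongrightarrow> 0"
    unfolding eq by simp
qed auto

lemma mean_product_tendsto:
  "conv_prob (\<lambda>n \<omega>. smean n (\<lambda>i. lin k l (err i \<omega>) * lin k' l' (err i \<omega>))) (lin_cov k l k' l')"
proof -
  define m where "m = lin_cov k l k' l'"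
  define v where "v = expectation (\<lambda>\<omega>. (lin k l (err 0 \<omega>) * lin k' l' (err 0 \<omega>))\<^sup>2)"
  let ?Y = "\<lambda>i \<omega>. lin k l (err i \<omega>) * lin k' l' (err i \<omega>)"
  have ind: "indep_vars (\<lambda>_. borel) ?Y {1..n}" for n
    by (rule indep_err_fun) measurable
  have v: "expectation (\<lambda>\<omega>. (?Y i \<omega>)\<^sup>2) = v" for i
    unfolding v_def by (rule expectation_err) measurable
  note var = variance_sum_indep[OF finite_atLeastAtMost ind integrable_lin_mult_square, unfolded expectation_lin_mult v, folded m_def]
  have "conv_prob (\<lambda>n \<omega>. ((\<Sum>i=1..n. ?Y i \<omega> - m) / real n)\<^sup>2) 0"
  proof (rule tendsto_whp_expectation[where Z="\<lambda>n \<omega>. ((\<Sum>i=1..n. ?Y i \<omega> - m) / real n)\<^sup>2"])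
    show "integrable M (\<lambda>\<omega>. ((\<Sum>i=1..n. ?Y i \<omega> - m) / real n)\<^sup>2)" for n
      unfolding power_divide by (intro integrable_divide var)
    have le: "expectation (\<lambda>\<omega>. ((\<Sum>i=1..n. ?Y i \<omega> - m) / real n)\<^sup>2) \<le> v * inverse (real n)" for n
    proof -
      have "expectation (\<lambda>\<omega>. ((\<Sum>i=1..n. ?Y i \<omega> - m) / real n)\<^sup>2) = expectation (\<lambda>\<omega>. (\<Sum>i=1..n. ?Y i \<omega> - m)\<^sup>2) / (real n)\<^sup>2"
        unfolding power_divide by simp
      also have "\<dots> \<le> (\<Sum>i=1..n. v) / (real n)\<^sup>2"
        by (intro divide_right_mono var(2)) auto
      also have "\<dots> = v * inverse (real n)"
        by (cases "n = 0") (simp_all add: power2_eq_square field_simps)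
      finally show ?thesis .
    qed
    have "(\<lambda>n. v * inverse (real n)) \<longlonglongrightarrow> v * 0"
      by (intro tendsto_intros lim_inverse_n)
    hence lim: "(\<lambda>n. v * inverse (real n)) \<longlonglongrightarrow> 0"
      by simp
    show "(\<lambda>n. expectation (\<lambda>\<omega>. ((\<Sum>i=1..n. ?Y i \<omega> - m) / real n)\<^sup>2)) \<longlonglongrightarrow> 0"
      by (rule tendsto_sandwich[OF always_eventually always_eventually tendsto_const lim])
        (intro allI Bochner_Integration.integral_nonneg zero_le_power2 le)+
  qed simp
  from tendsto_real_sqrt[OF this]
  have "conv_prob (\<lambda>n \<omega>. (\<Sum>i=1..n. ?Y i \<omega> - m) / real n) 0"
    unfolding real_sqrt_abs real_sqrt_zero by (rule tendsto_rabs_zero_cancel)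
  moreover have "likely (\<lambda>n \<omega>. (\<Sum>i=1..n. ?Y i \<omega> - m) / real n = smean n (\<lambda>i. ?Y i \<omega>) - m)"
    using eventually_whp_fst[OF eventually_gt_at_top[of 0]]
    by eventually_elim (simp add: smean_def sum_subtractf field_simps)
  ultimately have "conv_prob (\<lambda>n \<omega>. smean n (\<lambda>i. ?Y i \<omega>) - m) 0"
    by (rule Lim_transform_eventually)
  thus ?thesis
    unfolding m_def by (simp add: LIM_zero_iff)
qed

lemma sum_fourth_tendsto_0:
  "conv_prob (\<lambda>n \<omega>. (\<Sum>i=1..n. lin k l (err i \<omega>) ^ 4) / (real n)\<^sup>2) 0"
proof (rule tendsto_whp_expectation[where Z="\<lambda>n \<omega>. (\<Sum>i=1..n. lin k l (err i \<omega>) ^ 4) / (real n)\<^sup>2"])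
  define v where "v = expectation (\<lambda>\<omega>. lin k l (err 0 \<omega>) ^ 4)"
  have v: "expectation (\<lambda>\<omega>. lin k l (err i \<omega>) ^ 4) = v" for i
    unfolding v_def by (rule expectation_err) measurable
  have eq: "expectation (\<lambda>\<omega>. (\<Sum>i=1..n. lin k l (err i \<omega>) ^ 4) / (real n)\<^sup>2) = v * inverse (real n)" for n
    by (cases "n = 0") (simp_all add: integrable_lin4 v power2_eq_square field_simps)
  have "(\<lambda>n. v * inverse (real n)) \<longlonglongrightarrow> v * 0"
    by (intro tendsto_intros lim_inverse_n)
  thus "(\<lambda>n. expectation (\<lambda>\<omega>. (\<Sum>i=1..n. lin k l (err i \<omega>) ^ 4) / (real n)\<^sup>2)) \<longlonglongrightarrow> 0"
    unfolding eq by simp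
qed (auto intro!: integrable_divide Bochner_Integration.integrable_sum integrable_lin4 divide_nonneg_nonneg sum_nonneg)

end

section \<open>The central limit theorem for the score, given the explanatory variables\<close>

lemma sum_square_shift:
  assumes "0 < n"
  shows "(\<Sum>i=1..n. (a i - m)\<^sup>2) = centred_ss n a + real n * (smean n a - m)\<^sup>2"
proof -
  have "(\<Sum>i=1..n. (a i - m)\<^sup>2)
      = (\<Sum>i=1..n. (a i - smean n a)\<^sup>2 + (2 * (smean n a - m) * (a i - smean n a) + (smean n a - m)\<^sup>2))"
    by (intro sum.cong refl) (simp add: power2_eq_square algebra_simps)
  also have "\<dots> = centred_ss n a + (2 * (smean n a - m) * (\<Sum>i=1..n. a i - smean n a) + real n * (smean n a - m)\<^sup>2)"
    by (simp add: sum.distrib centred_ss_def sum_distrib_left)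
  also have "(\<Sum>i=1..n. a i - smean n a) = 0"
    using assms by (simp add: sum_subtractf smean_def)
  finally show ?thesis
    by simp
qed

lemma centred_ss_le_shift: "0 < n \<Longrightarrow> centred_ss n a \<le> (\<Sum>i=1..n. (a i - m)\<^sup>2)"
  unfolding sum_square_shift by simp

text \<open>
  In the model, \<open>z\<^sub>i = g \<xi>\<^sub>i + \<nu>\<^sub>i\<close> up to a constant, with \<open>\<nu> = lin k l\<close>: for \<open>j = 1\<close> one has
  \<open>(g, k, l) = (\<beta>, 1, 0)\<close>, and for \<open>j = 2\<close> one has \<open>(g, k, l) = (1, 0, 1)\<close>.
\<close>
locale eiv_score = eiv +
  fixes g k l \<beta> c :: real
  assumes g: "g \<noteq> 0" and c: "c = 0 \<or> c = 1" and nondeg: "0 < lin_cov 1 (- \<beta>) 1 (- \<beta>)"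
begin

abbreviation Xi :: "'a \<Rightarrow> nat \<Rightarrow> real" where "Xi \<omega> \<equiv> (\<lambda>i. \<xi> i \<omega>)"
abbreviation Er :: "'a \<Rightarrow> nat \<Rightarrow> real \<times> real" where "Er \<omega> \<equiv> (\<lambda>i. err i \<omega>)"
abbreviation Xsp :: "(nat \<Rightarrow> real) measure" where "Xsp \<equiv> (\<Pi>\<^sub>M i\<in>UNIV. borel)"
abbreviation Esp :: "(nat \<Rightarrow> real \<times> real) measure" where "Esp \<equiv> (\<Pi>\<^sub>M i\<in>UNIV. borel \<Otimes>\<^sub>M borel)"

definition cen :: "nat \<Rightarrow> (nat \<Rightarrow> real) \<Rightarrow> nat \<Rightarrow> real" where
  "cen n x i = x i - c * smean n x"

definition ss :: "nat \<Rightarrow> (nat \<Rightarrow> real) \<Rightarrow> real" where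
  "ss n x = (\<Sum>i=1..n. (cen n x i)\<^sup>2)"

abbreviation eta :: "real \<times> real \<Rightarrow> real" where "eta \<equiv> lin 1 (- \<beta>)"
abbreviation nu :: "real \<times> real \<Rightarrow> real" where "nu \<equiv> lin k l"
abbreviation kappa :: real where "kappa \<equiv> lin_cov k l 1 (- \<beta>)"
abbreviation eta_var :: real where "eta_var \<equiv> lin_cov 1 (- \<beta>) 1 (- \<beta>)"

definition zeta :: "real \<times> real \<Rightarrow> real" where
  "zeta e = nu e * eta e - kappa"

definition eta_zeta_cov :: real where "eta_zeta_cov = expectation (\<lambda>\<omega>. eta (err 0 \<omega>) * zeta (err 0 \<omega>))"
definition zeta_var :: real where "zeta_var = expectation (\<lambda>\<omega>. (zeta (err 0 \<omega>))\<^sup>2)"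

text \<open>
  The part of \<open>u\<^sub>i\<close> that, for given \<open>x\<close>, depends on the \<open>i\<close>-th error only; \<open>V\<close> below is the variance of its
  sum for given \<open>x\<close>.
\<close>
definition score :: "nat \<Rightarrow> (nat \<Rightarrow> real \<times> real) \<Rightarrow> (nat \<Rightarrow> real) \<Rightarrow> nat \<Rightarrow> real" where
  "score n e x i = g * cen n x i * eta (e i) + zeta (e i)"

definition V :: "nat \<Rightarrow> (nat \<Rightarrow> real) \<Rightarrow> real" where
  "V n x = (\<Sum>i=1..n. eta_var * (g * cen n x i)\<^sup>2 + 2 * eta_zeta_cov * (g * cen n x i) + zeta_var)"

lemma zeta_measurable [measurable]: "zeta \<in> borel_measurable (borel \<Otimes>\<^sub>M borel)"
  unfolding zeta_def by measurable

lemma fst_component [measurable]: "(\<lambda>p. fst p i) \<in> Esp \<Otimes>\<^sub>M Xsp \<rightarrow>\<^sub>M borel \<Otimes>\<^sub>M borel"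
  by (rule measurable_compose[OF measurable_fst measurable_component_singleton]) simp

lemma snd_component [measurable]: "(\<lambda>p. snd p i) \<in> Esp \<Otimes>\<^sub>M Xsp \<rightarrow>\<^sub>M borel"
  by (rule measurable_compose[OF measurable_snd measurable_component_singleton]) simp

lemma cen_measurable [measurable]: "(\<lambda>p. cen n (snd p) i) \<in> borel_measurable (Esp \<Otimes>\<^sub>M Xsp)"
  unfolding cen_def smean_def by measurable

lemma ss_measurable [measurable]: "(\<lambda>p. ss n (snd p)) \<in> borel_measurable (Esp \<Otimes>\<^sub>M Xsp)"
  unfolding ss_def by measurable

lemma score_measurable [measurable]: "(\<lambda>p. score n (fst p) (snd p) i) \<in> borel_measurable (Esp \<Otimes>\<^sub>M Xsp)"
  unfolding score_def by measurable

lemma V_measurable [measurable]: "(\<lambda>p. V n (snd p)) \<in> borel_measurable (Esp \<Otimes>\<^sub>M Xsp)"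
  unfolding V_def by measurable

lemma integrable_zeta_square: "integrable M (\<lambda>\<omega>. (zeta (err i \<omega>))\<^sup>2)"
proof -
  have "(zeta e)\<^sup>2 = (nu e * eta e)\<^sup>2 - 2 * kappa * (nu e * eta e) + kappa\<^sup>2" for e
    by (simp add: zeta_def power2_diff)
  thus ?thesis
    using integrable_lin_mult_square integrable_lin_mult by simp
qed

lemma integrable_zeta: "integrable M (\<lambda>\<omega>. zeta (err i \<omega>))"
  by (rule square_integrable_imp_integrable[OF _ integrable_zeta_square]) measurable

lemma expectation_zeta: "expectation (\<lambda>\<omega>. zeta (err i \<omega>)) = 0"
  unfolding zeta_def using integrable_lin_mult by (simp add: expectation_lin_mult prob_space)

lemma integrable_eta_zeta: "integrable M (\<lambda>\<omega>. eta (err i \<omega>) * zeta (err i \<omega>))"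
proof (rule Bochner_Integration.integrable_bound)
  show "integrable M (\<lambda>\<omega>. (eta (err i \<omega>))\<^sup>2 + (zeta (err i \<omega>))\<^sup>2)"
    by (intro Bochner_Integration.integrable_add integrable_lin_square integrable_zeta_square)
  thus "AE \<omega> in M. norm (eta (err i \<omega>) * zeta (err i \<omega>)) \<le> norm ((eta (err i \<omega>))\<^sup>2 + (zeta (err i \<omega>))\<^sup>2)"
    using abs_mult_le_squares by simp
qed measurable

lemma expectation_eta_zeta: "expectation (\<lambda>\<omega>. eta (err i \<omega>) * zeta (err i \<omega>)) = eta_zeta_cov"
  unfolding eta_zeta_cov_def by (rule expectation_err) measurable

lemma expectation_zeta_square: "expectation (\<lambda>\<omega>. (zeta (err i \<omega>))\<^sup>2) = zeta_var"
  unfolding zeta_var_def by (rule expectation_err) measurable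

lemma score_moments:
  shows "integrable M (\<lambda>\<omega>. (score n (Er \<omega>) x i)\<^sup>2)"
    and "expectation (\<lambda>\<omega>. score n (Er \<omega>) x i) = 0"
    and "expectation (\<lambda>\<omega>. (score n (Er \<omega>) x i)\<^sup>2)
      = eta_var * (g * cen n x i)\<^sup>2 + 2 * eta_zeta_cov * (g * cen n x i) + zeta_var"
proof -
  let ?a = "g * cen n x i"
  have eq: "(score n (Er \<omega>) x i)\<^sup>2 = ?a\<^sup>2 * (eta (err i \<omega>))\<^sup>2
      + (2 * ?a * (eta (err i \<omega>) * zeta (err i \<omega>)) + (zeta (err i \<omega>))\<^sup>2)" for \<omega>
    unfolding score_def by (simp only: power2_sum power_mult_distrib)
      (simp add: algebra_simps)?
  have 1: "integrable M (\<lambda>\<omega>. ?a\<^sup>2 * (eta (err i \<omega>))\<^sup>2)"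
    by (intro integrable_mult_right integrable_lin_square)
  have 2: "integrable M (\<lambda>\<omega>. 2 * ?a * (eta (err i \<omega>) * zeta (err i \<omega>)))"
    by (intro integrable_mult_right integrable_eta_zeta)
  note 3 = integrable_zeta_square[of i]
  show "integrable M (\<lambda>\<omega>. (score n (Er \<omega>) x i)\<^sup>2)"
    unfolding eq by (intro Bochner_Integration.integrable_add 1 2 3)
  show "expectation (\<lambda>\<omega>. (score n (Er \<omega>) x i)\<^sup>2) = eta_var * ?a\<^sup>2 + 2 * eta_zeta_cov * ?a + zeta_var"
    unfolding eq Bochner_Integration.integral_add[OF 1 Bochner_Integration.integrable_add[OF 2 3]]
      Bochner_Integration.integral_add[OF 2 3] integral_mult_right_zero lin_cov_self
      expectation_eta_zeta expectation_zeta_square by simp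
  show "expectation (\<lambda>\<omega>. score n (Er \<omega>) x i) = 0"
    unfolding score_def using integrable_lin integrable_zeta
    by (simp add: expectation_lin expectation_zeta)
qed

text \<open>
  Completing the square. The remaining constant \<open>Var \<zeta> - cov(\<eta>, \<zeta>)\<^sup>2 / Var \<eta>\<close> is nonnegative by
  Cauchy--Schwarz, but it may be \<open>0\<close>; this is why nondegeneracy of \<open>\<xi>\<close> is needed to keep \<open>V\<close> away from
  \<open>0\<close>.
\<close>
lemma V_ge_square: "eta_var * (\<Sum>i=1..n. (g * cen n x i + eta_zeta_cov / eta_var)\<^sup>2) \<le> V n x"
proof -
  let ?h = "eta_zeta_cov / eta_var"
  have "0 \<le> expectation (\<lambda>\<omega>. (zeta (err 0 \<omega>) - ?h * eta (err 0 \<omega>))\<^sup>2)"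
    by (rule Bochner_Integration.integral_nonneg) simp
  also have "\<dots> = expectation (\<lambda>\<omega>. (zeta (err 0 \<omega>))\<^sup>2
      + (- (2 * ?h) * (eta (err 0 \<omega>) * zeta (err 0 \<omega>)) + ?h\<^sup>2 * (eta (err 0 \<omega>))\<^sup>2))"
    by (intro Bochner_Integration.integral_cong refl) (simp add: power2_eq_square algebra_simps)
  also have "\<dots> = zeta_var + (- (2 * ?h) * eta_zeta_cov + ?h\<^sup>2 * eta_var)"
  proof -
    have 2: "integrable M (\<lambda>\<omega>. - (2 * ?h) * (eta (err 0 \<omega>) * zeta (err 0 \<omega>)))"
      by (intro integrable_mult_right integrable_eta_zeta)
    have 3: "integrable M (\<lambda>\<omega>. ?h\<^sup>2 * (eta (err 0 \<omega>))\<^sup>2)"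
      by (intro integrable_mult_right integrable_lin_square)
    show ?thesis
      unfolding Bochner_Integration.integral_add[OF integrable_zeta_square Bochner_Integration.integrable_add[OF 2 3]]
        Bochner_Integration.integral_add[OF 2 3] integral_mult_right_zero lin_cov_self
        expectation_eta_zeta expectation_zeta_square ..
  qed
  also have "\<dots> = zeta_var - eta_var * ?h\<^sup>2"
    using nondeg by (simp add: power2_eq_square field_simps)
  finally have z: "eta_var * ?h\<^sup>2 \<le> zeta_var"
    by simp
  have "eta_var * (a + ?h)\<^sup>2 \<le> eta_var * a\<^sup>2 + 2 * eta_zeta_cov * a + zeta_var" for a
  proof -
    have "eta_var * (a + ?h)\<^sup>2 = eta_var * a\<^sup>2 + 2 * eta_zeta_cov * a + eta_var * ?h\<^sup>2"
      using nondeg by (simp add: power2_sum field_simps power2_eq_square)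
    with z show ?thesis
      by simp
  qed
  thus ?thesis
    unfolding V_def sum_distrib_left by (rule sum_mono)
qed

text \<open>Whatever constant the square is centred at, the sample mean gives the smallest sum of squares.\<close>
lemma V_ge_centred_ss:
  assumes "0 < n"
  shows "eta_var * g\<^sup>2 * centred_ss n x \<le> V n x"
proof -
  let ?m = "c * smean n x - eta_zeta_cov / eta_var / g"
  have "g\<^sup>2 * centred_ss n x \<le> g\<^sup>2 * (\<Sum>i=1..n. (x i - ?m)\<^sup>2)"
    by (intro mult_left_mono centred_ss_le_shift[OF assms]) simp
  also have "\<dots> = (\<Sum>i=1..n. (g * cen n x i + eta_zeta_cov / eta_var)\<^sup>2)"
    unfolding sum_distrib_left
  proof (rule sum.cong[OF refl])
    fix i
    have "g * cen n x i + eta_zeta_cov / eta_var = g * (x i - ?m)"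
      using g by (simp add: cen_def field_simps)
    thus "g\<^sup>2 * (x i - ?m)\<^sup>2 = (g * cen n x i + eta_zeta_cov / eta_var)\<^sup>2"
      by (simp only: power_mult_distrib)
  qed
  finally have "eta_var * (g\<^sup>2 * centred_ss n x) \<le> eta_var * (\<Sum>i=1..n. (g * cen n x i + eta_zeta_cov / eta_var)\<^sup>2)"
    using nondeg by (intro mult_left_mono) auto
  with V_ge_square[of n x] show ?thesis
    by simp
qed

lemma ss_le_V:
  assumes n: "0 < n"
  shows "ss n x \<le> 2 / (g\<^sup>2 * eta_var) * V n x + 2 * (eta_zeta_cov / eta_var / g)\<^sup>2 * real n"
proof -
  let ?h = "eta_zeta_cov / eta_var"
  have "ss n x \<le> (\<Sum>i=1..n. 2 / g\<^sup>2 * (g * cen n x i + ?h)\<^sup>2 + 2 * (?h / g)\<^sup>2)"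
    unfolding ss_def
  proof (rule sum_mono)
    fix i
    have "cen n x i = (g * cen n x i + ?h) / g + - (?h / g)"
      using g by (simp add: field_simps)
    hence "(cen n x i)\<^sup>2 \<le> 2 * ((g * cen n x i + ?h) / g)\<^sup>2 + 2 * (- (?h / g))\<^sup>2"
      using square_add_le by metis
    thus "(cen n x i)\<^sup>2 \<le> 2 / g\<^sup>2 * (g * cen n x i + ?h)\<^sup>2 + 2 * (?h / g)\<^sup>2"
      by (simp only: power_divide power2_minus times_divide_eq_left times_divide_eq_right)
  qed
  also have "\<dots> = 2 / g\<^sup>2 * (\<Sum>i=1..n. (g * cen n x i + ?h)\<^sup>2) + 2 * (?h / g)\<^sup>2 * real n"
    by (simp add: sum.distrib sum_distrib_left)
  also have "2 / g\<^sup>2 * (\<Sum>i=1..n. (g * cen n x i + ?h)\<^sup>2) \<le> 2 / g\<^sup>2 * (V n x / eta_var)"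
    using V_ge_square[of n x] nondeg by (intro mult_left_mono) (auto simp: pos_le_divide_eq mult.commute)
  finally show ?thesis
    by simp
qed

lemma centred_ss_le_ss: "0 < n \<Longrightarrow> centred_ss n x \<le> ss n x"
  unfolding ss_def cen_def by (rule centred_ss_le_shift)

text \<open>
  The comparisons of sizes that make error terms negligible; for a
  suitable \<open>C\<close> they hold with probability tending to one.
\<close>
definition balanced :: "real \<Rightarrow> nat \<Rightarrow> (nat \<Rightarrow> real) \<Rightarrow> bool" where
  "balanced C n x \<longleftrightarrow> 0 < n \<and> 0 < V n x \<and> 0 < ss n x
     \<and> real n \<le> C * V n x \<and> real n \<le> C * ss n x \<and> ss n x \<le> C * V n x"

lemma balanced_ratios:
  assumes "likely (\<lambda>n \<omega>. balanced C n (Xi \<omega>))"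
  shows "likely (\<lambda>n \<omega>. 0 < n \<and> 0 < V n (Xi \<omega>) \<and> 0 < ss n (Xi \<omega>)
     \<and> real n / V n (Xi \<omega>) \<le> C \<and> real n / ss n (Xi \<omega>) \<le> C
     \<and> ss n (Xi \<omega>) / V n (Xi \<omega>) \<le> C)"
  using assms by eventually_elim (auto simp: balanced_def pos_divide_le_eq)

lemma eventually_balanced:
  obtains C where "0 < C"
    "likely (\<lambda>n \<omega>. balanced C n (Xi \<omega>))"
proof -
  obtain c0 where c0: "0 < c0" and ev: "likely (\<lambda>n \<omega>. c0 * real n \<le> centred_ss n (Xi \<omega>))"
    by (rule centred_ss_ge_linear)
  (* C1 compares n with V, and C2 then compares ss with V through ss_le_V *)
  define C1 where "C1 = 1 / (eta_var * g\<^sup>2 * c0)"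
  define C2 where "C2 = 2 / (g\<^sup>2 * eta_var) + 2 * (eta_zeta_cov / eta_var / g)\<^sup>2 * C1"
  have pos: "0 < eta_var * g\<^sup>2" "0 < C1" "0 < C2"
    using nondeg g c0 by (auto simp: C1_def C2_def intro!: add_pos_nonneg)
  have "likely (\<lambda>n \<omega>. 0 < n \<and> 0 < V n (Xi \<omega>) \<and> 0 < ss n (Xi \<omega>)
      \<and> real n \<le> C1 * V n (Xi \<omega>) \<and> real n \<le> 1 / c0 * ss n (Xi \<omega>)
      \<and> ss n (Xi \<omega>) \<le> C2 * V n (Xi \<omega>))"
    using ev eventually_whp_fst[OF eventually_gt_at_top[of 0]]
  proof eventually_elim
    case (elim p)
    define n where "n = fst p"
    define x where "x = Xi (snd p)"
    have n: "0 < n" and Q: "c0 * real n \<le> centred_ss n x"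
      using elim by (auto simp: n_def x_def)
    have "0 < c0 * real n"
      using n c0 by simp
    hence Qpos: "0 < centred_ss n x"
      using Q by linarith
    have A: "centred_ss n x \<le> ss n x"
      by (rule centred_ss_le_ss[OF n])
    have VQ: "eta_var * g\<^sup>2 * centred_ss n x \<le> V n x"
      by (rule V_ge_centred_ss[OF n])
    have Vpos: "0 < V n x"
      using mult_pos_pos[OF pos(1) Qpos] VQ by linarith
    have "eta_var * g\<^sup>2 * (c0 * real n) \<le> V n x"
      using mult_left_mono[OF Q, of "eta_var * g\<^sup>2"] pos VQ by linarith
    hence nV: "real n \<le> C1 * V n x"
      using pos c0 by (simp add: C1_def pos_le_divide_eq mult_ac)
    have nA: "real n \<le> 1 / c0 * ss n x"
      using Q A c0 by (simp add: pos_le_divide_eq mult_ac)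
    have "ss n x \<le> 2 / (g\<^sup>2 * eta_var) * V n x + 2 * (eta_zeta_cov / eta_var / g)\<^sup>2 * (C1 * V n x)"
      using ss_le_V[OF n, of x] mult_left_mono[OF nV, of "2 * (eta_zeta_cov / eta_var / g)\<^sup>2"] by simp
    also have "\<dots> = C2 * V n x"
      unfolding C2_def by (simp only: distrib_right mult.assoc)
    finally show ?case
      using n Vpos nV nA Qpos A unfolding n_def x_def by simp
  qed
  hence "likely (\<lambda>n \<omega>. 0 < n \<and> 0 < V n (Xi \<omega>) \<and> 0 < ss n (Xi \<omega>)
      \<and> real n \<le> max C1 (max C2 (1 / c0)) * V n (Xi \<omega>)
      \<and> real n \<le> max C1 (max C2 (1 / c0)) * ss n (Xi \<omega>)
      \<and> ss n (Xi \<omega>) \<le> max C1 (max C2 (1 / c0)) * V n (Xi \<omega>))"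
  proof eventually_elim
    case (elim p)
    let ?D = "max C1 (max C2 (1 / c0))"
    have "C1 * V (fst p) (Xi (snd p)) \<le> ?D * V (fst p) (Xi (snd p))"
      "C2 * V (fst p) (Xi (snd p)) \<le> ?D * V (fst p) (Xi (snd p))"
      "1 / c0 * ss (fst p) (Xi (snd p)) \<le> ?D * ss (fst p) (Xi (snd p))"
      using elim by (intro mult_right_mono; simp)+
    with elim show ?case
      by linarith
  qed
  thus thesis
    using pos(2) by (intro that[of "max C1 (max C2 (1 / c0))"]) (auto simp: balanced_def)
qed

text \<open>
  For \<open>c = 1\<close> this is the statement for the centred variables. For \<open>c = 0\<close> the sample mean has to be added
  back; it contributes equally to all \<open>n\<close> terms, hence at most a constant times \<open>1/n\<close> to the ratio.
\<close>
lemma cen_fourth_ratio: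
  "conv_prob (\<lambda>n \<omega>. (\<Sum>i=1..n. cen n (Xi \<omega>) i ^ 4) / (ss n (Xi \<omega>))\<^sup>2) 0"
proof -
  define R where "R p = (\<Sum>i=1..fst p. (\<xi> i (snd p) - smean (fst p) (Xi (snd p))) ^ 4)
      / (centred_ss (fst p) (Xi (snd p)))\<^sup>2" for p
  have R: "(R \<longlongrightarrow> 0) whp"
    using fourth_power_ratio unfolding R_def .
  obtain c0 where c0: "0 < c0" and ev: "likely (\<lambda>n \<omega>. c0 * real n \<le> centred_ss n (Xi \<omega>))"
    by (rule centred_ss_ge_linear)
  have "((\<lambda>p. 8 * R p + 8 * inverse (real (fst p))) \<longlongrightarrow> 8 * 0 + 8 * 0) whp"
    by (intro tendsto_intros R tendsto_whp_const[OF lim_inverse_n])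
  hence up: "((\<lambda>p. 8 * R p + 8 * inverse (real (fst p))) \<longlongrightarrow> 0) whp"
    by simp
  show ?thesis
  proof (rule tendsto_sandwich[OF _ _ tendsto_const up])
    show "likely (\<lambda>n \<omega>. 0 \<le> (\<Sum>i=1..n. cen n (Xi \<omega>) i ^ 4) / (ss n (Xi \<omega>))\<^sup>2)"
      by (intro always_eventually allI divide_nonneg_nonneg sum_nonneg) auto
    show "\<forall>\<^sub>F p in whp. (\<Sum>i=1..fst p. cen (fst p) (Xi (snd p)) i ^ 4) / (ss (fst p) (Xi (snd p)))\<^sup>2
        \<le> 8 * R p + 8 * inverse (real (fst p))"
      using ev eventually_whp_fst[OF eventually_gt_at_top[of 0]]
    proof eventually_elim
      case (elim p)
      define n where "n = fst p"
      define x where "x = Xi (snd p)"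
      let ?Q = "centred_ss n x" and ?A = "ss n x"
      let ?S = "\<Sum>i=1..n. (x i - smean n x) ^ 4"
      have n: "0 < n" and Q: "c0 * real n \<le> ?Q"
        using elim by (auto simp: n_def x_def)
      have "0 < c0 * real n"
        using n c0 by simp
      hence Qpos: "0 < ?Q"
        using Q by linarith
      have QA: "?Q \<le> ?A"
        by (rule centred_ss_le_ss[OF n])
      have Rp: "R p = ?S / ?Q\<^sup>2"
        by (simp add: R_def n_def x_def)
      have S0: "0 \<le> ?S"
        by (intro sum_nonneg) auto
      have RA: "?S / ?A\<^sup>2 \<le> R p"
        unfolding Rp using Qpos QA S0 by (intro divide_left_mono power_mono mult_pos_pos) auto
      have d: "(1 - c) * smean n x = 0 \<or> c = 0"
        using c by auto
      have nb: "real n * ((1 - c) * smean n x)\<^sup>2 \<le> ?A"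
      proof -
        have "?A = ?Q + real n * (smean n x - c * smean n x)\<^sup>2"
          unfolding ss_def cen_def by (rule sum_square_shift[OF n])
        thus ?thesis
          using Qpos by (simp add: algebra_simps)
      qed
      have "real n * ((1 - c) * smean n x) ^ 4 = (real n * ((1 - c) * smean n x)\<^sup>2)\<^sup>2 / real n"
        using n by (simp add: power_mult_distrib power2_eq_square power4_eq_xxxx)
      also have "\<dots> \<le> ?A\<^sup>2 / real n"
        by (intro divide_right_mono power_mono nb) auto
      finally have nb4: "real n * ((1 - c) * smean n x) ^ 4 \<le> ?A\<^sup>2 / real n" .
      have "(\<Sum>i=1..n. cen n x i ^ 4) \<le> (\<Sum>i=1..n. 8 * (x i - smean n x) ^ 4 + 8 * ((1 - c) * smean n x) ^ 4)"
      proof (rule sum_mono)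
        fix i
        have "cen n x i = (x i - smean n x) + (1 - c) * smean n x"
          by (simp add: cen_def algebra_simps)
        thus "cen n x i ^ 4 \<le> 8 * (x i - smean n x) ^ 4 + 8 * ((1 - c) * smean n x) ^ 4"
          using fourth_add_le by metis
      qed
      also have "\<dots> = 8 * ?S + 8 * (real n * ((1 - c) * smean n x) ^ 4)"
        by (simp add: sum.distrib sum_distrib_left)
      also have "\<dots> \<le> 8 * ?S + 8 * (?A\<^sup>2 / real n)"
        using nb4 by simp
      finally have "(\<Sum>i=1..n. cen n x i ^ 4) / ?A\<^sup>2 \<le> (8 * ?S + 8 * (?A\<^sup>2 / real n)) / ?A\<^sup>2"
        by (rule divide_right_mono) simp
      also have "\<dots> = 8 * (?S / ?A\<^sup>2) + 8 * inverse (real n)"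
        using Qpos QA by (simp add: add_divide_distrib inverse_eq_divide)
      also have "\<dots> \<le> 8 * R p + 8 * inverse (real n)"
        using RA by simp
      finally show ?case
        by (simp add: n_def x_def)
    qed
  qed
qed

text \<open>
  The contribution of \<open>\<zeta>\<close> to the Lindeberg sum. As \<open>\<zeta>\<close> is a product of two errors, four moments of
  the errors give it two. Dominated convergence takes the place of the third moment of \<open>\<eta>\<close>.
\<close>
definition zeta_tail :: "real \<Rightarrow> real" where
  "zeta_tail y = expectation (\<lambda>\<omega>. (zeta (err 0 \<omega>))\<^sup>2 * min 1 (\<bar>zeta (err 0 \<omega>)\<bar> * y))"

lemma integrable_zeta_tail:
  assumes "0 \<le> y"
  shows "integrable M (\<lambda>\<omega>. (zeta (err i \<omega>))\<^sup>2 * min 1 (\<bar>zeta (err i \<omega>)\<bar> * y))"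
proof (rule Bochner_Integration.integrable_bound[OF integrable_zeta_square[of i]])
  show "AE \<omega> in M. norm ((zeta (err i \<omega>))\<^sup>2 * min 1 (\<bar>zeta (err i \<omega>)\<bar> * y)) \<le> norm ((zeta (err i \<omega>))\<^sup>2)"
    using assms by (intro always_eventually allI) (auto simp: abs_mult intro!: mult_left_le)
qed measurable

lemma zeta_tail_tendsto_0:
  assumes "y \<longlonglongrightarrow> 0" and nonneg: "\<And>n. 0 \<le> y n"
  shows "(\<lambda>n. zeta_tail (y n)) \<longlonglongrightarrow> 0"
proof -
  have "(\<lambda>n. zeta_tail (y n)) \<longlonglongrightarrow> expectation (\<lambda>\<omega>. 0)"
    unfolding zeta_tail_def
  proof (rule integral_dominated_convergence[where w="\<lambda>\<omega>. (zeta (err 0 \<omega>))\<^sup>2"])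
    show "AE \<omega> in M. (\<lambda>n. (zeta (err 0 \<omega>))\<^sup>2 * min 1 (\<bar>zeta (err 0 \<omega>)\<bar> * y n)) \<longlonglongrightarrow> 0"
    proof (intro always_eventually allI)
      fix \<omega>
      have "(\<lambda>n. (zeta (err 0 \<omega>))\<^sup>2 * min 1 (\<bar>zeta (err 0 \<omega>)\<bar> * y n))
          \<longlonglongrightarrow> (zeta (err 0 \<omega>))\<^sup>2 * min 1 (\<bar>zeta (err 0 \<omega>)\<bar> * 0)"
        by (intro tendsto_intros assms(1))
      thus "(\<lambda>n. (zeta (err 0 \<omega>))\<^sup>2 * min 1 (\<bar>zeta (err 0 \<omega>)\<bar> * y n)) \<longlonglongrightarrow> 0"
        by simp
    qed
    show "AE \<omega> in M. norm ((zeta (err 0 \<omega>))\<^sup>2 * min 1 (\<bar>zeta (err 0 \<omega>)\<bar> * y n)) \<le> (zeta (err 0 \<omega>))\<^sup>2" for n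
      using nonneg[of n] by (intro always_eventually allI) (auto simp: abs_mult intro!: mult_left_le)
  qed (use integrable_zeta_square in auto)
  thus ?thesis
    by simp
qed

definition lindeberg_ratio :: "nat \<Rightarrow> (nat \<Rightarrow> real) \<Rightarrow> real" where
  "lindeberg_ratio n x = (\<Sum>i=1..n. expectation (\<lambda>\<omega>. lind (score n (Er \<omega>) x i / sqrt (V n x))))"

definition eta_cube :: real where
  "eta_cube = expectation (\<lambda>\<omega>. \<bar>eta (err 0 \<omega>)\<bar> ^ 3)"

lemma expectation_eta_cube: "expectation (\<lambda>\<omega>. \<bar>eta (err i \<omega>)\<bar> ^ 3) = eta_cube"
  unfolding eta_cube_def by (rule expectation_err) measurable

lemma eta_cube_nonneg: "0 \<le> eta_cube"
  unfolding eta_cube_def by (rule Bochner_Integration.integral_nonneg) simp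

lemma lind_score_le:
  assumes V: "0 < V n x" and n: "0 < n" "real n \<le> C * V n x"
  shows "expectation (\<lambda>\<omega>. lind (score n (Er \<omega>) x i / sqrt (V n x)))
    \<le> 8 * (eta_cube * \<bar>g\<bar> ^ 3 * \<bar>cen n x i\<bar> ^ 3 / sqrt (V n x) ^ 3 + zeta_tail (sqrt (C / real n)) / V n x)"
proof -
  define B where "B = sqrt (V n x)"
  define y where "y = sqrt (C / real n)"
  have B: "0 < B" "B\<^sup>2 = V n x"
    using V by (auto simp: B_def)
  have "1 / V n x \<le> C / real n"
    using V n by (simp add: field_simps)
  hence "sqrt (1 / V n x) \<le> y"
    unfolding y_def by (rule real_sqrt_le_mono)
  hence y: "1 / B \<le> y"
    by (simp add: B_def real_sqrt_divide)
  hence y0: "0 \<le> y"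
    using B(1) by (meson order_trans divide_nonneg_pos zero_le_one)
  define F where "F \<omega> = 8 * (\<bar>g\<bar> ^ 3 * \<bar>cen n x i\<bar> ^ 3 / B ^ 3 * \<bar>eta (err i \<omega>)\<bar> ^ 3
      + 1 / V n x * ((zeta (err i \<omega>))\<^sup>2 * min 1 (\<bar>zeta (err i \<omega>)\<bar> * y)))" for \<omega>
  have i1: "integrable M (\<lambda>\<omega>. \<bar>g\<bar> ^ 3 * \<bar>cen n x i\<bar> ^ 3 / B ^ 3 * \<bar>eta (err i \<omega>)\<bar> ^ 3)"
    by (intro integrable_mult_right integrable_lin_cube)
  have i2: "integrable M (\<lambda>\<omega>. 1 / V n x * ((zeta (err i \<omega>))\<^sup>2 * min 1 (\<bar>zeta (err i \<omega>)\<bar> * y)))"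
    by (intro integrable_mult_right integrable_zeta_tail y0)
  have pt: "lind (score n (Er \<omega>) x i / B) \<le> F \<omega>" for \<omega>
  proof -
    let ?p = "g * cen n x i * eta (err i \<omega>) / B" and ?q = "zeta (err i \<omega>) / B"
    have "lind ?p \<le> \<bar>?p\<bar> ^ 3"
      by (rule lind_le_cube)
    also have "\<dots> = \<bar>g\<bar> ^ 3 * \<bar>cen n x i\<bar> ^ 3 / B ^ 3 * \<bar>eta (err i \<omega>)\<bar> ^ 3"
      using B(1) by (simp add: abs_mult power_mult_distrib power_divide)
    finally have p: "lind ?p \<le> \<bar>g\<bar> ^ 3 * \<bar>cen n x i\<bar> ^ 3 / B ^ 3 * \<bar>eta (err i \<omega>)\<bar> ^ 3" .
    have "\<bar>?q\<bar> \<le> \<bar>zeta (err i \<omega>)\<bar> * y"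
      using mult_left_mono[OF y, of "\<bar>zeta (err i \<omega>)\<bar>"] B(1) by (simp add: abs_divide)
    hence "lind ?q \<le> ?q\<^sup>2 * min 1 (\<bar>zeta (err i \<omega>)\<bar> * y)"
      unfolding lind_def by (intro mult_left_mono min.mono) auto
    also have "\<dots> = 1 / V n x * ((zeta (err i \<omega>))\<^sup>2 * min 1 (\<bar>zeta (err i \<omega>)\<bar> * y))"
      by (simp add: power_divide B(2))
    finally have q: "lind ?q \<le> 1 / V n x * ((zeta (err i \<omega>))\<^sup>2 * min 1 (\<bar>zeta (err i \<omega>)\<bar> * y))" .
    have "score n (Er \<omega>) x i / B = ?p + ?q"
      by (simp add: score_def add_divide_distrib)
    with lind_add_le[of ?p ?q] p q show ?thesis
      unfolding F_def by simp
  qed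
  have "expectation (\<lambda>\<omega>. lind (score n (Er \<omega>) x i / B)) \<le> expectation F"
  proof (rule integral_mono'[OF _ pt order_trans[OF lind_nonneg pt]])
    show "integrable M F"
      unfolding F_def by (intro integrable_mult_right Bochner_Integration.integrable_add i1 i2)
  qed
  also have "expectation F = 8 * (\<bar>g\<bar> ^ 3 * \<bar>cen n x i\<bar> ^ 3 / B ^ 3 * eta_cube + 1 / V n x * zeta_tail y)"
  proof -
    have "expectation (\<lambda>\<omega>. (zeta (err i \<omega>))\<^sup>2 * min 1 (\<bar>zeta (err i \<omega>)\<bar> * y)) = zeta_tail y"
      unfolding zeta_tail_def by (rule expectation_err) measurable
    thus ?thesis
      unfolding F_def integral_mult_right_zero Bochner_Integration.integral_add[OF i1 i2]
      by (simp only: expectation_eta_cube)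
  qed
  finally show ?thesis
    by (simp add: B_def y_def mult_ac)
qed

text \<open>Cauchy--Schwarz: the third powers are controlled by the second and fourth ones.\<close>
lemma sum_cube_le:
  assumes V: "0 < V n x" and A: "0 < ss n x" "ss n x \<le> C * V n x"
  shows "(\<Sum>i=1..n. \<bar>cen n x i\<bar> ^ 3) / sqrt (V n x) ^ 3
    \<le> sqrt (C ^ 3 * ((\<Sum>i=1..n. cen n x i ^ 4) / (ss n x)\<^sup>2))"
proof (rule real_le_rsqrt)
  let ?A = "ss n x" and ?S = "\<Sum>i=1..n. cen n x i ^ 4"
  have "(\<Sum>i=1..n. \<bar>cen n x i\<bar> ^ 3) = (\<Sum>i=1..n. \<bar>cen n x i\<bar> * (cen n x i)\<^sup>2)"
    by (intro sum.cong refl) (simp add: power3_eq_cube power2_eq_square flip: abs_mult)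
  hence "(\<Sum>i=1..n. \<bar>cen n x i\<bar> ^ 3)\<^sup>2 \<le> (\<Sum>i=1..n. \<bar>cen n x i\<bar>\<^sup>2) * (\<Sum>i=1..n. ((cen n x i)\<^sup>2)\<^sup>2)"
    using Cauchy_Schwarz_ineq_sum[of "\<lambda>i. \<bar>cen n x i\<bar>" "\<lambda>i. (cen n x i)\<^sup>2" "{1..n}"] by simp
  also have "\<dots> = ?A * ?S"
    by (simp add: ss_def flip: power_mult)
  also have "\<dots> = ?A ^ 3 * (?S / ?A\<^sup>2)"
    using A(1) by (simp add: power2_eq_square power3_eq_cube)
  also have "\<dots> \<le> (C * V n x) ^ 3 * (?S / ?A\<^sup>2)"
    using A by (intro mult_right_mono power_mono divide_nonneg_nonneg sum_nonneg) auto
  finally have "(\<Sum>i=1..n. \<bar>cen n x i\<bar> ^ 3)\<^sup>2 / V n x ^ 3 \<le> (C * V n x) ^ 3 * (?S / ?A\<^sup>2) / V n x ^ 3"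
    using V by (intro divide_right_mono) auto
  also have "\<dots> = C ^ 3 * (?S / ?A\<^sup>2)"
    using V by (simp add: power_mult_distrib)
  also have "V n x ^ 3 = (sqrt (V n x) ^ 3)\<^sup>2"
    using V by (metis less_imp_le mult.commute power_mult real_sqrt_pow2)
  finally show "((\<Sum>i=1..n. \<bar>cen n x i\<bar> ^ 3) / sqrt (V n x) ^ 3)\<^sup>2 \<le> C ^ 3 * (?S / ?A\<^sup>2)"
    by (simp only: power_divide)
qed

lemma lindeberg_ratio_tendsto_0: "conv_prob (\<lambda>n \<omega>. lindeberg_ratio n (Xi \<omega>)) 0"
proof -
  obtain C where C: "0 < C" and ev: "likely (\<lambda>n \<omega>. balanced C n (Xi \<omega>))"
    by (rule eventually_balanced)
  define \<rho> where "\<rho> p = (\<Sum>i=1..fst p. cen (fst p) (Xi (snd p)) i ^ 4) / (ss (fst p) (Xi (snd p)))\<^sup>2" for p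
  define U where "U p = 8 * (eta_cube * \<bar>g\<bar> ^ 3 * sqrt (C ^ 3 * \<rho> p) + C * zeta_tail (sqrt (C / real (fst p))))" for p
  have "(\<lambda>n. sqrt (C * inverse (real n))) \<longlonglongrightarrow> sqrt (C * 0)"
    by (intro tendsto_intros lim_inverse_n)
  hence "(\<lambda>n. zeta_tail (sqrt (C / real n))) \<longlonglongrightarrow> 0"
    using C by (intro zeta_tail_tendsto_0) (auto simp: divide_inverse)
  from tendsto_whp_const[OF this]
  have "(U \<longlongrightarrow> 8 * (eta_cube * \<bar>g\<bar> ^ 3 * sqrt (C ^ 3 * 0) + C * 0)) whp"
    unfolding U_def by (intro tendsto_intros cen_fourth_ratio[folded \<rho>_def])
  hence U: "(U \<longlongrightarrow> 0) whp"
    by simp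
  show ?thesis
  proof (rule tendsto_sandwich[OF _ _ tendsto_const U])
    show "likely (\<lambda>n \<omega>. 0 \<le> lindeberg_ratio n (Xi \<omega>))"
      unfolding lindeberg_ratio_def
      by (intro always_eventually allI sum_nonneg Bochner_Integration.integral_nonneg lind_nonneg)
    show "\<forall>\<^sub>F p in whp. lindeberg_ratio (fst p) (Xi (snd p)) \<le> U p"
      using ev[unfolded balanced_def]
    proof eventually_elim
      case (elim p)
      define n where "n = fst p"
      define x where "x = Xi (snd p)"
      have n: "0 < n" and V: "0 < V n x" and A: "0 < ss n x" "ss n x \<le> C * V n x" and nV: "real n \<le> C * V n x"
        using elim by (auto simp: n_def x_def)
      let ?h = "zeta_tail (sqrt (C / real n))"
      have h0: "0 \<le> ?h"
        unfolding zeta_tail_def by (intro Bochner_Integration.integral_nonneg mult_nonneg_nonneg) (use C in auto)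
      have "lindeberg_ratio n x \<le> (\<Sum>i=1..n. 8 * (eta_cube * \<bar>g\<bar> ^ 3 * \<bar>cen n x i\<bar> ^ 3 / sqrt (V n x) ^ 3 + ?h / V n x))"
        unfolding lindeberg_ratio_def by (intro sum_mono lind_score_le V n nV)
      also have "\<dots> = 8 * (eta_cube * \<bar>g\<bar> ^ 3 * ((\<Sum>i=1..n. \<bar>cen n x i\<bar> ^ 3) / sqrt (V n x) ^ 3) + real n / V n x * ?h)"
        by (simp add: sum.distrib sum_distrib_left sum_divide_distrib)
      also have "\<dots> \<le> 8 * (eta_cube * \<bar>g\<bar> ^ 3 * sqrt (C ^ 3 * \<rho> p) + C * ?h)"
        using sum_cube_le[OF V A] nV V eta_cube_nonneg h0
        by (intro mult_left_mono add_mono mult_right_mono) (auto simp: \<rho>_def n_def x_def pos_divide_le_eq)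
      finally show ?case
        by (simp add: U_def n_def x_def)
    qed
  qed
qed

lemma lindeberg_sum_score:
  assumes V: "0 < V n x"
  shows "lindeberg_sum M (\<lambda>i \<omega>. score n (Er \<omega>) x i / sqrt (V n x)) {1..n} (lindeberg_ratio n x)"
proof
  show "finite {1..n}"
    by simp
  show "indep_vars (\<lambda>_. borel) (\<lambda>i \<omega>. score n (Er \<omega>) x i / sqrt (V n x)) {1..n}"
    unfolding score_def by (rule indep_err_fun) measurable
  show "integrable M (\<lambda>\<omega>. (score n (Er \<omega>) x i / sqrt (V n x))\<^sup>2)" for i
    unfolding power_divide by (intro integrable_divide score_moments)
  show "expectation (\<lambda>\<omega>. score n (Er \<omega>) x i / sqrt (V n x)) = 0" for i
    by (simp add: score_moments(2))
  have "(\<Sum>i=1..n. expectation (\<lambda>\<omega>. (score n (Er \<omega>) x i / sqrt (V n x))\<^sup>2)) = V n x / V n x"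
    unfolding power_divide integral_divide_zero score_moments(3) using V
    by (simp add: V_def flip: sum_divide_distrib)
  thus "(\<Sum>i=1..n. expectation (\<lambda>\<omega>. (score n (Er \<omega>) x i / sqrt (V n x))\<^sup>2)) = 1"
    using V by simp
qed (simp add: lindeberg_ratio_def)

text \<open>
  For given \<open>\<xi>\<close>, the characteristic function of the normalized sum differs from the Gaussian one by a
  function of the Lindeberg ratio, which tends to \<open>0\<close> in probability.
\<close>
lemma score_clt:
  "conv_std_normal (\<lambda>n \<omega>. (\<Sum>i=1..n. score n (Er \<omega>) (Xi \<omega>) i) / sqrt (V n (Xi \<omega>)))"
proof -
  define W where "W n p = (\<Sum>i=1..n. score n (fst p) (snd p) i) / sqrt (V n (snd p))"
    for n and p :: "(nat \<Rightarrow> real \<times> real) \<times> (nat \<Rightarrow> real)"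
  have "conv_std_normal (\<lambda>n \<omega>. W n (Er \<omega>, Xi \<omega>))"
  proof (rule conv_std_normal_conditional[OF indep_err_\<xi>])
    show "W n \<in> borel_measurable (Esp \<Otimes>\<^sub>M Xsp)" for n
      unfolding W_def by measurable
    fix t
    define b where "b z = t\<^sup>2 * max 1 \<bar>t\<bar> * z + t ^ 4 / 8 * (z + sqrt z)" for z :: real
    have "conv_prob (\<lambda>n \<omega>. b (lindeberg_ratio n (Xi \<omega>))) (b 0)"
      unfolding b_def by (intro tendsto_intros lindeberg_ratio_tendsto_0)
    hence b: "conv_prob (\<lambda>n \<omega>. b (lindeberg_ratio n (Xi \<omega>))) 0"
      by (simp add: b_def)
    obtain C where ev: "likely (\<lambda>n \<omega>. balanced C n (Xi \<omega>))"
      by (rule eventually_balanced)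
    have "conv_prob (\<lambda>n \<omega>'. expectation (\<lambda>\<omega>. iexp (t * W n (Er \<omega>, Xi \<omega>'))) - complex_of_real (exp (- t\<^sup>2 / 2))) 0"
    proof (rule Lim_null_comparison[OF _ b])
      show "likely (\<lambda>n \<omega>'. norm (expectation (\<lambda>\<omega>. iexp (t * W n (Er \<omega>, Xi \<omega>'))) - complex_of_real (exp (- t\<^sup>2 / 2)))
          \<le> b (lindeberg_ratio n (Xi \<omega>')))"
        using ev[unfolded balanced_def]
      proof eventually_elim
        case (elim p)
        then interpret L: lindeberg_sum M "\<lambda>i \<omega>. score (fst p) (Er \<omega>) (Xi (snd p)) i / sqrt (V (fst p) (Xi (snd p)))"
          "{1..fst p}" "lindeberg_ratio (fst p) (Xi (snd p))"
          by (intro lindeberg_sum_score) auto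
        show ?case
          using L.char_approx[of t] unfolding W_def b_def fst_conv snd_conv sum_divide_distrib .
      qed
    qed
    thus "conv_prob (\<lambda>n \<omega>'. expectation (\<lambda>\<omega>. iexp (t * W n (Er \<omega>, Xi \<omega>')))) (complex_of_real (exp (- t\<^sup>2 / 2)))"
      by (simp only: LIM_zero_iff)
  qed
  thus ?thesis
    by (simp add: W_def)
qed

lemma score_square_sum:
  "conv_prob (\<lambda>n \<omega>. (\<Sum>i=1..n. (score n (Er \<omega>) (Xi \<omega>) i)\<^sup>2) / V n (Xi \<omega>)) 1"
proof -
  define T where "T n p = (if 0 < V n (snd p) then \<bar>(\<Sum>i=1..n. (score n (fst p) (snd p) i / sqrt (V n (snd p)))\<^sup>2) - 1\<bar> else 0)"
    for n and p :: "(nat \<Rightarrow> real \<times> real) \<times> (nat \<Rightarrow> real)"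
  obtain C where ev: "likely (\<lambda>n \<omega>. balanced C n (Xi \<omega>))"
    by (rule eventually_balanced)
  have T0: "conv_prob (\<lambda>n \<omega>. T n (Er \<omega>, Xi \<omega>)) 0"
  proof (rule tendsto_whp_conditional[OF indep_err_\<xi>])
    show "T n \<in> borel_measurable (Esp \<Otimes>\<^sub>M Xsp)" for n
      unfolding T_def by measurable
    show "0 \<le> T n p" for n p
      by (simp add: T_def)
    show "integrable M (\<lambda>\<omega>. T n (Er \<omega>, Xi \<omega>'))" for n \<omega>'
    proof (cases "0 < V n (Xi \<omega>')")
      case True
      have "integrable M (\<lambda>\<omega>. \<Sum>i=1..n. (score n (Er \<omega>) (Xi \<omega>') i / sqrt (V n (Xi \<omega>')))\<^sup>2)"
        unfolding power_divide by (intro Bochner_Integration.integrable_sum integrable_divide score_moments)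
      thus ?thesis
        unfolding T_def fst_conv snd_conv using True by simp
    qed (simp add: T_def)
    have "conv_prob (\<lambda>n \<omega>. 2 * lindeberg_ratio n (Xi \<omega>) + sqrt (lindeberg_ratio n (Xi \<omega>))) (2 * 0 + sqrt 0)"
      by (intro tendsto_intros lindeberg_ratio_tendsto_0)
    hence b: "conv_prob (\<lambda>n \<omega>. 2 * lindeberg_ratio n (Xi \<omega>) + sqrt (lindeberg_ratio n (Xi \<omega>))) 0"
      by simp
    show "conv_prob (\<lambda>n \<omega>'. expectation (\<lambda>\<omega>. T n (Er \<omega>, Xi \<omega>'))) 0"
    proof (rule tendsto_sandwich[OF _ _ tendsto_const b])
      show "likely (\<lambda>n \<omega>'. 0 \<le> expectation (\<lambda>\<omega>. T n (Er \<omega>, Xi \<omega>')))"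
        by (intro always_eventually allI Bochner_Integration.integral_nonneg) (simp add: T_def)
      show "likely (\<lambda>n \<omega>'. expectation (\<lambda>\<omega>. T n (Er \<omega>, Xi \<omega>'))
          \<le> 2 * lindeberg_ratio n (Xi \<omega>') + sqrt (lindeberg_ratio n (Xi \<omega>')))"
        using ev[unfolded balanced_def]
      proof eventually_elim
        case (elim p)
        then interpret L: lindeberg_sum M "\<lambda>i \<omega>. score (fst p) (Er \<omega>) (Xi (snd p)) i / sqrt (V (fst p) (Xi (snd p)))"
          "{1..fst p}" "lindeberg_ratio (fst p) (Xi (snd p))"
          by (intro lindeberg_sum_score) auto
        show ?case
          using L.sum_square_approx elim unfolding T_def fst_conv snd_conv by simp
      qed
    qed
  qed
  have "conv_prob (\<lambda>n \<omega>. (\<Sum>i=1..n. (score n (Er \<omega>) (Xi \<omega>) i)\<^sup>2) / V n (Xi \<omega>) - 1) 0"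
  proof (rule Lim_null_comparison[OF _ T0])
    show "likely (\<lambda>n \<omega>. norm ((\<Sum>i=1..n. (score n (Er \<omega>) (Xi \<omega>) i)\<^sup>2) / V n (Xi \<omega>) - 1)
        \<le> T n (Er \<omega>, Xi \<omega>))"
      using ev[unfolded balanced_def] by eventually_elim (simp add: T_def power_divide sum_divide_distrib)
  qed
  thus ?thesis
    by (simp only: LIM_zero_iff)
qed

text \<open>Given \<open>\<xi>\<close>, the sum has variance proportional to \<open>ss\<close>, which is negligible against its square.\<close>
lemma cross_sum_tendsto_0:
  "conv_prob (\<lambda>n \<omega>. (\<Sum>i=1..n. cen n (Xi \<omega>) i * lin k' l' (err i \<omega>)) / ss n (Xi \<omega>)) 0"
proof -
  define T where "T n p = ((\<Sum>i=1..n. cen n (snd p) i * lin k' l' (fst p i)) / ss n (snd p))\<^sup>2"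
    for n and p :: "(nat \<Rightarrow> real \<times> real) \<times> (nat \<Rightarrow> real)"
  obtain C where C: "0 < C" and ev: "likely (\<lambda>n \<omega>. balanced C n (Xi \<omega>))"
    by (rule eventually_balanced)
  have *: "integrable M (\<lambda>\<omega>. (\<Sum>i=1..n. cen n x i * lin k' l' (err i \<omega>))\<^sup>2) \<and>
    expectation (\<lambda>\<omega>. (\<Sum>i=1..n. cen n x i * lin k' l' (err i \<omega>))\<^sup>2)
      = (\<Sum>i=1..n. expectation (\<lambda>\<omega>. (cen n x i * lin k' l' (err i \<omega>))\<^sup>2))" for n x
  proof (rule expectation_sum_square)
    show "indep_vars (\<lambda>_. borel) (\<lambda>i \<omega>. cen n x i * lin k' l' (err i \<omega>)) {1..n}"
      by (rule indep_err_fun) measurable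
    show "integrable M (\<lambda>\<omega>. (cen n x i * lin k' l' (err i \<omega>))\<^sup>2)" for i
      unfolding power_mult_distrib by (intro integrable_mult_right integrable_lin_square)
    show "expectation (\<lambda>\<omega>. cen n x i * lin k' l' (err i \<omega>)) = 0" for i
      by (simp add: expectation_lin)
  qed simp
  have T0: "conv_prob (\<lambda>n \<omega>. T n (Er \<omega>, Xi \<omega>)) 0"
  proof (rule tendsto_whp_conditional[OF indep_err_\<xi>])
    show "T n \<in> borel_measurable (Esp \<Otimes>\<^sub>M Xsp)" for n
      unfolding T_def by measurable
    show "0 \<le> T n p" for n p
      by (simp add: T_def)
    show "integrable M (\<lambda>\<omega>. T n (Er \<omega>, Xi \<omega>'))" for n \<omega>'
      unfolding T_def power_divide fst_conv snd_conv using * by (intro integrable_divide) blast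
    have "conv_prob (\<lambda>n \<omega>. C * lin_cov k' l' k' l' * inverse (real n)) (C * lin_cov k' l' k' l' * 0)"
      by (intro tendsto_intros tendsto_whp_const[OF lim_inverse_n])
    hence b: "conv_prob (\<lambda>n \<omega>. C * lin_cov k' l' k' l' * inverse (real n)) 0"
      by simp
    show "conv_prob (\<lambda>n \<omega>'. expectation (\<lambda>\<omega>. T n (Er \<omega>, Xi \<omega>'))) 0"
    proof (rule tendsto_sandwich[OF _ _ tendsto_const b])
      show "likely (\<lambda>n \<omega>'. 0 \<le> expectation (\<lambda>\<omega>. T n (Er \<omega>, Xi \<omega>')))"
        by (intro always_eventually allI Bochner_Integration.integral_nonneg) (simp add: T_def)
      show "likely (\<lambda>n \<omega>'. expectation (\<lambda>\<omega>. T n (Er \<omega>, Xi \<omega>')) \<le> C * lin_cov k' l' k' l' * inverse (real n))"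
        using ev[unfolded balanced_def]
      proof eventually_elim
        case (elim p)
        define n where "n = fst p"
        define x where "x = Xi (snd p)"
        have n: "0 < n" and A: "0 < ss n x" "real n \<le> C * ss n x"
          using elim by (auto simp: n_def x_def)
        have lc: "0 \<le> lin_cov k' l' k' l'"
          unfolding lin_cov_self[of k' l' 0, symmetric] by (rule Bochner_Integration.integral_nonneg) simp
        have "expectation (\<lambda>\<omega>. T n (Er \<omega>, x)) = (\<Sum>i=1..n. (cen n x i)\<^sup>2 * lin_cov k' l' k' l') / (ss n x)\<^sup>2"
          unfolding T_def power_divide fst_conv snd_conv integral_divide_zero conjunct2[OF *]
          by (simp add: power_mult_distrib lin_cov_self)
        also have "\<dots> = lin_cov k' l' k' l' * (1 / ss n x)"
          using A(1) by (simp add: ss_def power2_eq_square flip: sum_distrib_right)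
        also have "\<dots> \<le> lin_cov k' l' k' l' * (C * inverse (real n))"
          using A n by (intro mult_left_mono lc) (simp add: field_simps)
        finally show ?case
          by (simp add: n_def x_def mult_ac)
      qed
    qed
  qed
  from tendsto_real_sqrt[OF this] show ?thesis
    unfolding T_def fst_conv snd_conv real_sqrt_abs real_sqrt_zero by (rule tendsto_rabs_zero_cancel)
qed

end

section \<open>Residuals, self-normalization and the estimating equation\<close>

context eiv_score
begin

definition emean :: "real \<Rightarrow> real \<Rightarrow> nat \<Rightarrow> 'a \<Rightarrow> real" where
  "emean k' l' n \<omega> = smean n (\<lambda>i. lin k' l' (err i \<omega>))"

text \<open>
  The observable \<open>g' \<xi>\<^sub>i + lin k' l' (err i) + const\<close>, minus \<open>c\<close> times its sample mean. Thus
  \<open>obs \<beta> 1 0\<close> is the centred \<open>y\<close>, \<open>obs 1 0 1\<close> is the centred \<open>x\<close>, and \<open>obs 0 1 (- \<beta>)\<close> is the centred \<open>\<eta>\<close>.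
\<close>
definition obs :: "real \<Rightarrow> real \<Rightarrow> real \<Rightarrow> nat \<Rightarrow> 'a \<Rightarrow> nat \<Rightarrow> real" where
  "obs g' k' l' n \<omega> i = g' * cen n (Xi \<omega>) i + lin k' l' (err i \<omega>) - c * emean k' l' n \<omega>"

lemma obs_diff: "obs 0 1 (- \<beta>) n \<omega> i = obs \<beta> 1 0 n \<omega> i - \<beta> * obs 1 0 1 n \<omega> i"
proof -
  have m: "emean 1 (- \<beta>) n \<omega> = emean 1 0 n \<omega> - \<beta> * emean 0 1 n \<omega>"
    by (simp add: emean_def smean_def lin_def sum_subtractf sum_distrib_left diff_divide_distrib)
  show ?thesis
    unfolding obs_def lin_def m by (simp add: algebra_simps)
qed

text \<open>
  A product of two observables minus its error covariance. Summed over \<open>i\<close> and divided by \<open>n\<close>, these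
  are the corrected sample moments such as \<open>S\<^sub>x\<^sub>y - \<mu>\<close>.
\<close>
definition cross :: "real \<times> real \<times> real \<Rightarrow> real \<times> real \<times> real \<Rightarrow> nat \<Rightarrow> 'a \<Rightarrow> nat \<Rightarrow> real" where
  "cross = (\<lambda>(g1, k1, l1) (g2, k2, l2) n \<omega> i. obs g1 k1 l1 n \<omega> i * obs g2 k2 l2 n \<omega> i - lin_cov k1 l1 k2 l2)"

lemma cross_eq: "cross (g1, k1, l1) (g2, k2, l2) n \<omega> i
    = obs g1 k1 l1 n \<omega> i * obs g2 k2 l2 n \<omega> i - lin_cov k1 l1 k2 l2"
  by (simp add: cross_def)

lemma sum_lin: "0 < n \<Longrightarrow> (\<Sum>i=1..n. lin k' l' (err i \<omega>)) = real n * emean k' l' n \<omega>"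
  by (simp add: emean_def smean_def)

lemma c_sum_cen: "0 < n \<Longrightarrow> c * (\<Sum>i=1..n. cen n x i) = 0"
  using c by (auto simp: cen_def sum_subtractf smean_def)

lemma c_square: "c * c = c"
  using c by auto

text \<open>
  All mixed terms with the sample means collapse, because \<open>c\<^sup>2 = c\<close> and because the sum of the \<open>cen\<close> terms is
  \<open>0\<close> unless \<open>c = 0\<close>.
\<close>
lemma sum_cross:
  assumes n: "0 < n"
  shows "(\<Sum>i=1..n. cross (g1, k1, l1) (g2, k2, l2) n \<omega> i)
    = g1 * g2 * ss n (Xi \<omega>)
      + g1 * (\<Sum>i=1..n. cen n (Xi \<omega>) i * lin k2 l2 (err i \<omega>))
      + g2 * (\<Sum>i=1..n. cen n (Xi \<omega>) i * lin k1 l1 (err i \<omega>))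
      + (\<Sum>i=1..n. lin k1 l1 (err i \<omega>) * lin k2 l2 (err i \<omega>) - lin_cov k1 l1 k2 l2)
      - c * (real n * (emean k1 l1 n \<omega> * emean k2 l2 n \<omega>))"
proof -
  let ?a = "cen n (Xi \<omega>)" and ?e1 = "\<lambda>i. lin k1 l1 (err i \<omega>)" and ?e2 = "\<lambda>i. lin k2 l2 (err i \<omega>)"
  let ?m1 = "emean k1 l1 n \<omega>" and ?m2 = "emean k2 l2 n \<omega>"
  have "(\<Sum>i=1..n. cross (g1, k1, l1) (g2, k2, l2) n \<omega> i)
      = (\<Sum>i=1..n. g1 * g2 * (?a i)\<^sup>2 + g1 * (?a i * ?e2 i) + g2 * (?a i * ?e1 i)
          + (?e1 i * ?e2 i - lin_cov k1 l1 k2 l2)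
          - (c * ?a i) * (g1 * ?m2 + g2 * ?m1) - c * ?m2 * ?e1 i - c * ?m1 * ?e2 i + c * c * (?m1 * ?m2))"
    by (intro sum.cong refl) (simp add: cross_eq obs_def power2_eq_square algebra_simps)
  also have "\<dots> = g1 * g2 * ss n (Xi \<omega>) + g1 * (\<Sum>i=1..n. ?a i * ?e2 i) + g2 * (\<Sum>i=1..n. ?a i * ?e1 i)
      + (\<Sum>i=1..n. ?e1 i * ?e2 i - lin_cov k1 l1 k2 l2)
      - (c * (\<Sum>i=1..n. ?a i)) * (g1 * ?m2 + g2 * ?m1)
      - c * ?m2 * (\<Sum>i=1..n. ?e1 i) - c * ?m1 * (\<Sum>i=1..n. ?e2 i) + real n * (c * c * (?m1 * ?m2))"
    by (simp only: sum.distrib sum_subtractf sum_distrib_left sum_distrib_right ss_def sum_constant card_atLeastAtMost)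
      simp
  also have "\<dots> = g1 * g2 * ss n (Xi \<omega>) + g1 * (\<Sum>i=1..n. ?a i * ?e2 i) + g2 * (\<Sum>i=1..n. ?a i * ?e1 i)
      + (\<Sum>i=1..n. ?e1 i * ?e2 i - lin_cov k1 l1 k2 l2) - c * (real n * (?m1 * ?m2))"
    unfolding c_sum_cen[OF n] sum_lin[OF n] c_square by (simp add: algebra_simps)
  finally show ?thesis .
qed

lemma Xi_measurable [measurable]: "(\<lambda>\<omega>. cen n (Xi \<omega>) i) \<in> borel_measurable M"
  unfolding cen_def smean_def by measurable

lemma ss_M_measurable [measurable]: "(\<lambda>\<omega>. ss n (Xi \<omega>)) \<in> borel_measurable M"
  unfolding ss_def by measurable

lemma V_M_measurable [measurable]: "(\<lambda>\<omega>. V n (Xi \<omega>)) \<in> borel_measurable M"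
  unfolding V_def by measurable

lemma score_M_measurable [measurable]: "(\<lambda>\<omega>. score n (Er \<omega>) (Xi \<omega>) i) \<in> borel_measurable M"
  unfolding score_def by measurable

lemma emean_measurable [measurable]: "emean k' l' n \<in> borel_measurable M"
  unfolding emean_def smean_def by measurable

lemma cross_measurable [measurable]: "(\<lambda>\<omega>. cross f1 f2 n \<omega> i) \<in> borel_measurable M"
  unfolding cross_def obs_def by (cases f1; cases f2) simp

lemma emean_tendsto_0: "conv_prob (\<lambda>n \<omega>. sqrt (real n) * (emean k' l' n \<omega>)\<^sup>2) 0"
  using scaled_mean_square_tendsto_0 unfolding emean_def .

lemma emean_square_tendsto_0: "conv_prob (\<lambda>n \<omega>. (emean k' l' n \<omega>)\<^sup>2) 0"
proof (rule tendsto_sandwich[OF _ _ tendsto_const emean_tendsto_0])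
  show "likely (\<lambda>n \<omega>. (emean k' l' n \<omega>)\<^sup>2 \<le> sqrt (real n) * (emean k' l' n \<omega>)\<^sup>2)"
    using eventually_whp_fst[OF eventually_ge_at_top[of 1]]
  proof eventually_elim
    case (elim p)
    have "1 * (emean k' l' (fst p) (snd p))\<^sup>2 \<le> sqrt (real (fst p)) * (emean k' l' (fst p) (snd p))\<^sup>2"
      using elim by (intro mult_right_mono) auto
    thus ?case
      by simp
  qed
qed simp

lemma scaled_emean_product_tendsto_0:
  "conv_prob (\<lambda>n \<omega>. sqrt (real n) * (emean k1 l1 n \<omega> * emean k2 l2 n \<omega>)) 0"
proof (rule Lim_null_comparison)
  have "conv_prob (\<lambda>n \<omega>. sqrt (real n) * (emean k1 l1 n \<omega>)\<^sup>2 + sqrt (real n) * (emean k2 l2 n \<omega>)\<^sup>2) (0 + 0)"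
    by (intro tendsto_add emean_tendsto_0)
  thus "conv_prob (\<lambda>n \<omega>. sqrt (real n) * (emean k1 l1 n \<omega>)\<^sup>2 + sqrt (real n) * (emean k2 l2 n \<omega>)\<^sup>2) 0"
    by simp
  show "likely (\<lambda>n \<omega>. norm (sqrt (real n) * (emean k1 l1 n \<omega> * emean k2 l2 n \<omega>))
      \<le> sqrt (real n) * (emean k1 l1 n \<omega>)\<^sup>2 + sqrt (real n) * (emean k2 l2 n \<omega>)\<^sup>2)"
  proof (intro always_eventually allI)
    fix p :: "nat \<times> 'a"
    show "norm (sqrt (real (fst p)) * (emean k1 l1 (fst p) (snd p) * emean k2 l2 (fst p) (snd p)))
        \<le> sqrt (real (fst p)) * (emean k1 l1 (fst p) (snd p))\<^sup>2 + sqrt (real (fst p)) * (emean k2 l2 (fst p) (snd p))\<^sup>2"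
      using mult_left_mono[OF abs_mult_le_squares[of "emean k1 l1 (fst p) (snd p)" "emean k2 l2 (fst p) (snd p)"],
          of "sqrt (real (fst p))"] by (simp add: abs_mult distrib_left)
  qed
qed

lemma emean_product_tendsto_0:
  "conv_prob (\<lambda>n \<omega>. emean k1 l1 n \<omega> * emean k2 l2 n \<omega>) 0"
proof -
  have "conv_prob (\<lambda>n \<omega>. \<bar>emean k1 l1 n \<omega>\<bar> * \<bar>emean k2 l2 n \<omega>\<bar>) (sqrt 0 * sqrt 0)"
    unfolding real_sqrt_abs[symmetric]
    by (intro tendsto_mult tendsto_real_sqrt emean_square_tendsto_0)
  thus ?thesis
    by - (rule tendsto_rabs_zero_cancel, simp add: abs_mult)
qed

lemma eventually_V_pos: "likely (\<lambda>n \<omega>. 0 < V n (Xi \<omega>))"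
proof -
  obtain C where "likely (\<lambda>n \<omega>. balanced C n (Xi \<omega>))"
    by (rule eventually_balanced)
  thus ?thesis
    by eventually_elim (simp add: balanced_def)
qed

lemma eventually_ss_pos: "likely (\<lambda>n \<omega>. 0 < ss n (Xi \<omega>))"
proof -
  obtain C where "likely (\<lambda>n \<omega>. balanced C n (Xi \<omega>))"
    by (rule eventually_balanced)
  thus ?thesis
    by eventually_elim (simp add: balanced_def)
qed

lemma bounded_mult_null:
  fixes f h :: "nat \<times> 'a \<Rightarrow> real"
  assumes "\<forall>\<^sub>F p in whp. \<bar>f p\<bar> \<le> C" and h: "(h \<longlongrightarrow> 0) whp"
  shows "((\<lambda>p. f p * h p) \<longlongrightarrow> 0) whp"
proof (rule Lim_null_comparison)
  have "((\<lambda>p. C * \<bar>h p\<bar>) \<longlongrightarrow> C * \<bar>0\<bar>) whp"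
    by (intro tendsto_intros h)
  thus "((\<lambda>p. C * \<bar>h p\<bar>) \<longlongrightarrow> 0) whp"
    by simp
  show "\<forall>\<^sub>F p in whp. norm (f p * h p) \<le> C * \<bar>h p\<bar>"
    using assms(1) by eventually_elim (simp add: abs_mult mult_right_mono)
qed

text \<open>
  In a corrected sample moment the part \<open>g1 g2 \<Sum> a\<^sub>i\<^sup>2\<close> dominates, even if \<open>\<xi>\<close> has infinite variance. Hence the
  estimators are defined with probability tending to one.
\<close>
lemma cross_sum_ratio:
  "conv_prob (\<lambda>n \<omega>. (\<Sum>i=1..n. cross (g1, k1, l1) (g2, k2, l2) n \<omega> i) / ss n (Xi \<omega>)) (g1 * g2)"
proof -
  obtain C where bal: "likely (\<lambda>n \<omega>. balanced C n (Xi \<omega>))"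
    by (rule eventually_balanced)
  note ev = balanced_ratios[OF bal]
  have bn: "likely (\<lambda>n \<omega>. \<bar>real n / ss n (Xi \<omega>)\<bar> \<le> C)"
    using ev by eventually_elim simp
  define m where "m p = smean (fst p) (\<lambda>i. lin k1 l1 (err i (snd p)) * lin k2 l2 (err i (snd p))) - lin_cov k1 l1 k2 l2" for p
  have m: "(m \<longlongrightarrow> 0) whp"
    unfolding m_def using mean_product_tendsto by (simp add: LIM_zero_iff)
  define G where "G p = g1 * g2
      + g1 * ((\<Sum>i=1..fst p. cen (fst p) (Xi (snd p)) i * lin k2 l2 (err i (snd p))) / ss (fst p) (Xi (snd p)))
      + g2 * ((\<Sum>i=1..fst p. cen (fst p) (Xi (snd p)) i * lin k1 l1 (err i (snd p))) / ss (fst p) (Xi (snd p)))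
      + real (fst p) / ss (fst p) (Xi (snd p)) * m p
      - c * (real (fst p) / ss (fst p) (Xi (snd p)) * (emean k1 l1 (fst p) (snd p) * emean k2 l2 (fst p) (snd p)))" for p
  have "(G \<longlongrightarrow> g1 * g2 + g1 * 0 + g2 * 0 + 0 - c * 0) whp"
    unfolding G_def
    by (intro tendsto_diff tendsto_add tendsto_mult tendsto_const cross_sum_tendsto_0
        bounded_mult_null[OF bn] m emean_product_tendsto_0)
  hence "(G \<longlongrightarrow> g1 * g2) whp"
    by simp
  moreover have "\<forall>\<^sub>F p in whp. G p = (\<Sum>i=1..fst p. cross (g1, k1, l1) (g2, k2, l2) (fst p) (snd p) i) / ss (fst p) (Xi (snd p))"
    using ev
  proof eventually_elim
    case (elim p)
    hence n: "0 < fst p" and A: "0 < ss (fst p) (Xi (snd p))"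
      by auto
    have "(\<Sum>i=1..fst p. lin k1 l1 (err i (snd p)) * lin k2 l2 (err i (snd p)) - lin_cov k1 l1 k2 l2) = real (fst p) * m p"
      using n by (simp add: m_def smean_def sum_subtractf field_simps)
    thus ?case
      unfolding sum_cross[OF n] G_def using A by (simp add: add_divide_distrib diff_divide_distrib)
  qed
  ultimately show ?thesis
    by (rule Lim_transform_eventually)
qed

lemma obs_fourth_ratio:
  "conv_prob (\<lambda>n \<omega>. (\<Sum>i=1..n. obs g' k' l' n \<omega> i ^ 4) / (ss n (Xi \<omega>))\<^sup>2) 0"
proof -
  obtain C where bal: "likely (\<lambda>n \<omega>. balanced C n (Xi \<omega>))"
    by (rule eventually_balanced)
  note ev = balanced_ratios[OF bal]
  have bn: "likely (\<lambda>n \<omega>. \<bar>(real n / ss n (Xi \<omega>))\<^sup>2\<bar> \<le> C\<^sup>2)"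
    using ev
  proof eventually_elim
    case (elim p)
    hence "(real (fst p) / ss (fst p) (Xi (snd p))) ^ 2 \<le> C ^ 2"
      by (intro power_mono) auto
    thus ?case
      by simp
  qed
  define G where "G p = 8 * g' ^ 4 * ((\<Sum>i=1..fst p. cen (fst p) (Xi (snd p)) i ^ 4) / (ss (fst p) (Xi (snd p)))\<^sup>2)
      + 64 * ((real (fst p) / ss (fst p) (Xi (snd p)))\<^sup>2 * ((\<Sum>i=1..fst p. lin k' l' (err i (snd p)) ^ 4) / (real (fst p))\<^sup>2))
      + 64 * ((real (fst p) / ss (fst p) (Xi (snd p)))\<^sup>2 * (inverse (real (fst p)) * ((emean k' l' (fst p) (snd p))\<^sup>2)\<^sup>2))" for p
  have "(G \<longlongrightarrow> 8 * g' ^ 4 * 0 + 64 * 0 + 64 * 0) whp"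
    unfolding G_def
  proof (intro tendsto_add tendsto_mult tendsto_const cen_fourth_ratio bounded_mult_null[OF bn] sum_fourth_tendsto_0)
    have "conv_prob (\<lambda>n \<omega>. inverse (real n) * ((emean k' l' n \<omega>)\<^sup>2)\<^sup>2) (0 * 0\<^sup>2)"
      by (intro tendsto_mult tendsto_power emean_square_tendsto_0 tendsto_whp_const[OF lim_inverse_n])
    thus "conv_prob (\<lambda>n \<omega>. inverse (real n) * ((emean k' l' n \<omega>)\<^sup>2)\<^sup>2) 0"
      by simp
  qed
  hence G: "(G \<longlongrightarrow> 0) whp"
    by simp
  show ?thesis
  proof (rule tendsto_sandwich[OF _ _ tendsto_const G])
    show "likely (\<lambda>n \<omega>. 0 \<le> (\<Sum>i=1..n. obs g' k' l' n \<omega> i ^ 4) / (ss n (Xi \<omega>))\<^sup>2)"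
      by (intro always_eventually allI divide_nonneg_nonneg sum_nonneg) auto
    show "\<forall>\<^sub>F p in whp. (\<Sum>i=1..fst p. obs g' k' l' (fst p) (snd p) i ^ 4) / (ss (fst p) (Xi (snd p)))\<^sup>2 \<le> G p"
      using ev
    proof eventually_elim
      case (elim p)
      obtain n \<omega> where p: "p = (n, \<omega>)"
        by (cases p)
      let ?A = "ss n (Xi \<omega>)" and ?m = "emean k' l' n \<omega>"
      have n: "0 < n" and A: "0 < ?A"
        using elim by (auto simp: p)
      have "(\<Sum>i=1..n. obs g' k' l' n \<omega> i ^ 4)
          \<le> (\<Sum>i=1..n. 8 * g' ^ 4 * cen n (Xi \<omega>) i ^ 4 + 64 * lin k' l' (err i \<omega>) ^ 4 + 64 * ?m ^ 4)"
      proof (rule sum_mono)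
        fix i
        have "obs g' k' l' n \<omega> i = g' * cen n (Xi \<omega>) i + (lin k' l' (err i \<omega>) + - (c * ?m))"
          by (simp add: obs_def)
        hence "obs g' k' l' n \<omega> i ^ 4 \<le> 8 * (g' * cen n (Xi \<omega>) i) ^ 4 + 8 * (lin k' l' (err i \<omega>) + - (c * ?m)) ^ 4"
          using fourth_add_le by metis
        moreover have "(lin k' l' (err i \<omega>) + - (c * ?m)) ^ 4 \<le> 8 * lin k' l' (err i \<omega>) ^ 4 + 8 * ?m ^ 4"
          using fourth_add_le[of "lin k' l' (err i \<omega>)" "- (c * ?m)"] c by (auto simp: zero_le_even_power intro: order_trans)
        ultimately show "obs g' k' l' n \<omega> i ^ 4 \<le> 8 * g' ^ 4 * cen n (Xi \<omega>) i ^ 4 + 64 * lin k' l' (err i \<omega>) ^ 4 + 64 * ?m ^ 4"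
          by (simp add: power_mult_distrib)
      qed
      also have "\<dots> = 8 * g' ^ 4 * (\<Sum>i=1..n. cen n (Xi \<omega>) i ^ 4) + 64 * (\<Sum>i=1..n. lin k' l' (err i \<omega>) ^ 4) + 64 * (real n * ?m ^ 4)"
        by (simp add: sum.distrib sum_distrib_left)
      finally have "(\<Sum>i=1..n. obs g' k' l' n \<omega> i ^ 4) / ?A\<^sup>2
          \<le> (8 * g' ^ 4 * (\<Sum>i=1..n. cen n (Xi \<omega>) i ^ 4) + 64 * (\<Sum>i=1..n. lin k' l' (err i \<omega>) ^ 4) + 64 * (real n * ?m ^ 4)) / ?A\<^sup>2"
        by (rule divide_right_mono) simp
      also have "\<dots> = G p"
        using n A by (simp add: G_def p add_divide_distrib power_divide power2_eq_square[of "real n"] flip: power_mult)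
      finally show ?case
        by (simp add: p)
    qed
  qed
qed

text \<open>
  The Euclidean norm of the terms is negligible against \<open>ss\<close>, the order of their sum. This is what makes the
  estimated slope as good as the true one in the denominator.
\<close>
lemma cross_square_ratio:
  "conv_prob (\<lambda>n \<omega>. (\<Sum>i=1..n. (cross (g1, k1, l1) (g2, k2, l2) n \<omega> i)\<^sup>2) / (ss n (Xi \<omega>))\<^sup>2) 0"
proof -
  obtain C where bal: "likely (\<lambda>n \<omega>. balanced C n (Xi \<omega>))"
    by (rule eventually_balanced)
  note ev = balanced_ratios[OF bal]
  have bn: "likely (\<lambda>n \<omega>. \<bar>(real n / ss n (Xi \<omega>))\<^sup>2\<bar> \<le> C\<^sup>2)"
    using ev
  proof eventually_elim
    case (elim p)
    hence "(real (fst p) / ss (fst p) (Xi (snd p))) ^ 2 \<le> C ^ 2"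
      by (intro power_mono) auto
    thus ?case
      by simp
  qed
  let ?v = "lin_cov k1 l1 k2 l2"
  define G where "G p = (\<Sum>i=1..fst p. obs g1 k1 l1 (fst p) (snd p) i ^ 4) / (ss (fst p) (Xi (snd p)))\<^sup>2
      + (\<Sum>i=1..fst p. obs g2 k2 l2 (fst p) (snd p) i ^ 4) / (ss (fst p) (Xi (snd p)))\<^sup>2
      + 2 * ?v\<^sup>2 * ((real (fst p) / ss (fst p) (Xi (snd p)))\<^sup>2 * inverse (real (fst p)))" for p
  have "(G \<longlongrightarrow> 0 + 0 + 2 * ?v\<^sup>2 * 0) whp"
    unfolding G_def
    by (intro tendsto_add tendsto_mult tendsto_const obs_fourth_ratio bounded_mult_null[OF bn] tendsto_whp_const[OF lim_inverse_n])
  hence G: "(G \<longlongrightarrow> 0) whp"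
    by simp
  show ?thesis
  proof (rule tendsto_sandwich[OF _ _ tendsto_const G])
    show "likely (\<lambda>n \<omega>. 0 \<le> (\<Sum>i=1..n. (cross (g1, k1, l1) (g2, k2, l2) n \<omega> i)\<^sup>2) / (ss n (Xi \<omega>))\<^sup>2)"
      by (intro always_eventually allI divide_nonneg_nonneg sum_nonneg) auto
    show "\<forall>\<^sub>F p in whp. (\<Sum>i=1..fst p. (cross (g1, k1, l1) (g2, k2, l2) (fst p) (snd p) i)\<^sup>2) / (ss (fst p) (Xi (snd p)))\<^sup>2 \<le> G p"
      using ev
    proof eventually_elim
      case (elim p)
      obtain n \<omega> where p: "p = (n, \<omega>)"
        by (cases p)
      let ?A = "ss n (Xi \<omega>)"
      have n: "0 < n" and A: "0 < ?A"
        using elim by (auto simp: p)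
      have "(\<Sum>i=1..n. (cross (g1, k1, l1) (g2, k2, l2) n \<omega> i)\<^sup>2)
          \<le> (\<Sum>i=1..n. obs g1 k1 l1 n \<omega> i ^ 4 + obs g2 k2 l2 n \<omega> i ^ 4 + 2 * ?v\<^sup>2)"
      proof (rule sum_mono)
        fix i
        let ?a = "obs g1 k1 l1 n \<omega> i" and ?b = "obs g2 k2 l2 n \<omega> i"
        have "(?a * ?b + - ?v)\<^sup>2 \<le> 2 * (?a * ?b)\<^sup>2 + 2 * (- ?v)\<^sup>2"
          by (rule square_add_le)
        moreover have "2 * (?a * ?b)\<^sup>2 \<le> ?a ^ 4 + ?b ^ 4"
          using sum_squares_bound[of "?a\<^sup>2" "?b\<^sup>2"] by (simp add: power_mult_distrib flip: power_mult)
        ultimately show "(cross (g1, k1, l1) (g2, k2, l2) n \<omega> i)\<^sup>2 \<le> ?a ^ 4 + ?b ^ 4 + 2 * ?v\<^sup>2"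
          by (simp add: cross_eq)
      qed
      also have "\<dots> = (\<Sum>i=1..n. obs g1 k1 l1 n \<omega> i ^ 4) + (\<Sum>i=1..n. obs g2 k2 l2 n \<omega> i ^ 4) + 2 * ?v\<^sup>2 * real n"
        by (simp add: sum.distrib)
      finally have "(\<Sum>i=1..n. (cross (g1, k1, l1) (g2, k2, l2) n \<omega> i)\<^sup>2) / ?A\<^sup>2
          \<le> ((\<Sum>i=1..n. obs g1 k1 l1 n \<omega> i ^ 4) + (\<Sum>i=1..n. obs g2 k2 l2 n \<omega> i ^ 4) + 2 * ?v\<^sup>2 * real n) / ?A\<^sup>2"
        by (rule divide_right_mono) simp
      also have "\<dots> = G p"
        using n A by (simp add: G_def p add_divide_distrib power_divide power2_eq_square[of "real n"])
      finally show ?case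
        by (simp add: p)
    qed
  qed
qed

text \<open>
  \<open>res\<close> are the residuals \<open>u\<^sub>i\<close> with the true slope, and \<open>wt\<close> are the terms whose mean is \<open>U\<close>.
\<close>
definition res :: "nat \<Rightarrow> 'a \<Rightarrow> nat \<Rightarrow> real" where
  "res = cross (g, k, l) (0, 1, - \<beta>)"

definition wt :: "nat \<Rightarrow> 'a \<Rightarrow> nat \<Rightarrow> real" where
  "wt = cross (g, k, l) (1, 0, 1)"

lemma res_measurable [measurable]: "(\<lambda>\<omega>. res n \<omega> i) \<in> borel_measurable M"
  unfolding res_def by measurable

lemma wt_measurable [measurable]: "(\<lambda>\<omega>. wt n \<omega> i) \<in> borel_measurable M"
  unfolding wt_def by measurable

lemma sum_res_eq_score:
  assumes n: "0 < n"
  shows "(\<Sum>i=1..n. res n \<omega> i) = (\<Sum>i=1..n. score n (Er \<omega>) (Xi \<omega>) i)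
    - c * (real n * (emean k l n \<omega> * emean 1 (- \<beta>) n \<omega>))"
  unfolding res_def sum_cross[OF n] score_def zeta_def
  by (simp add: sum.distrib sum_distrib_left mult.assoc)

text \<open>
  Residual and score differ by terms containing at least one error mean as a factor, and
  the squares of the error means tend to \<open>0\<close>.
\<close>
lemma res_minus_score_null:
  "conv_prob (\<lambda>n \<omega>. L2_set (\<lambda>i. res n \<omega> i - score n (Er \<omega>) (Xi \<omega>) i) {1..n}
      / sqrt (V n (Xi \<omega>))) 0"
proof -
  obtain C where bal: "likely (\<lambda>n \<omega>. balanced C n (Xi \<omega>))"
    by (rule eventually_balanced)
  note ev = balanced_ratios[OF bal]
  have bn: "likely (\<lambda>n \<omega>. \<bar>real n / V n (Xi \<omega>)\<bar> \<le> C)"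
    using ev by eventually_elim simp
  have bA: "likely (\<lambda>n \<omega>. \<bar>ss n (Xi \<omega>) / V n (Xi \<omega>)\<bar> \<le> C)"
    using ev by eventually_elim simp
  define m1 where "m1 p = (emean k l (fst p) (snd p))\<^sup>2" for p
  define m2 where "m2 p = (emean 1 (- \<beta>) (fst p) (snd p))\<^sup>2" for p
  define q1 where "q1 p = smean (fst p) (\<lambda>i. nu (err i (snd p)) * nu (err i (snd p)))" for p
  define q2 where "q2 p = smean (fst p) (\<lambda>i. eta (err i (snd p)) * eta (err i (snd p)))" for p
  have m: "(m1 \<longlongrightarrow> 0) whp" "(m2 \<longlongrightarrow> 0) whp"
    unfolding m1_def m2_def by (rule emean_square_tendsto_0)+
  have q: "(q1 \<longlongrightarrow> lin_cov k l k l) whp" "(q2 \<longlongrightarrow> eta_var) whp"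
    unfolding q1_def q2_def by (rule mean_product_tendsto)+
  define G where "G p = 4 * (g\<^sup>2 * (ss (fst p) (Xi (snd p)) / V (fst p) (Xi (snd p)) * m2 p)
      + real (fst p) / V (fst p) (Xi (snd p)) * (m2 p * q1 p)
      + real (fst p) / V (fst p) (Xi (snd p)) * (m1 p * q2 p)
      + real (fst p) / V (fst p) (Xi (snd p)) * (m1 p * m2 p))" for p
  have "((\<lambda>p. m2 p * q1 p) \<longlongrightarrow> 0 * lin_cov k l k l) whp" "((\<lambda>p. m1 p * q2 p) \<longlongrightarrow> 0 * eta_var) whp"
    "((\<lambda>p. m1 p * m2 p) \<longlongrightarrow> 0 * 0) whp"
    by (intro tendsto_mult m q)+
  hence mq: "((\<lambda>p. m2 p * q1 p) \<longlongrightarrow> 0) whp" "((\<lambda>p. m1 p * q2 p) \<longlongrightarrow> 0) whp" "((\<lambda>p. m1 p * m2 p) \<longlongrightarrow> 0) whp"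
    by simp_all
  have "(G \<longlongrightarrow> 4 * (g\<^sup>2 * 0 + 0 + 0 + 0)) whp"
    unfolding G_def
    by (intro tendsto_mult[OF tendsto_const] tendsto_add bounded_mult_null[OF bn] bounded_mult_null[OF bA] m mq)
  hence "(G \<longlongrightarrow> 0) whp"
    by simp
  from tendsto_real_sqrt[OF this] have G: "((\<lambda>p. sqrt (G p)) \<longlongrightarrow> 0) whp"
    by simp
  show ?thesis
  proof (rule Lim_null_comparison[OF _ G])
    show "\<forall>\<^sub>F p in whp. norm (L2_set (\<lambda>i. res (fst p) (snd p) i - score (fst p) (Er (snd p)) (Xi (snd p)) i) {1..fst p}
        / sqrt (V (fst p) (Xi (snd p)))) \<le> sqrt (G p)"
      using ev
    proof eventually_elim
      case (elim p)
      obtain n \<omega> where p: "p = (n, \<omega>)"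
        by (cases p)
      let ?V = "V n (Xi \<omega>)" and ?a = "cen n (Xi \<omega>)" and ?nb = "emean k l n \<omega>" and ?eb = "emean 1 (- \<beta>) n \<omega>"
      have n: "0 < n" and V: "0 < ?V"
        using elim by (auto simp: p)
      have "(\<Sum>i=1..n. (res n \<omega> i - score n (Er \<omega>) (Xi \<omega>) i)\<^sup>2)
          \<le> (\<Sum>i=1..n. 4 * (g\<^sup>2 * m2 p * (?a i)\<^sup>2 + m2 p * (nu (err i \<omega>) * nu (err i \<omega>))
              + m1 p * (eta (err i \<omega>) * eta (err i \<omega>)) + m1 p * m2 p))"
      proof (rule sum_mono)
        fix i
        have eq: "res n \<omega> i - score n (Er \<omega>) (Xi \<omega>) i
            = c * (- (g * ?a i * ?eb) + - (nu (err i \<omega>) * ?eb) + - (?nb * eta (err i \<omega>)) + c * (?nb * ?eb))"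
          by (simp add: res_def cross_eq obs_def score_def zeta_def algebra_simps)
        have c2: "(c * y)\<^sup>2 \<le> y\<^sup>2" for y
          using c by auto
        have "(res n \<omega> i - score n (Er \<omega>) (Xi \<omega>) i)\<^sup>2
            \<le> (- (g * ?a i * ?eb) + - (nu (err i \<omega>) * ?eb) + - (?nb * eta (err i \<omega>)) + c * (?nb * ?eb))\<^sup>2"
          unfolding eq by (rule c2)
        also have "\<dots> \<le> 4 * ((- (g * ?a i * ?eb))\<^sup>2 + (- (nu (err i \<omega>) * ?eb))\<^sup>2 + (- (?nb * eta (err i \<omega>)))\<^sup>2 + (c * (?nb * ?eb))\<^sup>2)"
          by (rule four_square_le)
        also have "\<dots> \<le> 4 * ((- (g * ?a i * ?eb))\<^sup>2 + (- (nu (err i \<omega>) * ?eb))\<^sup>2 + (- (?nb * eta (err i \<omega>)))\<^sup>2 + (?nb * ?eb)\<^sup>2)"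
          using c2[of "?nb * ?eb"] by simp
        also have "\<dots> = 4 * (g\<^sup>2 * m2 p * (?a i)\<^sup>2 + m2 p * (nu (err i \<omega>) * nu (err i \<omega>))
              + m1 p * (eta (err i \<omega>) * eta (err i \<omega>)) + m1 p * m2 p)"
          by (simp add: m1_def m2_def p power2_eq_square mult_ac)
        finally show "(res n \<omega> i - score n (Er \<omega>) (Xi \<omega>) i)\<^sup>2 \<le> 4 * (g\<^sup>2 * m2 p * (?a i)\<^sup>2 + m2 p * (nu (err i \<omega>) * nu (err i \<omega>))
              + m1 p * (eta (err i \<omega>) * eta (err i \<omega>)) + m1 p * m2 p)" .
      qed
      also have "\<dots> = 4 * (g\<^sup>2 * m2 p * ss n (Xi \<omega>) + m2 p * (\<Sum>i=1..n. nu (err i \<omega>) * nu (err i \<omega>))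
              + m1 p * (\<Sum>i=1..n. eta (err i \<omega>) * eta (err i \<omega>)) + real n * (m1 p * m2 p))"
        unfolding ss_def by (simp only: sum.distrib sum_distrib_left[symmetric] sum_constant card_atLeastAtMost) simp
      also have "\<dots> = 4 * (g\<^sup>2 * m2 p * ss n (Xi \<omega>) + m2 p * (real n * q1 p) + m1 p * (real n * q2 p) + real n * (m1 p * m2 p))"
        using n by (simp add: q1_def q2_def p smean_def)
      also have "\<dots> = ?V * G p"
        using V by (simp add: G_def p field_simps)
      finally have "sqrt (\<Sum>i=1..n. (res n \<omega> i - score n (Er \<omega>) (Xi \<omega>) i)\<^sup>2) \<le> sqrt (?V * G p)"
        by (rule real_sqrt_le_mono)
      hence "L2_set (\<lambda>i. res n \<omega> i - score n (Er \<omega>) (Xi \<omega>) i) {1..n} \<le> sqrt ?V * sqrt (G p)"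
        by (simp add: L2_set_def real_sqrt_mult)
      thus ?case
        using V by (simp add: p pos_divide_le_eq mult.commute)
    qed
  qed
qed

lemma res_clt: "conv_std_normal (\<lambda>n \<omega>. (\<Sum>i=1..n. res n \<omega> i) / sqrt (V n (Xi \<omega>)))"
proof (rule slutsky_add[OF _ _ score_clt])
  obtain C where C: "0 < C" and bal: "likely (\<lambda>n \<omega>. balanced C n (Xi \<omega>))"
    by (rule eventually_balanced)
  note ev = balanced_ratios[OF bal]
  define m where "m p = sqrt (real (fst p)) * (emean k l (fst p) (snd p) * emean 1 (- \<beta>) (fst p) (snd p))" for p
  have bn: "likely (\<lambda>n \<omega>. \<bar>- c * sqrt (real n / V n (Xi \<omega>))\<bar> \<le> sqrt C)"
    using ev
  proof eventually_elim
    case (elim p)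
    hence "sqrt (real (fst p) / V (fst p) (Xi (snd p))) \<le> sqrt C"
      by (intro real_sqrt_le_mono) auto
    thus ?case
      using c C elim by (auto simp: abs_mult)
  qed
  have "((\<lambda>p. - c * sqrt (real (fst p) / V (fst p) (Xi (snd p))) * m p) \<longlongrightarrow> 0) whp"
    unfolding m_def by (rule bounded_mult_null[OF bn scaled_emean_product_tendsto_0])
  moreover have "\<forall>\<^sub>F p in whp. - c * sqrt (real (fst p) / V (fst p) (Xi (snd p))) * m p
      = (\<Sum>i=1..fst p. res (fst p) (snd p) i) / sqrt (V (fst p) (Xi (snd p)))
        - (\<Sum>i=1..fst p. score (fst p) (Er (snd p)) (Xi (snd p)) i) / sqrt (V (fst p) (Xi (snd p)))"
    using ev
  proof eventually_elim
    case (elim p)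
    hence n: "0 < fst p"
      by simp
    have "sqrt (real (fst p) / V (fst p) (Xi (snd p))) * m p
        = real (fst p) * (emean k l (fst p) (snd p) * emean 1 (- \<beta>) (fst p) (snd p)) / sqrt (V (fst p) (Xi (snd p)))"
      by (simp add: m_def real_sqrt_divide)
    thus ?case
      unfolding sum_res_eq_score[OF n] by (simp add: diff_divide_distrib mult.assoc)
  qed
  ultimately show "conv_prob (\<lambda>n \<omega>. (\<Sum>i=1..n. res n \<omega> i) / sqrt (V n (Xi \<omega>))
        - (\<Sum>i=1..n. score n (Er \<omega>) (Xi \<omega>) i) / sqrt (V n (Xi \<omega>))) 0"
    by (rule Lim_transform_eventually)
qed measurable

lemma res_norm_ratio:
  "conv_prob (\<lambda>n \<omega>. L2_set (res n \<omega>) {1..n} / sqrt (V n (Xi \<omega>))) 1"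
proof -
  let ?sc = "\<lambda>p. score (fst p) (Er (snd p)) (Xi (snd p))" and ?B = "\<lambda>p. sqrt (V (fst p) (Xi (snd p)))"
  have "((\<lambda>p. L2_set (?sc p) {1..fst p} / ?B p) \<longlongrightarrow> 1) whp"
    using tendsto_real_sqrt[OF score_square_sum] unfolding real_sqrt_divide L2_set_def by simp
  moreover have "((\<lambda>p. L2_set (res (fst p) (snd p)) {1..fst p} / ?B p - L2_set (?sc p) {1..fst p} / ?B p) \<longlongrightarrow> 0) whp"
  proof (rule Lim_null_comparison[OF _ res_minus_score_null])
    show "\<forall>\<^sub>F p in whp. norm (L2_set (res (fst p) (snd p)) {1..fst p} / ?B p - L2_set (?sc p) {1..fst p} / ?B p)
        \<le> L2_set (\<lambda>i. res (fst p) (snd p) i - ?sc p i) {1..fst p} / ?B p"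
    proof (rule eventually_mono[OF eventually_V_pos])
      fix p assume "0 < V (fst p) (Xi (snd p))"
      thus "norm (L2_set (res (fst p) (snd p)) {1..fst p} / ?B p - L2_set (?sc p) {1..fst p} / ?B p)
          \<le> L2_set (\<lambda>i. res (fst p) (snd p) i - ?sc p i) {1..fst p} / ?B p"
        using L2_set_diff_le[of "res (fst p) (snd p)" "{1..fst p}" "?sc p"]
        by (simp add: divide_right_mono flip: diff_divide_distrib)
    qed
  qed
  ultimately have "((\<lambda>p. (L2_set (res (fst p) (snd p)) {1..fst p} / ?B p - L2_set (?sc p) {1..fst p} / ?B p)
      + L2_set (?sc p) {1..fst p} / ?B p) \<longlongrightarrow> 0 + 1) whp"
    by (intro tendsto_add)
  thus ?thesis
    by simp
qed

text \<open>
  A perturbation of the residuals does not affect their norm asymptotically if its norm is at most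
  \<open>|\<Sum> res| |R|\<close> with \<open>R \<rightarrow> 0\<close>: as \<open>\<Sum> res / \<surd>V\<close> is tight, its product with \<open>R\<close> tends to \<open>0\<close>. Both remaining
  denominators are of this kind, with \<open>R = 1/\<surd>n\<close> for the
  centred residuals and \<open>R\<close> the norm of \<open>wt\<close> divided by its sum for the estimated slope.
\<close>
lemma perturbed_norm_ratio:
  assumes d: "conv_prob (\<lambda>n \<omega>. (\<Sum>i=1..n. res n \<omega> i) / sqrt (V n (Xi \<omega>)) * R n \<omega>) 0"
    and le: "likely (\<lambda>n \<omega>. L2_set (\<lambda>i. v n \<omega> i - res n \<omega> i) {1..n}
        \<le> \<bar>(\<Sum>i=1..n. res n \<omega> i) * R n \<omega>\<bar>)"
  shows "conv_prob (\<lambda>n \<omega>. L2_set (v n \<omega>) {1..n} / sqrt (V n (Xi \<omega>))) 1"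
proof -
  let ?B = "\<lambda>p. sqrt (V (fst p) (Xi (snd p)))"
  have "((\<lambda>p. L2_set (v (fst p) (snd p)) {1..fst p} / ?B p - L2_set (res (fst p) (snd p)) {1..fst p} / ?B p) \<longlongrightarrow> 0) whp"
  proof (rule Lim_null_comparison[OF _ tendsto_rabs_zero[OF d]])
    show "\<forall>\<^sub>F p in whp. norm (L2_set (v (fst p) (snd p)) {1..fst p} / ?B p - L2_set (res (fst p) (snd p)) {1..fst p} / ?B p)
        \<le> \<bar>(\<Sum>i=1..fst p. res (fst p) (snd p) i) / sqrt (V (fst p) (Xi (snd p))) * R (fst p) (snd p)\<bar>"
      using le eventually_V_pos
    proof eventually_elim
      case (elim p)
      have "\<bar>L2_set (v (fst p) (snd p)) {1..fst p} - L2_set (res (fst p) (snd p)) {1..fst p}\<bar>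
          \<le> \<bar>(\<Sum>i=1..fst p. res (fst p) (snd p) i) * R (fst p) (snd p)\<bar>"
        using L2_set_diff_le elim(1) by (rule order_trans)
      from divide_right_mono[OF this, of "?B p"] elim(2) show ?case
        by (simp add: abs_mult flip: diff_divide_distrib)
    qed
  qed
  from tendsto_add[OF this res_norm_ratio] show ?thesis
    by simp
qed

text \<open>The factor \<open>a\<^sub>n\<close> absorbs the difference between \<open>n\<close> and \<open>n - 1\<close> in the sample variance.\<close>
lemma self_normalized_limit:
  assumes Z[measurable]: "\<And>n. Z n \<in> borel_measurable M" and v[measurable]: "\<And>n i. (\<lambda>\<omega>. v n \<omega> i) \<in> borel_measurable M"
    and D: "conv_prob (\<lambda>n \<omega>. L2_set (v n \<omega>) {1..n} / sqrt (V n (Xi \<omega>))) 1"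
    and a: "a \<longlonglongrightarrow> 1"
    and eq: "likely (\<lambda>n \<omega>. Z n \<omega> = a n * (\<Sum>i=1..n. res n \<omega> i) / L2_set (v n \<omega>) {1..n})"
  shows "conv_std_normal Z"
proof -
  define W where "W n \<omega> = (\<Sum>i=1..n. res n \<omega> i) / sqrt (V n (Xi \<omega>))" for n \<omega>
  define R where "R n \<omega> = a n * inverse (L2_set (v n \<omega>) {1..n} / sqrt (V n (Xi \<omega>)))" for n \<omega>
  have [measurable]: "W n \<in> borel_measurable M" "R n \<in> borel_measurable M" for n
    unfolding W_def R_def L2_set_def by measurable
  have "conv_prob (\<lambda>n \<omega>. R n \<omega>) (1 * inverse 1)"
    unfolding R_def by (intro tendsto_mult tendsto_inverse D tendsto_whp_const[OF a]) simp
  hence R: "conv_prob (\<lambda>n \<omega>. R n \<omega>) 1"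
    by simp
  have WR: "conv_std_normal (\<lambda>n \<omega>. W n \<omega> * R n \<omega>)"
    by (rule slutsky_mult[OF _ _ _ R]) (use res_clt in \<open>simp_all add: W_def[abs_def]\<close>)
  show ?thesis
  proof (rule slutsky_add[OF _ _ WR])
    show "conv_prob (\<lambda>n \<omega>. Z n \<omega> - W n \<omega> * R n \<omega>) 0"
    proof (rule tendsto_eventually)
      show "likely (\<lambda>n \<omega>. Z n \<omega> - W n \<omega> * R n \<omega> = 0)"
        using eq eventually_V_pos
        by eventually_elim (simp add: W_def R_def field_simps)
    qed
  qed measurable
qed

lemma wt_sum_nonzero: "likely (\<lambda>n \<omega>. (\<Sum>i=1..n. wt n \<omega> i) \<noteq> 0)"
proof -
  have "conv_prob (\<lambda>n \<omega>. (\<Sum>i=1..n. wt n \<omega> i) / ss n (Xi \<omega>)) (g * 1)"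
    unfolding wt_def by (rule cross_sum_ratio)
  hence "likely (\<lambda>n \<omega>. (\<Sum>i=1..n. wt n \<omega> i) / ss n (Xi \<omega>) \<noteq> 0)"
    using g by (intro tendsto_imp_eventually_ne) auto
  thus ?thesis
    by eventually_elim auto
qed

theorem self_normalized_estimator:
  assumes bhat[measurable]: "\<And>n. bhat n \<in> borel_measurable M"
    and est: "likely (\<lambda>n \<omega>. bhat n \<omega> - \<beta>
      = (\<Sum>i=1..n. res n \<omega> i) / (\<Sum>i=1..n. wt n \<omega> i))"
  defines "num \<equiv> \<lambda>n \<omega>. (\<Sum>i=1..n. wt n \<omega> i) / real n * (bhat n \<omega> - \<beta>)"
  shows "conv_std_normal (\<lambda>n \<omega>. sqrt (real n) * num n \<omega>
      / sqrt ((\<Sum>i=1..n. (res n \<omega> i - smean n (res n \<omega>))\<^sup>2) / (real n - 1)))"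
    and "conv_std_normal (\<lambda>n \<omega>. real n * num n \<omega> / sqrt (\<Sum>i=1..n. (res n \<omega> i)\<^sup>2))"
    and "conv_std_normal (\<lambda>n \<omega>. real n * num n \<omega>
      / sqrt (\<Sum>i=1..n. (res n \<omega> i - (bhat n \<omega> - \<beta>) * wt n \<omega> i)\<^sup>2))"
proof -
  define T where "T n \<omega> = (\<Sum>i=1..n. res n \<omega> i) / sqrt (V n (Xi \<omega>))" for n \<omega>
  have Tm[measurable]: "T n \<in> borel_measurable M" for n
    unfolding T_def by measurable
  have T: "conv_std_normal T"
    using res_clt unfolding T_def .
  have [measurable]: "num n \<in> borel_measurable M" for n
    unfolding num_def by measurable
  have numer: "likely (\<lambda>n \<omega>. real n * num n \<omega> = (\<Sum>i=1..n. res n \<omega> i))"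
    using est wt_sum_nonzero eventually_whp_fst[OF eventually_gt_at_top[of 0]]
    by eventually_elim (simp add: num_def)
  show "conv_std_normal (\<lambda>n \<omega>. real n * num n \<omega> / sqrt (\<Sum>i=1..n. (res n \<omega> i)\<^sup>2))"
  proof (rule self_normalized_limit[OF _ _ res_norm_ratio tendsto_const])
    show "likely (\<lambda>n \<omega>. real n * num n \<omega> / sqrt (\<Sum>i=1..n. (res n \<omega> i)\<^sup>2)
        = 1 * (\<Sum>i=1..n. res n \<omega> i) / L2_set (res n \<omega>) {1..n})"
      using numer by eventually_elim (simp add: L2_set_def)
  qed measurable
  show "conv_std_normal (\<lambda>n \<omega>. sqrt (real n) * num n \<omega>
      / sqrt ((\<Sum>i=1..n. (res n \<omega> i - smean n (res n \<omega>))\<^sup>2) / (real n - 1)))"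
  proof (rule self_normalized_limit[where a="\<lambda>n. sqrt (1 - inverse (real n))"
        and v="\<lambda>n \<omega> i. res n \<omega> i - smean n (res n \<omega>)"])
    show "(\<lambda>n. sqrt (1 - inverse (real n))) \<longlonglongrightarrow> 1"
      using tendsto_real_sqrt[OF tendsto_diff[OF tendsto_const[of "1::real"] lim_inverse_n]] by simp
    show "(\<lambda>\<omega>. sqrt (real n) * num n \<omega>
        / sqrt ((\<Sum>i=1..n. (res n \<omega> i - smean n (res n \<omega>))\<^sup>2) / (real n - 1))) \<in> borel_measurable M" for n
      unfolding smean_def by measurable
    show "(\<lambda>\<omega>. res n \<omega> i - smean n (res n \<omega>)) \<in> borel_measurable M" for n i
      unfolding smean_def by measurable
    show "conv_prob (\<lambda>n \<omega>. L2_set (\<lambda>i. res n \<omega> i - smean n (res n \<omega>)) {1..n}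
        / sqrt (V n (Xi \<omega>))) 1"
    proof (rule perturbed_norm_ratio[where R="\<lambda>n \<omega>. inverse (sqrt (real n))"])
      have "conv_prob (\<lambda>n \<omega>. inverse (sqrt (real n))) 0"
        by (rule tendsto_whp_const, rule tendsto_inverse_0_at_top,
            rule filterlim_compose[OF sqrt_at_top filterlim_real_sequentially])
      thus "conv_prob (\<lambda>n \<omega>. (\<Sum>i=1..n. res n \<omega> i) / sqrt (V n (Xi \<omega>)) * inverse (sqrt (real n))) 0"
        unfolding T_def[symmetric] by (intro tight_mult_null[OF Tm _ T, where R="\<lambda>n \<omega>. inverse (sqrt (real n))"]) auto
      show "likely (\<lambda>n \<omega>. L2_set (\<lambda>i. res n \<omega> i - smean n (res n \<omega>) - res n \<omega> i) {1..n}
          \<le> \<bar>(\<Sum>i=1..n. res n \<omega> i) * inverse (sqrt (real n))\<bar>)"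
        using eventually_whp_fst[OF eventually_gt_at_top[of 0]]
      proof eventually_elim
        case (elim p)
        have "L2_set (\<lambda>i. - smean (fst p) (res (fst p) (snd p))) {1..fst p} = sqrt (real (fst p)) * \<bar>smean (fst p) (res (fst p) (snd p))\<bar>"
          by (simp add: L2_set_def real_sqrt_mult)
        also have "\<dots> = \<bar>\<Sum>i=1..fst p. res (fst p) (snd p) i\<bar> * (sqrt (real (fst p)) / real (fst p))"
          by (simp add: smean_def abs_divide)
        also have "sqrt (real (fst p)) / real (fst p) = inverse (sqrt (real (fst p)))"
          using elim by (simp add: field_simps)
        finally show ?case
          by (simp add: abs_mult)
      qed
    qed
    show "likely (\<lambda>n \<omega>. sqrt (real n) * num n \<omega>
        / sqrt ((\<Sum>i=1..n. (res n \<omega> i - smean n (res n \<omega>))\<^sup>2) / (real n - 1))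
        = sqrt (1 - inverse (real n)) * (\<Sum>i=1..n. res n \<omega> i)
          / L2_set (\<lambda>i. res n \<omega> i - smean n (res n \<omega>)) {1..n})"
      using numer eventually_whp_fst[OF eventually_gt_at_top[of 1]]
    proof eventually_elim
      case (elim p)
      let ?n = "real (fst p)"
      have n: "1 < ?n"
        using elim by simp
      have "1 - inverse ?n = (?n - 1) / ?n"
        using n by (simp add: field_simps)
      hence "sqrt (1 - inverse ?n) * (?n * num (fst p) (snd p)) = sqrt (?n - 1) * (?n / sqrt ?n) * num (fst p) (snd p)"
        by (simp add: real_sqrt_divide)
      also have "?n / sqrt ?n = sqrt ?n"
        using n by (simp add: real_div_sqrt)
      finally show ?case
        using elim by (simp add: L2_set_def real_sqrt_divide mult_ac)
    qed
  qed
  show "conv_std_normal (\<lambda>n \<omega>. real n * num n \<omega>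
      / sqrt (\<Sum>i=1..n. (res n \<omega> i - (bhat n \<omega> - \<beta>) * wt n \<omega> i)\<^sup>2))"
  proof (rule self_normalized_limit[OF _ _ _ tendsto_const,
        where v="\<lambda>n \<omega> i. res n \<omega> i - (bhat n \<omega> - \<beta>) * wt n \<omega> i"])
    define R where "R n \<omega> = L2_set (wt n \<omega>) {1..n} / (\<Sum>i=1..n. wt n \<omega> i)" for n \<omega>
    have Rm[measurable]: "R n \<in> borel_measurable M" for n
      unfolding R_def L2_set_def by measurable
    have R: "conv_prob (\<lambda>n \<omega>. R n \<omega>) 0"
    proof -
      have 1: "conv_prob (\<lambda>n \<omega>. (\<Sum>i=1..n. wt n \<omega> i) / ss n (Xi \<omega>)) (g * 1)"
        unfolding wt_def by (rule cross_sum_ratio)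
      have "conv_prob (\<lambda>n \<omega>. sqrt ((\<Sum>i=1..n. (wt n \<omega> i)\<^sup>2) / (ss n (Xi \<omega>))\<^sup>2)) (sqrt 0)"
        unfolding wt_def by (intro tendsto_real_sqrt cross_square_ratio)
      from tendsto_divide[OF this 1]
      have "conv_prob (\<lambda>n \<omega>. sqrt ((\<Sum>i=1..n. (wt n \<omega> i)\<^sup>2) / (ss n (Xi \<omega>))\<^sup>2)
          / ((\<Sum>i=1..n. wt n \<omega> i) / ss n (Xi \<omega>))) 0"
        using g by simp
      moreover have "likely (\<lambda>n \<omega>. sqrt ((\<Sum>i=1..n. (wt n \<omega> i)\<^sup>2) / (ss n (Xi \<omega>))\<^sup>2)
          / ((\<Sum>i=1..n. wt n \<omega> i) / ss n (Xi \<omega>)) = R n \<omega>)"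
        using eventually_ss_pos
        by eventually_elim (simp add: R_def L2_set_def real_sqrt_divide)
      ultimately show ?thesis
        by (rule Lim_transform_eventually)
    qed
    show "conv_prob (\<lambda>n \<omega>. L2_set (\<lambda>i. res n \<omega> i - (bhat n \<omega> - \<beta>) * wt n \<omega> i) {1..n}
        / sqrt (V n (Xi \<omega>))) 1"
    proof (rule perturbed_norm_ratio[where R=R])
      show "conv_prob (\<lambda>n \<omega>. (\<Sum>i=1..n. res n \<omega> i) / sqrt (V n (Xi \<omega>)) * R n \<omega>) 0"
        using tight_mult_null[OF Tm Rm T R] unfolding T_def .
      show "likely (\<lambda>n \<omega>. L2_set (\<lambda>i. res n \<omega> i - (bhat n \<omega> - \<beta>) * wt n \<omega> i - res n \<omega> i) {1..n}
          \<le> \<bar>(\<Sum>i=1..n. res n \<omega> i) * R n \<omega>\<bar>)"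
        using est
      proof eventually_elim
        case (elim p)
        have "L2_set (\<lambda>i. - ((bhat (fst p) (snd p) - \<beta>) * wt (fst p) (snd p) i)) {1..fst p}
            = \<bar>bhat (fst p) (snd p) - \<beta>\<bar> * L2_set (wt (fst p) (snd p)) {1..fst p}"
          by (simp add: L2_set_def power_mult_distrib real_sqrt_mult flip: sum_distrib_left)
        also have "\<dots> = \<bar>(\<Sum>i=1..fst p. res (fst p) (snd p) i) * R (fst p) (snd p)\<bar>"
          unfolding elim R_def by (simp add: abs_mult abs_divide L2_set_nonneg)
        finally show ?case
          by simp
      qed
    qed
    show "likely (\<lambda>n \<omega>. real n * num n \<omega>
        / sqrt (\<Sum>i=1..n. (res n \<omega> i - (bhat n \<omega> - \<beta>) * wt n \<omega> i)\<^sup>2)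
        = 1 * (\<Sum>i=1..n. res n \<omega> i)
          / L2_set (\<lambda>i. res n \<omega> i - (bhat n \<omega> - \<beta>) * wt n \<omega> i) {1..n})"
      using numer by eventually_elim (simp add: L2_set_def)
  qed measurable
qed

text \<open>
  The same for data that satisfy the defining relations from \<open>n = 1\<close> on. For \<open>n = 0\<close> all statistics are
  \<open>0\<close>.
\<close>
lemma statistics_limits:
  assumes bhat: "\<And>n. bhat n \<in> borel_measurable M"
    and est: "likely (\<lambda>n \<omega>. bhat n \<omega> - \<beta>
      = (\<Sum>i=1..n. res n \<omega> i) / (\<Sum>i=1..n. wt n \<omega> i))"
    and U: "\<And>n \<omega>. 0 < n \<Longrightarrow> Uf n \<omega> = (\<Sum>i=1..n. wt n \<omega> i) / real n"
    and u: "\<And>n \<omega> i. i \<in> {1..n} \<Longrightarrow> u n \<omega> i = res n \<omega> i"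
    and ut: "\<And>n \<omega> i. i \<in> {1..n} \<Longrightarrow> ut n \<omega> i = res n \<omega> i - (bhat n \<omega> - \<beta>) * wt n \<omega> i"
  shows "conv_std_normal (\<lambda>n \<omega>. sqrt (real n) * Uf n \<omega> * (bhat n \<omega> - \<beta>)
           / sqrt ((\<Sum>i=1..n. (u n \<omega> i - smean n (u n \<omega>))\<^sup>2) / (real n - 1)))
       \<and> conv_std_normal (\<lambda>n \<omega>. real n * Uf n \<omega> * (bhat n \<omega> - \<beta>) / sqrt (\<Sum>i=1..n. (u n \<omega> i)\<^sup>2))
       \<and> conv_std_normal (\<lambda>n \<omega>. real n * Uf n \<omega> * (bhat n \<omega> - \<beta>) / sqrt (\<Sum>i=1..n. (ut n \<omega> i)\<^sup>2))"
proof -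
  have sm: "smean n (u n \<omega>) = smean n (res n \<omega>)" for n \<omega>
    using u by (simp add: smean_def)
  have eq: "sqrt (real n) * Uf n \<omega> * (bhat n \<omega> - \<beta>)
           / sqrt ((\<Sum>i=1..n. (u n \<omega> i - smean n (u n \<omega>))\<^sup>2) / (real n - 1))
      = sqrt (real n) * ((\<Sum>i=1..n. wt n \<omega> i) / real n * (bhat n \<omega> - \<beta>))
           / sqrt ((\<Sum>i=1..n. (res n \<omega> i - smean n (res n \<omega>))\<^sup>2) / (real n - 1))"
    "real n * Uf n \<omega> * (bhat n \<omega> - \<beta>) / sqrt (\<Sum>i=1..n. (u n \<omega> i)\<^sup>2)
      = real n * ((\<Sum>i=1..n. wt n \<omega> i) / real n * (bhat n \<omega> - \<beta>)) / sqrt (\<Sum>i=1..n. (res n \<omega> i)\<^sup>2)"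
    "real n * Uf n \<omega> * (bhat n \<omega> - \<beta>) / sqrt (\<Sum>i=1..n. (ut n \<omega> i)\<^sup>2)
      = real n * ((\<Sum>i=1..n. wt n \<omega> i) / real n * (bhat n \<omega> - \<beta>))
        / sqrt (\<Sum>i=1..n. (res n \<omega> i - (bhat n \<omega> - \<beta>) * wt n \<omega> i)\<^sup>2)" for n \<omega>
    using U u ut by (cases "n = 0"; simp add: sm mult.assoc)+
  show ?thesis
    unfolding eq by (intro conjI self_normalized_estimator bhat est)
qed

end

section \<open>The theorem\<close>

lemma sprod_cong: "(\<And>i. 1 \<le> i \<Longrightarrow> u i = u' i) \<Longrightarrow> (\<And>i. 1 \<le> i \<Longrightarrow> v i = v' i) \<Longrightarrow> 1 \<le> i
    \<Longrightarrow> sprod c n u v i = sprod c n u' v' i"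
  unfolding sprod_def smean_def by simp

text \<open>
  The model equations hold for indices \<open>i \<ge> 1\<close> only, so measurability of the estimator is shown for
  data that satisfy them at all indices; sample moments do not see the difference.
\<close>
lemma S_cong:
  assumes "\<And>i. 1 \<le> i \<Longrightarrow> u i = u' i" "\<And>i. 1 \<le> i \<Longrightarrow> v i = v' i"
  shows "S c n u v = S c n u' v'"
proof -
  have "sprod c n u v i = sprod c n u' v' i" if "i \<in> {1..n}" for i
    using assms that by (intro sprod_cong) auto
  thus ?thesis
    unfolding S_def smean_def[of n "sprod c n u v"] smean_def[of n "sprod c n u' v'"] by simp
qed

lemma S_minus_const: "0 < n \<Longrightarrow> S c n u v - m = (\<Sum>i=1..n. sprod c n u v i - m) / real n"
  by (simp add: S_def smean_def sum_subtractf field_simps)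

theorem theorem2:
  fixes M :: "'a measure"
    and \<delta> \<epsilon> \<xi> :: "nat \<Rightarrow> 'a \<Rightarrow> real"
    and x y :: "'a \<Rightarrow> nat \<Rightarrow> real"
    and \<alpha> \<beta> c lam th mu :: real
    and j :: nat
    and bhat :: "nat \<Rightarrow> 'a \<Rightarrow> real"
    and u ut :: "nat \<Rightarrow> 'a \<Rightarrow> nat \<Rightarrow> real"
  assumes prob: "prob_space M"
    \<comment> \<open>(A); index 0 carries the generic copies of the error vector and of \<open>\<xi>\<close>\<close>
    and A_iid: "prob_space.iid M (borel \<Otimes>\<^sub>M borel) (\<lambda>i \<omega>. (\<delta> i \<omega>, \<epsilon> i \<omega>))"
    and A_mom4: "integrable M (\<lambda>\<omega>. \<delta> 0 \<omega> ^ 4)" "integrable M (\<lambda>\<omega>. \<epsilon> 0 \<omega> ^ 4)"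
    and A_mean: "prob_space.expectation M (\<delta> 0) = 0" "prob_space.expectation M (\<epsilon> 0) = 0"
    and A_cov: "prob_space.variance M (\<delta> 0) = lam * th" "prob_space.variance M (\<epsilon> 0) = th"
      "prob_space.covariance M (\<delta> 0) (\<epsilon> 0) = mu"
    and A_pd: "pos_def (vector [vector [lam * th, mu], vector [mu, th]] :: real ^ 2 ^ 2)"
    \<comment> \<open>(B)\<close>
    and B_iid: "prob_space.iid M borel \<xi>"
    and B_DAN: "prob_space.DAN M \<xi>"
    \<comment> \<open>(C)\<close>
    and C_indep: "prob_space.indep_rv M
      (\<Pi>\<^sub>M i\<in>UNIV. borel \<Otimes>\<^sub>M borel) (\<lambda>\<omega> i. (\<delta> i \<omega>, \<epsilon> i \<omega>))
      (\<Pi>\<^sub>M i\<in>UNIV. borel) (\<lambda>\<omega> i. \<xi> i \<omega>)"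
    \<comment> \<open>the model\<close>
    and y_eq: "\<And>i \<omega>. i \<ge> 1 \<Longrightarrow> y \<omega> i = \<beta> * \<xi> i \<omega> + \<alpha> + \<delta> i \<omega>"
    and x_eq: "\<And>i \<omega>. i \<ge> 1 \<Longrightarrow> x \<omega> i = \<xi> i \<omega> + \<epsilon> i \<omega>"
    and intercept: "(c = 0 \<and> \<alpha> = 0) \<or> c = 1"
    and j: "j \<in> {1, 2}"
    \<comment> \<open>for \<open>j = 1\<close> and \<open>\<beta> = 0\<close> the estimator is undefined with probability not tending to 0\<close>
    and slope: "j = 1 \<Longrightarrow> \<beta> \<noteq> 0"
  defines "bhat \<equiv> \<lambda>n \<omega>. beta_hat j c lam th mu n (x \<omega>) (y \<omega>)"
  defines "u \<equiv> \<lambda>n \<omega>. u_resid j c lam th mu \<beta> n (x \<omega>) (y \<omega>)"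
    and "ut \<equiv> \<lambda>n \<omega>. u_resid j c lam th mu (bhat n \<omega>) n (x \<omega>) (y \<omega>)"
  shows "prob_space.conv_std_normal M (\<lambda>n \<omega>.
           sqrt (real n) * U j c th mu n (x \<omega>) (y \<omega>) * (bhat n \<omega> - \<beta>)
           / sqrt ((\<Sum>i=1..n. (u n \<omega> i - smean n (u n \<omega>))\<^sup>2) / (real n - 1)))
       \<and> prob_space.conv_std_normal M (\<lambda>n \<omega>.
           real n * U j c th mu n (x \<omega>) (y \<omega>) * (bhat n \<omega> - \<beta>)
           / sqrt (\<Sum>i=1..n. (u n \<omega> i)\<^sup>2))
       \<and> prob_space.conv_std_normal M (\<lambda>n \<omega>.
           real n * U j c th mu n (x \<omega>) (y \<omega>) * (bhat n \<omega> - \<beta>)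
           / sqrt (\<Sum>i=1..n. (ut n \<omega> i)\<^sup>2))"
proof -
  interpret prob_space M
    by (rule prob)
  define err where "err i \<omega> = (\<delta> i \<omega>, \<epsilon> i \<omega>)" for i \<omega>
  have indep_err: "indep_vars (\<lambda>_. borel \<Otimes>\<^sub>M borel) err UNIV"
    using A_iid by (simp add: iid_def err_def[abs_def])
  have [measurable]: "err i \<in> M \<rightarrow>\<^sub>M borel \<Otimes>\<^sub>M borel" for i
    using indep_err by (auto simp: indep_vars_def)
  interpret eiv M \<xi> err
    by unfold_locales
      (use A_iid A_mom4 A_mean B_iid B_DAN C_indep in \<open>simp_all add: err_def[abs_def]\<close>)
  have sq: "lin_cov 1 0 1 0 = lam * th" "lin_cov 0 1 0 1 = th" "lin_cov 1 0 0 1 = mu" "lin_cov 0 1 1 0 = mu"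
    using A_cov A_mean by (simp_all add: lin_cov_def lin_def err_def covariance_def power2_eq_square mult.commute)
  have cov_lin: "lin_cov k l 1 (- \<beta>) = lin_cov k l 1 0 - \<beta> * lin_cov k l 0 1" for k l
  proof -
    have "lin k l e * lin 1 (- \<beta>) e = lin k l e * lin 1 0 e - \<beta> * (lin k l e * lin 0 1 e)" for e
      by (simp add: lin_def algebra_simps)
    thus ?thesis
      unfolding lin_cov_def using integrable_lin_mult by simp
  qed
  (* Var(\<delta> - \<beta>\<epsilon>) is the quadratic form of the covariance matrix at (1, -\<beta>) *)
  have nondeg: "0 < lin_cov 1 (- \<beta>) 1 (- \<beta>)"
  proof -
    let ?v = "vector [1, - \<beta>] :: real ^ 2"
    have "?v \<noteq> 0"
      by (metis vector_2(1) zero_index zero_neq_one)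
    hence "0 < ?v \<bullet> ((vector [vector [lam * th, mu], vector [mu, th]] :: real ^ 2 ^ 2) *v ?v)"
      using A_pd by (auto simp: pos_def_def)
    hence "0 < lam * th - 2 * \<beta> * mu + \<beta> * \<beta> * th"
      by (simp add: inner_vec_def matrix_vector_mult_def sum_2 algebra_simps)
    moreover have "lin_cov 1 (- \<beta>) 1 (- \<beta>) = lam * th - 2 * \<beta> * mu + \<beta> * \<beta> * th"
    proof -
      have "lin 1 (- \<beta>) e * lin 1 (- \<beta>) e = lin 1 0 e * lin 1 0 e - (2 * \<beta>) * (lin 1 0 e * lin 0 1 e)
          + (\<beta> * \<beta>) * (lin 0 1 e * lin 0 1 e)" for e
        by (simp add: lin_def algebra_simps)
      hence "lin_cov 1 (- \<beta>) 1 (- \<beta>) = lin_cov 1 0 1 0 - 2 * \<beta> * lin_cov 1 0 0 1 + \<beta> * \<beta> * lin_cov 0 1 0 1"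
        unfolding lin_cov_def using integrable_lin_mult by simp
      thus ?thesis
        by (simp add: sq)
    qed
    ultimately show ?thesis
      by simp
  qed
  have c01: "c = 0 \<or> c = 1" and \<alpha>c: "\<alpha> = c * \<alpha>"
    using intercept by auto
  (* where the estimator is undefined it has a constant value, so it is measurable everywhere *)
  have bhat_m: "bhat n \<in> borel_measurable M" for n
  proof -
    define X where "X \<omega> i = \<xi> i \<omega> + snd (err i \<omega>)" for \<omega> i
    define Y where "Y \<omega> i = \<beta> * \<xi> i \<omega> + \<alpha> + fst (err i \<omega>)" for \<omega> i
    have eqs: "S c n (y \<omega>) (y \<omega>) = S c n (Y \<omega>) (Y \<omega>)" "S c n (x \<omega>) (y \<omega>) = S c n (X \<omega>) (Y \<omega>)"
      "S c n (x \<omega>) (x \<omega>) = S c n (X \<omega>) (X \<omega>)" for \<omega>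
      by (intro S_cong; simp add: X_def Y_def x_eq y_eq err_def)+
    have [measurable]: "(\<lambda>\<omega>. X \<omega> i) \<in> borel_measurable M" "(\<lambda>\<omega>. Y \<omega> i) \<in> borel_measurable M" for i
      unfolding X_def Y_def by measurable
    have [measurable]: "(\<lambda>\<omega>. S c n (Y \<omega>) (Y \<omega>)) \<in> borel_measurable M"
      "(\<lambda>\<omega>. S c n (X \<omega>) (Y \<omega>)) \<in> borel_measurable M" "(\<lambda>\<omega>. S c n (X \<omega>) (X \<omega>)) \<in> borel_measurable M"
      unfolding S_def sprod_def smean_def by measurable
    show ?thesis
      unfolding bhat_def beta_hat_def eqs by measurable
  qed
  have x_cen: "x \<omega> i - c * smean n (x \<omega>) = (\<xi> i \<omega> - c * smean n (\<lambda>i. \<xi> i \<omega>)) + lin 0 1 (err i \<omega>)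
      - c * smean n (\<lambda>i. lin 0 1 (err i \<omega>))" if "1 \<le> i" for \<omega> i n
    using that by (simp add: smean_def x_eq sum.distrib lin_def err_def add_divide_distrib algebra_simps)
  have y_cen: "y \<omega> i - c * smean n (y \<omega>) = \<beta> * (\<xi> i \<omega> - c * smean n (\<lambda>i. \<xi> i \<omega>)) + lin 1 0 (err i \<omega>)
      - c * smean n (\<lambda>i. lin 1 0 (err i \<omega>))" if "1 \<le> i" "0 < n" for \<omega> i n
  proof -
    have "smean n (y \<omega>) = \<beta> * smean n (\<lambda>i. \<xi> i \<omega>) + \<alpha> + smean n (\<lambda>i. lin 1 0 (err i \<omega>))"
      using that by (simp add: smean_def y_eq sum.distrib lin_def err_def add_divide_distrib sum_distrib_left)
    thus ?thesis
      using that \<alpha>c by (simp add: y_eq lin_def err_def algebra_simps)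
  qed
  (* both cases at once: z is the variable that is multiplied by y - \<beta>x in the estimating equation *)
  define g k l where "g = (if j = 1 then \<beta> else 1)" and "k = (if j = 1 then 1 else 0 :: real)"
    and "l = (if j = 1 then 0 else 1 :: real)"
  define z where "z = (if j = 1 then y else x)"
  note jcase = g_def k_def l_def z_def
  have j12: "j = 1 \<or> j = 2"
    using j by auto
  interpret eiv_score M \<xi> err g k l \<beta> c
    by unfold_locales (use slope c01 nondeg in \<open>auto simp: g_def\<close>)
  have yo: "y \<omega> i - c * smean n (y \<omega>) = obs \<beta> 1 0 n \<omega> i"
    and xo: "x \<omega> i - c * smean n (x \<omega>) = obs 1 0 1 n \<omega> i" if "i \<in> {1..n}" for \<omega> i n
    using that y_cen[of i n \<omega>] x_cen[of i \<omega> n] by (simp_all add: obs_def cen_def emean_def)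
  hence zo: "z \<omega> i - c * smean n (z \<omega>) = obs g k l n \<omega> i" if "i \<in> {1..n}" for \<omega> i n
    using that by (simp add: jcase)
  have szx: "sprod c n (z \<omega>) (x \<omega>) i - lin_cov k l 0 1 = wt n \<omega> i"
    and szy: "sprod c n (z \<omega>) (y \<omega>) i - lin_cov k l 1 0 = cross (g, k, l) (\<beta>, 1, 0) n \<omega> i"
    and szz: "sprod c n (z \<omega>) (z \<omega>) i - lin_cov k l k l = cross (g, k, l) (g, k, l) n \<omega> i"
    if "i \<in> {1..n}" for \<omega> i n
    using that by (simp_all add: sprod_def xo yo zo wt_def cross_eq)
  have res_eq: "res n \<omega> i = cross (g, k, l) (\<beta>, 1, 0) n \<omega> i - \<beta> * wt n \<omega> i" for n \<omega> i
    by (simp add: res_def wt_def cross_eq obs_diff cov_lin algebra_simps)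
  have sprod_commute: "sprod c n a b i = sprod c n b a i" for n a b i
    by (simp add: sprod_def mult.commute)
  hence S_commute: "S c n a b = S c n b a" for n a b
    by (simp add: S_def smean_def)
  have Sw: "S c n (z \<omega>) (x \<omega>) - lin_cov k l 0 1 = (\<Sum>i=1..n. wt n \<omega> i) / real n" if "0 < n" for n \<omega>
    using szx by (simp add: S_minus_const[OF that])
  have Uw: "U j c th mu n (x \<omega>) (y \<omega>) = (\<Sum>i=1..n. wt n \<omega> i) / real n" if "0 < n" for n \<omega>
    using j12 unfolding Sw[OF that, symmetric] U_def by (auto simp: jcase sq S_commute)
  have ures: "u_resid j c lam th mu b n (x \<omega>) (y \<omega>) i = res n \<omega> i - (b - \<beta>) * wt n \<omega> i"
    if "i \<in> {1..n}" for b n \<omega> i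
  proof -
    have "u_resid j c lam th mu b n (x \<omega>) (y \<omega>) i
        = (sprod c n (z \<omega>) (y \<omega>) i - lin_cov k l 1 0) - b * (sprod c n (z \<omega>) (x \<omega>) i - lin_cov k l 0 1)"
      using j12 by (auto simp: u_resid_def jcase sq sprod_commute)
    thus ?thesis
      unfolding szx[OF that] szy[OF that] res_eq by (simp add: algebra_simps)
  qed
  (* for j = 1 this is the condition on S_yy, for j = 2 the one on S_xx; in both cases z is the variable in question *)
  have pos: "likely (\<lambda>n \<omega>. 0 < S c n (z \<omega>) (z \<omega>) - lin_cov k l k l)"
  proof -
    have "likely (\<lambda>n \<omega>. 0 < (\<Sum>i=1..n. cross (g, k, l) (g, k, l) n \<omega> i) / ss n (Xi \<omega>))"
      by (rule order_tendstoD(1)[OF cross_sum_ratio]) (use g in \<open>auto simp: zero_less_mult_iff\<close>)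
    thus ?thesis
      using eventually_ss_pos eventually_whp_fst[OF eventually_gt_at_top[of 0]]
      by eventually_elim (simp add: S_minus_const szz zero_less_divide_iff)
  qed
  have est: "likely (\<lambda>n \<omega>. bhat n \<omega> - \<beta>
    = (\<Sum>i=1..n. res n \<omega> i) / (\<Sum>i=1..n. wt n \<omega> i))"
    using pos wt_sum_nonzero eventually_whp_fst[OF eventually_gt_at_top[of 0]]
  proof eventually_elim
    case (elim p)
    obtain n \<omega> where p: "p = (n, \<omega>)"
      by (cases p)
    have n: "0 < n" and w: "(\<Sum>i=1..n. wt n \<omega> i) \<noteq> 0"
      and v: "0 < S c n (z \<omega>) (z \<omega>) - lin_cov k l k l"
      using elim by (auto simp: p)
    have "S c n (z \<omega>) (x \<omega>) - lin_cov k l 0 1 \<noteq> 0"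
      using w n by (simp add: Sw[OF n])
    hence "bhat n \<omega> = (S c n (z \<omega>) (y \<omega>) - lin_cov k l 1 0) / (S c n (z \<omega>) (x \<omega>) - lin_cov k l 0 1)"
      using j12 v unfolding bhat_def beta_hat_def by (auto simp: jcase sq S_commute)
    also have "\<dots> = (\<Sum>i=1..n. cross (g, k, l) (\<beta>, 1, 0) n \<omega> i) / (\<Sum>i=1..n. wt n \<omega> i)"
      using n szy by (simp add: Sw[OF n] S_minus_const[OF n, of c "z \<omega>" "y \<omega>"])
    finally have "bhat n \<omega> - \<beta> = (\<Sum>i=1..n. res n \<omega> i) / (\<Sum>i=1..n. wt n \<omega> i)"
      unfolding res_eq using w by (simp add: sum_subtractf diff_divide_distrib flip: sum_distrib_left)
    thus ?case
      by (simp add: p)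
  qed
  show ?thesis
  proof (rule statistics_limits[OF bhat_m est])
    show "U j c th mu n (x \<omega>) (y \<omega>) = (\<Sum>i=1..n. wt n \<omega> i) / real n" if "0 < n" for n \<omega>
      by (rule Uw[OF that])
    show "u n \<omega> i = res n \<omega> i" if "i \<in> {1..n}" for n \<omega> i
      unfolding u_def ures[OF that] by simp
    show "ut n \<omega> i = res n \<omega> i - (bhat n \<omega> - \<beta>) * wt n \<omega> i" if "i \<in> {1..n}" for n \<omega> i
      unfolding ut_def by (rule ures[OF that])
  qed
qed

end
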